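(* In the causal inference setting of the context, assume: (i) $N\to\infty$, $\bar\pi_N\to0$, $N\bar\pi_N\to\infty$; for all $x\in\mathcal X$, $c\bar\pi_N<\pi_N(x),e_N(x)<C\bar\pi_N$ for some $c,C>0$; with $\varepsilon=Y-Rm_1(X)-(1-R)m_0(X)$, $\|\varepsilon\|_{2,\mathbb P}<\infty$, $\|m_0(\cdot)-\mu_0(\cdot)\|_{2,\mathbb P_X}<C<\infty$, $\mathrm{Var}\{m_0(X)\}<\infty$; and $\|\hat m_0(\cdot)-\mu_0(\cdot)\|_{2,\mathbb P_X}=O_p(r_{\mu,0,N})$, $\sup_{x\in\mathcal X}|\{\hat\pi_N(x)-e_N(x)\}/\bar\pi_N|=O_p(r_{e,N})$ with positive $r_{\mu,0,N}=o(1)$, $r_{e,N}=o(1)$; (ii) at least one of $e_N(\cdot)=\pi_N(\cdot)$ and $\mu_1(\cdot)=m_1(\cdot)$ holds; for every $k\le\mathbb K$, $\|\hat m_1(\cdot;\mathbb S_{-k})-\mu_1(\cdot)\|_{2,\mathbb P_X}=O_p(r_{\mu,1,N})$ with $r_{\mu,1,N}=o(1)$, $\mathbb E_X\big[\frac{a_N}{\pi_N(X)}\{\hat m_1(X;\mathbb S_{-k})-\mu_1(X)\}^2\big]=o_p(1)$, $\mathbb E_X\big[\frac{a_N}{\pi_N(X)}\{1-\frac{e_N(X)}{\hat\pi_N(X;\mathbb S_{-k})}\}^2\big]=o_p(1)$ and $\mathbb E_X\{1-\frac{e_N(X)}{\hat\pi_N(X;\mathbb S_{-k})}\}^2=O_p(r_{e,N}^2)$;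 and, for a constant $C<\infty$, $\|m_1(\cdot)-\mu_1(\cdot)\|_{2,\mathbb P_X}<C$ if $e_N=\pi_N$, and $\|1-\pi_N(\cdot)/e_N(\cdot)\|_{2,\mathbb P_X}<C$ if $\mu_1=m_1$. Then $$\hat\theta_{\mathrm{ATE}}-\theta_{\mathrm{ATE}}=N^{-1}\sum_{i=1}^N\psi_1(Z_i)+\hat\Delta_N+O_p(r_{e,N}r_{\mu,1,N}+\bar\pi_Nr_{e,N}r_{\mu,0,N})$$ $$+\mathbf 1\{m_0(\cdot)\ne\mu_0(\cdot)\}O_p(\bar\pi_Nr_{e,N})+\mathbf 1\{e_N(\cdot)\ne\pi_N(\cdot)\}O_p(\bar\pi_Nr_{\mu,0,N})$$ $$+\mathbf 1\{e_N(\cdot)\ne\pi_N(\cdot),\ \mu_0(\cdot)\ne m_0(\cdot)\}O_p(\bar\pi_N)+o_p\big((N\bar\pi_N)^{-1/2}\big),$$ where $\psi_1(Z)=\mu_1(X)-\theta^1+\frac{R}{e_N(X)}\{Y-\mu_1(X)\}$, with $\mathbb E\{\psi_1(Z)\}=0$, $\mathbb E\{\psi_1^2(Z)\}\asymp\bar\pi_N^{-1}$, and $$\hat\Delta_N=\frac1N\sum_{i=1}^N\Big\{\frac{R_i}{\pi_N(X_i)}-\frac{R_i}{\hat\pi_N(X_i)}\Big\}\{\mu_1(X_i)-m_1(X_i)\}=O_p(r_{e,N})\quad\text{if }e_N(\cdot)=\pi_N(\cdot),$$ $$\hat\Delta_N=\frac1N\sum_{i=1}^N\Big\{\frac{R_i}{\pi_N(X_i)}-\frac{R_i}{e_N(X_i)}\Big\}\{\hat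 m_1(X_i)-m_1(X_i)\}=O_p(r_{\mu,1,N})\quad\text{if }\mu_1(\cdot)=m_1(\cdot).$$ Moreover, if $r_{e,N}r_{\mu,1,N}=o((N\bar\pi_N)^{-1/2})$, then $$\hat\theta_{\mathrm{ATE}}-\theta_{\mathrm{ATE}}=N^{-1}\sum_{i=1}^N\psi_1(Z_i)+o_p\big((N\bar\pi_N)^{-1/2}\big)+\hat\Delta_N$$ as long as one of the following holds: (a) $m_0$ and $\pi_N$ are both correctly specified ($\mu_0=m_0$, $e_N=\pi_N$) and $r_{e,N}r_{\mu,0,N}=o(N^{-1/2}\bar\pi_N^{-3/2})$; or (b) $\pi_N$ is correctly specified, $m_0$ is misspecified, and $r_{e,N}=o(N^{-1/2}\bar\pi_N^{-3/2})$; or (c) $m_0$ is correctly specified, $\pi_N$ is misspecified, and $r_{\mu,0,N}=o(N^{-1/2}\bar\pi_N^{-3/2})$; or (d) $m_0$ and $\pi_N$ are both misspecified, and $N\bar\pi_N^3=o(1)$.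
   Context: Setting. For each $N$, $\mathbb S=\{Z_i=(R_i,Y_i,X_i)\}_{i=1}^N$ are i.i.d. copies of $Z=(R,Y,X)$, where $R\in\{0,1\}$ is a treatment indicator whose law may depend on $N$, $X\in\mathbb R^p$ has law $\mathbb P_X$ and support $\mathcal X$, and $Y=R\,\mathrm Y(1)+(1-R)\mathrm Y(0)$ with potential outcomes $\mathrm Y(0),\mathrm Y(1)\in\mathbb R$. Unconfoundedness: $\{\mathrm Y(0),\mathrm Y(1)\}\perp\!\!\!\perp R\mid X$. $\theta^r=\mathbb E\{\mathrm Y(r)\}$ for $r\in\{0,1\}$, $\theta_{\mathrm{ATE}}=\theta^1-\theta^0$, $m_r(x)=\mathbb E(Y\mid R=r,X=x)=\mathbb E\{\mathrm Y(r)\mid X=x\}$, $\pi_N(x)=\mathbb P(R=1\mid X=x)$, $\bar\pi_N=\mathbb P(R=1)$, $a_N=[\mathbb E\{\pi_N^{-1}(X)\}]^{-1}$ (under (i), $a_N\asymp\bar\pi_N$). Basic Assumption, in force for both $r=0$ and $r=1$: $Z$ and $\mathrm Y(r)$ have finite second moments, $\mathrm{Var}(X)$ is positive definite, and there are constants $0<\sigma_{\zeta,1}^2,\sigma_{\zeta,2}^2<\infty$ independent of $N$ with $\mathbb E[\{\mathrm Y(r)-m_r(X)\}^2\mid X=x]\ge\sigma_{\zeta,1}^2$ and $\mathbb E[\{\mathrm Y(r)-\mu_r(X)\}^2\mid X=x]\le\sigma_{\zeta,2}^2$ for all $x\in\mathcal X$, and $\mathrm{Var}\{\mathrm Y(r)\}\le\sigma_{\zeta,2}^2$.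 Estimators. For a fixed integer $\mathbb K\ge2$, $\{\mathcal I_k\}_{k=1}^{\mathbb K}$ is a random partition of $\{1,\dots,N\}$ (independent of the data); $\mathbb S_{-k}=\{Z_i:i\notin\mathcal I_k\}$; $\hat m_r(\cdot)=\hat m_r(\cdot;\mathbb S_{-k})$ ($r=0,1$) and $\hat\pi_N(\cdot)=\hat\pi_N(\cdot;\mathbb S_{-k})$ are estimators of $m_r$, $\pi_N$ built from $\mathbb S_{-k}$, evaluated at $X_i$ with the $k$ such that $i\in\mathcal I_k$; $$\hat\theta^1=\frac1N\sum_{i=1}^N\Big[\hat m_1(X_i)+\frac{R_i}{\hat\pi_N(X_i)}\{Y_i-\hat m_1(X_i)\}\Big],\quad \hat\theta^0=\frac1N\sum_{i=1}^N\Big[\hat m_0(X_i)+\frac{1-R_i}{1-\hat\pi_N(X_i)}\{Y_i-\hat m_0(X_i)\}\Big],$$ and $\hat\theta_{\mathrm{ATE}}=\hat\theta^1-\hat\theta^0$. $\mu_0,\mu_1,e_N$ are nonrandom functions (possibly misspecified limits of $\hat m_0,\hat m_1,\hat\pi_N$). $\mathbb E_X$, $\|f\|_{2,\mathbb P_X}$ are taken over an independent copy of $X$ with estimators held fixed; moment bounds are uniform in $N$. $u_N\asymp v_N$ means equality up to constant factors for large $N$. *)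

theory Defs
  imports "HOL-Probability.Probability" "HOL-Library.Landau_Symbols"
begin

section \<open>Stochastic orders\<close>

text \<open>
  The variables take values in the extended reals, because \<open>L\<^sub>2\<close>-errors and suprema of estimators
  may be infinite. The tail events enter through their outer probability: a supremum over an
  uncountable set need not be measurable, and the measure of a non-measurable set is \<open>0\<close> in HOL.
  For random variables this is the ordinary probability.
\<close>

definition bigOp :: "(nat \<Rightarrow> 'w measure) \<Rightarrow> (nat \<Rightarrow> 'w \<Rightarrow> ereal) \<Rightarrow> (nat \<Rightarrow> real) \<Rightarrow> bool" where
  "bigOp M W r \<longleftrightarrow>
    (\<forall>\<epsilon>::real. \<epsilon> > 0 \<longrightarrow> (\<exists>K::real. K > 0 \<and>
      (\<forall>\<^sub>F N in sequentially.
        outer_measure_of (M N) {\<omega> \<in> space (M N). \<bar>W N \<omega>\<bar> > ereal (K * r N)} \<le> ennreal \<epsilon>)))"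

definition littleop :: "(nat \<Rightarrow> 'w measure) \<Rightarrow> (nat \<Rightarrow> 'w \<Rightarrow> ereal) \<Rightarrow> (nat \<Rightarrow> real) \<Rightarrow> bool" where
  "littleop M W r \<longleftrightarrow>
    (\<forall>\<delta>::real. \<delta> > 0 \<longrightarrow>
      (\<lambda>N. outer_measure_of (M N) {\<omega> \<in> space (M N). \<bar>W N \<omega>\<bar> > ereal (\<delta> * r N)})
        \<longlonglongrightarrow> 0)"

section \<open>Norms, supports, covariance\<close>

text \<open>The value is \<open>\<infinity>\<close> off \<open>L\<^sub>2\<close>, where the Bochner integral would give \<open>0\<close>.\<close>

definition L2norm :: "'a measure \<Rightarrow> ('a \<Rightarrow> real) \<Rightarrow> ereal" where
  "L2norm M f =
    (if integrable M (\<lambda>x. (f x)\<^sup>2) then ereal (sqrt (\<integral>x. (f x)\<^sup>2 \<partial>M)) else \<infinity>)"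

definition law_support :: "'a::topological_space measure \<Rightarrow> 'a set" where
  "law_support P = {x. \<forall>U. open U \<and> x \<in> U \<longrightarrow> emeasure P U > 0}"

definition covariance_matrix :: "'q measure \<Rightarrow> ('q \<Rightarrow> real^'p) \<Rightarrow> real^'p^'p" where
  "covariance_matrix Q X =
    (\<chi> i j. \<integral>\<omega>. (X \<omega> $ i - (\<integral>\<omega>'. X \<omega>' $ i \<partial>Q)) * (X \<omega> $ j - (\<integral>\<omega>'. X \<omega>' $ j \<partial>Q)) \<partial>Q)"

definition pos_def_matrix :: "real^'p^'p \<Rightarrow> bool" where
  "pos_def_matrix A \<longleftrightarrow> transpose A = A \<and> (\<forall>v. v \<noteq> 0 \<longrightarrow> v \<bullet> (A *v v) > 0)"

section \<open>Conditioning on a random vector\<close>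

definition sigma_of :: "'q measure \<Rightarrow> ('q \<Rightarrow> 'x::topological_space) \<Rightarrow> 'q measure" where
  "sigma_of Q X = vimage_algebra (space Q) X borel"

text \<open>\<open>g\<close> is a version of \<open>x \<mapsto> E(W | X = x)\<close>.\<close>

definition is_cond_mean ::
  "'q measure \<Rightarrow> ('q \<Rightarrow> 'x::topological_space) \<Rightarrow> ('q \<Rightarrow> real) \<Rightarrow> ('x \<Rightarrow> real) \<Rightarrow> bool" where
  "is_cond_mean Q X W g \<longleftrightarrow> integrable Q W \<and> g \<in> borel_measurable borel \<and>
    (AE \<omega> in Q. real_cond_exp Q (sigma_of Q X) W \<omega> = g (X \<omega>))"

definition cond_indep ::
  "'q measure \<Rightarrow> ('q \<Rightarrow> 'a::topological_space) \<Rightarrow> ('q \<Rightarrow> 'b::topological_space) \<Rightarrow>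
    ('q \<Rightarrow> 'x::topological_space) \<Rightarrow> bool" where
  "cond_indep Q V W X \<longleftrightarrow>
    (\<forall>A\<in>sets borel. \<forall>B\<in>sets borel. AE \<omega> in Q.
      real_cond_exp Q (sigma_of Q X) (\<lambda>\<omega>. of_bool (V \<omega> \<in> A \<and> W \<omega> \<in> B)) \<omega> =
      real_cond_exp Q (sigma_of Q X) (\<lambda>\<omega>. of_bool (V \<omega> \<in> A)) \<omega> *
      real_cond_exp Q (sigma_of Q X) (\<lambda>\<omega>. of_bool (W \<omega> \<in> B)) \<omega>)"

section \<open>Population model\<close>

type_synonym 'p obs = "real \<times> real \<times> (real^'p)"

abbreviation obsR :: "'p obs \<Rightarrow> real" where "obsR z \<equiv> fst z"
abbreviation obsY :: "'p obs \<Rightarrow> real" where "obsY z \<equiv> fst (snd z)"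
abbreviation obsX :: "'p obs \<Rightarrow> real^'p" where "obsX z \<equiv> snd (snd z)"

definition observation ::
  "(nat \<Rightarrow> 'q \<Rightarrow> real) \<Rightarrow> ('q \<Rightarrow> real) \<Rightarrow> ('q \<Rightarrow> real^'p) \<Rightarrow> 'q \<Rightarrow> 'p obs" where
  "observation Yp R X \<omega> = (R \<omega>, R \<omega> * Yp 1 \<omega> + (1 - R \<omega>) * Yp 0 \<omega>, X \<omega>)"

text \<open>
  \<open>Yp 0\<close>, \<open>Yp 1\<close> are the potential outcomes. Only the treatment indicator \<open>R N\<close> depends on
  the sample size \<open>N\<close>. By unconfoundedness, \<open>m r\<close> is also the regression of the observed outcome
  on \<open>X\<close> in the group \<open>R = r\<close>, wherever that group has positive conditional probability.
\<close>

definition causal_model ::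
  "'q measure \<Rightarrow> ('q \<Rightarrow> real^'p) \<Rightarrow> (nat \<Rightarrow> 'q \<Rightarrow> real) \<Rightarrow> (nat \<Rightarrow> 'q \<Rightarrow> real) \<Rightarrow>
    (nat \<Rightarrow> real^'p \<Rightarrow> real) \<Rightarrow> (nat \<Rightarrow> real^'p \<Rightarrow> real) \<Rightarrow> bool" where
  "causal_model Q X Yp R m \<pi> \<longleftrightarrow>
    prob_space Q \<and> X \<in> borel_measurable Q \<and>
    (\<forall>r\<in>{0,1}. Yp r \<in> borel_measurable Q) \<and>
    (\<forall>N\<ge>1. R N \<in> borel_measurable Q \<and> (\<forall>\<omega>\<in>space Q. R N \<omega> \<in> {0, 1}) \<and>
      cond_indep Q (\<lambda>\<omega>. (Yp 0 \<omega>, Yp 1 \<omega>)) (R N) X \<and>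
      is_cond_mean Q X (\<lambda>\<omega>. of_bool (R N \<omega> = 1)) (\<pi> N)) \<and>
    (\<forall>r\<in>{0,1}. is_cond_mean Q X (Yp r) (m r))"

text \<open>
  The conditional second moments are taken in \<open>ennreal\<close>, so that the upper bound also excludes
  infinite values. As conditional expectations are determined only up to null sets, the bounds
  over \<open>x\<close> in the support of \<open>X\<close> hold almost surely.
\<close>

definition basic_assumption ::
  "'q measure \<Rightarrow> ('q \<Rightarrow> real^'p) \<Rightarrow> (nat \<Rightarrow> 'q \<Rightarrow> real) \<Rightarrow> (nat \<Rightarrow> 'q \<Rightarrow> real) \<Rightarrow>
    (nat \<Rightarrow> real^'p \<Rightarrow> real) \<Rightarrow> (nat \<Rightarrow> real^'p \<Rightarrow> real) \<Rightarrow> bool" where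
  "basic_assumption Q X Yp R m \<mu> \<longleftrightarrow>
    (\<forall>N\<ge>1. integrable Q (\<lambda>\<omega>. (norm (observation Yp (R N) X \<omega>))\<^sup>2)) \<and>
    (\<forall>r\<in>{0,1}. integrable Q (\<lambda>\<omega>. (Yp r \<omega>)\<^sup>2)) \<and>
    pos_def_matrix (covariance_matrix Q X) \<and>
    (\<exists>s1 s2 :: real. s1 > 0 \<and> s2 > 0 \<and> (\<forall>r\<in>{0,1}.
      (AE \<omega> in Q. nn_cond_exp Q (sigma_of Q X) (\<lambda>\<omega>. ennreal ((Yp r \<omega> - m r (X \<omega>))\<^sup>2)) \<omega> \<ge> ennreal s1) \<and>
      (AE \<omega> in Q. nn_cond_exp Q (sigma_of Q X) (\<lambda>\<omega>. ennreal ((Yp r \<omega> - \<mu> r (X \<omega>))\<^sup>2)) \<omega> \<le> ennreal s2) \<and>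
      (\<integral>\<omega>. (Yp r \<omega> - (\<integral>\<omega>'. Yp r \<omega>' \<partial>Q))\<^sup>2 \<partial>Q) \<le> s2))"

section \<open>Sample, folds and cross-fitting\<close>

definition iid_copies ::
  "'w measure \<Rightarrow> 'i set \<Rightarrow> ('i \<Rightarrow> 'w \<Rightarrow> 'a::topological_space) \<Rightarrow> 'q measure \<Rightarrow> ('q \<Rightarrow> 'a) \<Rightarrow> bool" where
  "iid_copies M I Zs Q Z \<longleftrightarrow>
    prob_space.indep_vars M (\<lambda>_. borel) Zs I \<and> (\<forall>i\<in>I. distr M borel (Zs i) = distr Q borel Z)"

text \<open>
  \<open>I k\<close> is the \<open>k\<close>-th fold, for \<open>k \<in> {1..K}\<close>. Nothing is required of the sizes of the folds.
\<close>

definition random_partition ::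
  "'w measure \<Rightarrow> nat \<Rightarrow> nat \<Rightarrow> (nat \<Rightarrow> 'w \<Rightarrow> nat set) \<Rightarrow> (nat \<Rightarrow> 'w \<Rightarrow> 'z::topological_space) \<Rightarrow> bool" where
  "random_partition M N K I Zs \<longleftrightarrow>
    (\<forall>\<omega>\<in>space M. disjoint_family_on (\<lambda>k. I k \<omega>) {1..K} \<and> (\<Union>k\<in>{1..K}. I k \<omega>) = {1..N}) \<and>
    prob_space.indep_set M
      (sets (vimage_algebra (space M) (\<lambda>\<omega>. restrict (\<lambda>k. I k \<omega>) {1..K}) (count_space UNIV)))
      (sets (vimage_algebra (space M) (\<lambda>\<omega>. restrict (\<lambda>i. Zs i \<omega>) {1..N}) (Pi\<^sub>M {1..N} (\<lambda>_. borel))))"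

text \<open>
  An estimator maps a set \<open>J\<close> of indices and the data \<open>(Z\<^sub>i)\<close>, \<open>i \<in> J\<close>, to a function of \<open>x\<close>.
\<close>

type_synonym 'p estimator = "nat set \<Rightarrow> (nat \<Rightarrow> 'p::finite obs) \<Rightarrow> real^'p \<Rightarrow> real"

definition measurable_estimator :: "nat \<Rightarrow> 'p::finite estimator \<Rightarrow> bool" where
  "measurable_estimator N est \<longleftrightarrow>
    (\<forall>J\<subseteq>{1..N}. (\<lambda>(z, x). est J z x) \<in> borel_measurable (Pi\<^sub>M J (\<lambda>_. borel) \<Otimes>\<^sub>M borel))"

definition fold_fit ::
  "'p::finite estimator \<Rightarrow> nat \<Rightarrow> nat set \<Rightarrow> (nat \<Rightarrow> 'p::finite obs) \<Rightarrow> real^'p \<Rightarrow> real" where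
  "fold_fit est N Ik z = est ({1..N} - Ik) (restrict z ({1..N} - Ik))"

definition fold_of :: "nat \<Rightarrow> (nat \<Rightarrow> nat set) \<Rightarrow> nat \<Rightarrow> nat" where
  "fold_of K I i = (THE k. k \<in> {1..K} \<and> i \<in> I k)"

text \<open>The cross-fitted value of the estimator at \<open>X\<^sub>i\<close>.\<close>

definition cross_fit ::
  "'p::finite estimator \<Rightarrow> nat \<Rightarrow> nat \<Rightarrow> (nat \<Rightarrow> nat set) \<Rightarrow> (nat \<Rightarrow> 'p::finite obs) \<Rightarrow> nat \<Rightarrow> real" where
  "cross_fit est N K I z i = fold_fit est N (I (fold_of K I i)) z (obsX (z i))"

definition theta_hat1 ::
  "nat \<Rightarrow> nat \<Rightarrow> 'p estimator \<Rightarrow> 'p estimator \<Rightarrow> (nat \<Rightarrow> nat set) \<Rightarrow> (nat \<Rightarrow> 'p::finite obs) \<Rightarrow> real" where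
  "theta_hat1 N K mhat1 pihat I z =
    (\<Sum>i=1..N. cross_fit mhat1 N K I z i +
      obsR (z i) / cross_fit pihat N K I z i * (obsY (z i) - cross_fit mhat1 N K I z i)) / real N"

definition theta_hat0 ::
  "nat \<Rightarrow> nat \<Rightarrow> 'p estimator \<Rightarrow> 'p estimator \<Rightarrow> (nat \<Rightarrow> nat set) \<Rightarrow> (nat \<Rightarrow> 'p::finite obs) \<Rightarrow> real" where
  "theta_hat0 N K mhat0 pihat I z =
    (\<Sum>i=1..N. cross_fit mhat0 N K I z i +
      (1 - obsR (z i)) / (1 - cross_fit pihat N K I z i) * (obsY (z i) - cross_fit mhat0 N K I z i)) / real N"

definition theta_hat_ATE ::
  "nat \<Rightarrow> nat \<Rightarrow> 'p estimator \<Rightarrow> 'p estimator \<Rightarrow> 'p estimator \<Rightarrow>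
    (nat \<Rightarrow> nat set) \<Rightarrow> (nat \<Rightarrow> 'p::finite obs) \<Rightarrow> real" where
  "theta_hat_ATE N K mhat0 mhat1 pihat I z =
    theta_hat1 N K mhat1 pihat I z - theta_hat0 N K mhat0 pihat I z"

text \<open>The two forms of the drift term, for a correct propensity limit and a correct regression limit.\<close>

definition drift_e ::
  "nat \<Rightarrow> nat \<Rightarrow> (real^'p \<Rightarrow> real) \<Rightarrow> (real^'p \<Rightarrow> real) \<Rightarrow> (real^'p \<Rightarrow> real) \<Rightarrow> 'p estimator \<Rightarrow>
    (nat \<Rightarrow> nat set) \<Rightarrow> (nat \<Rightarrow> 'p::finite obs) \<Rightarrow> real" where
  "drift_e N K \<pi>N \<mu>1 m1 pihat I z =
    (\<Sum>i=1..N. (obsR (z i) / \<pi>N (obsX (z i)) - obsR (z i) / cross_fit pihat N K I z i) *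
      (\<mu>1 (obsX (z i)) - m1 (obsX (z i)))) / real N"

definition drift_m ::
  "nat \<Rightarrow> nat \<Rightarrow> (real^'p \<Rightarrow> real) \<Rightarrow> (real^'p \<Rightarrow> real) \<Rightarrow> (real^'p \<Rightarrow> real) \<Rightarrow> 'p estimator \<Rightarrow>
    (nat \<Rightarrow> nat set) \<Rightarrow> (nat \<Rightarrow> 'p::finite obs) \<Rightarrow> real" where
  "drift_m N K \<pi>N eN m1 mhat1 I z =
    (\<Sum>i=1..N. (obsR (z i) / \<pi>N (obsX (z i)) - obsR (z i) / eN (obsX (z i))) *
      (cross_fit mhat1 N K I z i - m1 (obsX (z i)))) / real N"

definition psi1 :: "real \<Rightarrow> (real^'p \<Rightarrow> real) \<Rightarrow> (real^'p \<Rightarrow> real) \<Rightarrow> 'p obs \<Rightarrow> real" where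
  "psi1 \<theta>1 \<mu>1 eN z = \<mu>1 (obsX z) - \<theta>1 + obsR z / eN (obsX z) * (obsY z - \<mu>1 (obsX z))"

end

theory Submission
  imports Defs
begin

text \<open>
  With the fold and the training data fixed, a cross-fitted average is a sum of i.i.d. terms, so it is
  controlled by a conditional first moment (Markov) or, for conditionally centred terms, by a
  conditional second moment (Chebyshev). Arm 1 minus its linear term splits into the drift, two
  conditionally centred averages with second moments \<open>o(1 / pbar)\<close>, and the product of the two nuisance
  errors. In arm 0 the inverse weights \<open>1 / (1 - \<pi>)\<close> are bounded and differ from their estimates and
  limits only by \<open>O(pbar)\<close>; every centred term is there of order \<open>N powr (-1/2)\<close>, which is negligible
  since \<open>pbar \<longlonglongrightarrow> 0\<close>, and the four products of weight errors and regression errors give the remaining rates.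
\<close>

section \<open>Calculus of stochastic orders\<close>

text \<open>Two features shape the proof. Fold sizes are arbitrary, so every fold sum keeps the
  divisor \<open>N\<close> and tail bounds are uniform over index sets of at most \<open>N\<close>
  elements. And correct specification is only an almost sure property, while the expansion is
  claimed at every outcome: its last remainder is therefore whatever is left over, shown to agree
  almost surely with the centred averages. The scale comes from overlap. A weight
  \<open>R / \<pi>\<close> is of size 1/pbar on an event of probability about pbar, so second
  moments are of order 1/pbar, and sqrt (1 / pbar / N) is the target rate. In first moments pbar
  cancels, so products of errors in arm 1 keep the plain rates. By conditional Jensen, the bound
  \<open>s2\<close> on conditional second moments about \<open>\<mu>\<close> bounds
  \<open>m - \<mu>\<close> by sqrt s2 almost surely; a misspecified regression thus costs only a
  constant in the drift and in arm 0. Double robustness enters arm 1 by algebra: in general the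
  drift has two summands, and each kind of correct specification removes one.\<close>

lemma outer_measure_of_Un:
  assumes "A \<subseteq> space M" "B \<subseteq> space M"
  shows "outer_measure_of M (A \<union> B) \<le> outer_measure_of M A + outer_measure_of M B"
proof -
  \<comment> \<open>Measurable covers of the same outer measure reduce the claim to subadditivity of
    \<open>emeasure\<close>; the tail events themselves need not be measurable.\<close>
  obtain E where E: "E \<in> sets M" "A \<subseteq> E" "outer_measure_of M A = emeasure M E"
    using outer_measure_of_attain[OF assms(1)] by blast
  obtain F where F: "F \<in> sets M" "B \<subseteq> F" "outer_measure_of M B = emeasure M F"
    using outer_measure_of_attain[OF assms(2)] by blast
  have "outer_measure_of M (A \<union> B) \<le> outer_measure_of M (E \<union> F)"
    using E F by (intro outer_measure_of_mono) auto
  also have "\<dots> = emeasure M (E \<union> F)" using E F by simp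
  also have "\<dots> \<le> emeasure M E + emeasure M F" using E F by (intro emeasure_subadditive) auto
  finally show ?thesis using E F by simp
qed

abbreviation tail_event :: "(nat \<Rightarrow> 'w measure) \<Rightarrow> (nat \<Rightarrow> 'w \<Rightarrow> ereal) \<Rightarrow> nat \<Rightarrow> real \<Rightarrow> 'w set" where
  "tail_event M W N t \<equiv> {w \<in> space (M N). \<bar>W N w\<bar> > ereal t}"

abbreviation tail :: "(nat \<Rightarrow> 'w measure) \<Rightarrow> (nat \<Rightarrow> 'w \<Rightarrow> ereal) \<Rightarrow> nat \<Rightarrow> real \<Rightarrow> ennreal" where
  "tail M W N t \<equiv> outer_measure_of (M N) (tail_event M W N t)"

abbreviation real_bigOp :: "(nat \<Rightarrow> 'w measure) \<Rightarrow> (nat \<Rightarrow> 'w \<Rightarrow> real) \<Rightarrow> (nat \<Rightarrow> real) \<Rightarrow> bool" where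
  "real_bigOp M V \<equiv> bigOp M (\<lambda>N w. ereal (V N w))"

abbreviation real_littleop :: "(nat \<Rightarrow> 'w measure) \<Rightarrow> (nat \<Rightarrow> 'w \<Rightarrow> real) \<Rightarrow> (nat \<Rightarrow> real) \<Rightarrow> bool" where
  "real_littleop M V \<equiv> littleop M (\<lambda>N w. ereal (V N w))"

lemma tail_event_subset: "tail_event M W N t \<subseteq> space (M N)"
  by auto

lemma bigOpD:
  assumes "bigOp M W r" "\<epsilon> > (0::real)"
  obtains K where "K > 0"
    "\<forall>\<^sub>F N in sequentially. tail M W N (K * r N) \<le> ennreal \<epsilon>"
  using assms(1)[unfolded bigOp_def, rule_format, OF assms(2)] by blast

text \<open>Off two tail events of outer probability at most \<epsilon>/2 each, both bounds hold and
  a deterministic implication takes over. Nonnegative rates let both bounds be weakened to one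
  common constant, so \<open>imp\<close> speaks of a single \<open>K\<close>.\<close>

lemma bigOp_mono2:
  assumes W1: "bigOp M W1 r1" and W2: "bigOp M W2 r2"
    and imp: "\<And>K::real. K > 0 \<Longrightarrow> \<exists>K'>0. \<forall>\<^sub>F N in sequentially. \<forall>w\<in>space (M N).
      \<bar>W1 N w\<bar> \<le> ereal (K * r1 N) \<longrightarrow> \<bar>W2 N w\<bar> \<le> ereal (K * r2 N) \<longrightarrow> \<bar>V N w\<bar> \<le> ereal (K' * s N)"
    and r: "\<And>N. N \<ge> 1 \<Longrightarrow> r1 N \<ge> 0" "\<And>N. N \<ge> 1 \<Longrightarrow> r2 N \<ge> 0"
  shows "bigOp M V s"
  unfolding bigOp_def
proof (intro allI impI)
  fix \<epsilon> :: real assume e: "\<epsilon> > 0"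
  obtain K1 where K1: "K1 > 0"
    "\<forall>\<^sub>F N in sequentially. tail M W1 N (K1 * r1 N) \<le> ennreal (\<epsilon>/2)"
    using bigOpD[OF W1, of "\<epsilon>/2"] e by auto
  obtain K2 where K2: "K2 > 0"
    "\<forall>\<^sub>F N in sequentially. tail M W2 N (K2 * r2 N) \<le> ennreal (\<epsilon>/2)"
    using bigOpD[OF W2, of "\<epsilon>/2"] e by auto
  define K where "K = max K1 K2"
  have "K > 0" using K1 by (simp add: K_def)
  then obtain K' where K': "K' > 0" "\<forall>\<^sub>F N in sequentially. \<forall>w\<in>space (M N).
      \<bar>W1 N w\<bar> \<le> ereal (K * r1 N) \<longrightarrow> \<bar>W2 N w\<bar> \<le> ereal (K * r2 N) \<longrightarrow> \<bar>V N w\<bar> \<le> ereal (K' * s N)"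
    using imp by blast
  have "\<forall>\<^sub>F N in sequentially. tail M V N (K' * s N) \<le> ennreal \<epsilon>"
    using K1(2) K2(2) K'(2) eventually_ge_at_top[of 1]
  proof eventually_elim
    case (elim N)
    have le: "K1 * r1 N \<le> K * r1 N" "K2 * r2 N \<le> K * r2 N"
      using r elim by (auto simp: K_def intro!: mult_right_mono)
    have "tail_event M V N (K' * s N) \<subseteq> tail_event M W1 N (K1 * r1 N) \<union> tail_event M W2 N (K2 * r2 N)"
    proof (intro subsetI)
      fix w assume "w \<in> tail_event M V N (K' * s N)"
      then have w: "w \<in> space (M N)" "\<not> \<bar>V N w\<bar> \<le> ereal (K' * s N)" by (simp_all add: not_le)
      with elim(3) have "\<not> \<bar>W1 N w\<bar> \<le> ereal (K * r1 N) \<or> \<not> \<bar>W2 N w\<bar> \<le> ereal (K * r2 N)" by blast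
      moreover have "ereal (K1 * r1 N) \<le> ereal (K * r1 N)" "ereal (K2 * r2 N) \<le> ereal (K * r2 N)" using le by simp_all
      ultimately have "ereal (K1 * r1 N) < \<bar>W1 N w\<bar> \<or> ereal (K2 * r2 N) < \<bar>W2 N w\<bar>"
        unfolding not_le by (meson order.strict_trans1)
      with w(1) show "w \<in> tail_event M W1 N (K1 * r1 N) \<union> tail_event M W2 N (K2 * r2 N)"
        by blast
    qed
    then have "tail M V N (K' * s N) \<le>
      tail M W1 N (K1 * r1 N) + tail M W2 N (K2 * r2 N)"
      by (intro order_trans[OF outer_measure_of_mono outer_measure_of_Un] tail_event_subset)
    also have "\<dots> \<le> ennreal (\<epsilon>/2) + ennreal (\<epsilon>/2)" using elim by (intro add_mono)
    also have "\<dots> = ennreal \<epsilon>" using e by (simp flip: ennreal_plus)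
    finally show ?case .
  qed
  with K'(1) show "\<exists>K>0. \<forall>\<^sub>F N in sequentially. tail M V N (K * s N) \<le> ennreal \<epsilon>"
    by blast
qed

lemma bigOp_mono:
  assumes "bigOp M W r"
    and "\<And>K::real. K > 0 \<Longrightarrow> \<exists>K'>0. \<forall>\<^sub>F N in sequentially. \<forall>w\<in>space (M N).
      \<bar>W N w\<bar> \<le> ereal (K * r N) \<longrightarrow> \<bar>V N w\<bar> \<le> ereal (K' * s N)"
    and "\<And>N. N \<ge> 1 \<Longrightarrow> r N \<ge> 0"
  shows "bigOp M V s"
proof (rule bigOp_mono2[OF assms(1,1)])
  fix K :: real assume "K > 0"
  from assms(2)[OF this] show "\<exists>K'>0. \<forall>\<^sub>F N in sequentially. \<forall>w\<in>space (M N).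
      \<bar>W N w\<bar> \<le> ereal (K * r N) \<longrightarrow> \<bar>W N w\<bar> \<le> ereal (K * r N) \<longrightarrow> \<bar>V N w\<bar> \<le> ereal (K' * s N)"
    by simp
qed (use assms(3) in blast)+

lemma bigOp_zero: "(\<And>N. N \<ge> 1 \<Longrightarrow> r N \<ge> 0) \<Longrightarrow> bigOp M (\<lambda>N w. 0) r"
  unfolding bigOp_def
proof (intro allI impI exI[of _ 1] conjI eventually_mono[OF eventually_ge_at_top[of 1]])
  fix \<epsilon> :: real and N :: nat assume "\<And>N. N \<ge> 1 \<Longrightarrow> r N \<ge> 0" "1 \<le> N"
  then have e: "tail_event M (\<lambda>N w. 0) N (1 * r N) = {}" using leD by auto
  show "tail M (\<lambda>N w. 0) N (1 * r N) \<le> ennreal \<epsilon>" unfolding e by simp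
qed simp

lemma bigOp_add:
  fixes V1 V2 :: "nat \<Rightarrow> 'w \<Rightarrow> real"
  assumes "real_bigOp M V1 r1" "real_bigOp M V2 r2"
    and r: "\<And>N. N \<ge> 1 \<Longrightarrow> r1 N \<ge> 0" "\<And>N. N \<ge> 1 \<Longrightarrow> r2 N \<ge> 0"
  shows "real_bigOp M (\<lambda>N w. V1 N w + V2 N w) (\<lambda>N. r1 N + r2 N)"
proof (rule bigOp_mono2[OF assms(1,2)])
  fix K :: real assume "K > 0"
  then show "\<exists>K'>0. \<forall>\<^sub>F N in sequentially. \<forall>w\<in>space (M N).
      \<bar>ereal (V1 N w)\<bar> \<le> ereal (K * r1 N) \<longrightarrow> \<bar>ereal (V2 N w)\<bar> \<le> ereal (K * r2 N) \<longrightarrow>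
      \<bar>ereal (V1 N w + V2 N w)\<bar> \<le> ereal (K' * (r1 N + r2 N))"
    by (intro exI[of _ K]) (auto simp: algebra_simps abs_le_iff intro!: always_eventually)
qed (use r in auto)

lemma bigOp_sum:
  fixes V :: "'k \<Rightarrow> nat \<Rightarrow> 'w \<Rightarrow> real"
  assumes "finite A" "\<And>k. k \<in> A \<Longrightarrow> real_bigOp M (V k) r" "\<And>N. N \<ge> 1 \<Longrightarrow> r N \<ge> 0"
  shows "real_bigOp M (\<lambda>N w. \<Sum>k\<in>A. V k N w) r"
  using assms(1,2)
proof (induction A rule: finite_induct)
  case empty
  then show ?case using bigOp_zero[OF assms(3)] by (simp add: zero_ereal_def)
next
  case (insert x A)
  have "real_bigOp M (\<lambda>N w. V x N w + (\<Sum>k\<in>A. V k N w)) (\<lambda>N. r N + r N)"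
    using insert assms(3) by (intro bigOp_add) auto
  then have "real_bigOp M (\<lambda>N w. V x N w + (\<Sum>k\<in>A. V k N w)) r"
  proof (rule bigOp_mono)
    fix K :: real assume "K > 0"
    then show "\<exists>K'>0. \<forall>\<^sub>F N in sequentially. \<forall>w\<in>space (M N).
        \<bar>ereal (V x N w + (\<Sum>k\<in>A. V k N w))\<bar> \<le> ereal (K * (r N + r N)) \<longrightarrow>
        \<bar>ereal (V x N w + (\<Sum>k\<in>A. V k N w))\<bar> \<le> ereal (K' * r N)"
      by (intro exI[of _ "2 * K"] conjI always_eventually) (auto simp: algebra_simps)
  qed (use assms(3) in simp)
  with insert(1,2) show ?case by simp
qed

section \<open>Small-o in outer probability\<close>

lemma littleop_iff:
  "littleop M W r \<longleftrightarrow> (\<forall>\<delta>>0. \<forall>\<epsilon>>0. \<forall>\<^sub>F N in sequentially.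
    tail M W N (\<delta> * r N) \<le> ennreal \<epsilon>)"
proof -
  have "f \<longlonglongrightarrow> 0 \<longleftrightarrow> (\<forall>\<epsilon>>0. \<forall>\<^sub>F N in sequentially. f N \<le> ennreal \<epsilon>)" for f :: "nat \<Rightarrow> ennreal"
  proof
    assume f: "f \<longlonglongrightarrow> 0"
    show "\<forall>\<epsilon>>0. \<forall>\<^sub>F N in sequentially. f N \<le> ennreal \<epsilon>"
      using order_tendstoD(2)[OF f] by (metis (mono_tags, lifting) ennreal_less_zero_iff eventually_mono less_imp_le)
  next
    assume f: "\<forall>\<epsilon>>0. \<forall>\<^sub>F N in sequentially. f N \<le> ennreal \<epsilon>"
    show "f \<longlonglongrightarrow> 0"
    proof (rule order_tendstoI)
      fix a :: ennreal assume "0 < a"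
      \<comment> \<open>A bound \<open>b\<close> strictly below \<open>a\<close> is finite even when
        \<open>a\<close> is infinite, hence it is \<open>ennreal\<close> of a positive real, to
        which the assumption on \<open>f\<close> applies.\<close>
      then obtain b where b: "0 < b" "b < a" using dense by blast
      then have "b < \<top>" using top.not_eq_extremum by fastforce
      with b have "b = ennreal (enn2real b)" "enn2real b > 0"
        by (auto simp: enn2real_positive_iff)
      then have "\<forall>\<^sub>F N in sequentially. f N \<le> b" using f by metis
      then show "\<forall>\<^sub>F N in sequentially. f N < a"
        by eventually_elim (use b in auto)
    qed simp
  qed
  then show ?thesis unfolding littleop_def by simp
qed

lemma littleopD:
  assumes "littleop M W r" "\<delta> > 0" "\<epsilon> > 0"
  shows "\<forall>\<^sub>F N in sequentially. tail M W N (\<delta> * r N) \<le> ennreal \<epsilon>"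
  using assms(1)[unfolded littleop_iff, rule_format, OF assms(2,3)] .

text \<open>The constant \<open>K\<close> of the bounded variable is fixed before
  \<open>\<delta>'\<close>, so the smallness demanded of \<open>W1\<close> may depend on it. Setting
  one of the two variables to zero yields both of the special rules below.\<close>

lemma littleop_mono2:
  assumes W1: "littleop M W1 r1" and W2: "bigOp M W2 r2"
    and imp: "\<And>K \<delta>::real. K > 0 \<Longrightarrow> \<delta> > 0 \<Longrightarrow> \<exists>\<delta>'>0. \<forall>\<^sub>F N in sequentially. \<forall>w\<in>space (M N).
      \<bar>W1 N w\<bar> \<le> ereal (\<delta>' * r1 N) \<longrightarrow> \<bar>W2 N w\<bar> \<le> ereal (K * r2 N) \<longrightarrow> \<bar>V N w\<bar> \<le> ereal (\<delta> * s N)"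
  shows "littleop M V s"
  unfolding littleop_iff
proof (intro allI impI)
  fix \<delta> \<epsilon> :: real assume d: "\<delta> > 0" and e: "\<epsilon> > 0"
  obtain K where K: "K > 0"
    "\<forall>\<^sub>F N in sequentially. tail M W2 N (K * r2 N) \<le> ennreal (\<epsilon>/2)"
    using bigOpD[OF W2, of "\<epsilon>/2"] e by auto
  obtain \<delta>' where d': "\<delta>' > 0" "\<forall>\<^sub>F N in sequentially. \<forall>w\<in>space (M N).
      \<bar>W1 N w\<bar> \<le> ereal (\<delta>' * r1 N) \<longrightarrow> \<bar>W2 N w\<bar> \<le> ereal (K * r2 N) \<longrightarrow> \<bar>V N w\<bar> \<le> ereal (\<delta> * s N)"
    using imp[OF K(1) d] by blast
  have "\<forall>\<^sub>F N in sequentially. tail M W1 N (\<delta>' * r1 N) \<le> ennreal (\<epsilon>/2)"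
    using e by (intro littleopD[OF W1 d'(1)]) simp
  with K(2) d'(2)
  show "\<forall>\<^sub>F N in sequentially. tail M V N (\<delta> * s N) \<le> ennreal \<epsilon>"
  proof eventually_elim
    case (elim N)
    have "tail_event M V N (\<delta> * s N) \<subseteq> tail_event M W1 N (\<delta>' * r1 N) \<union> tail_event M W2 N (K * r2 N)"
    proof (intro subsetI)
      fix w assume "w \<in> tail_event M V N (\<delta> * s N)"
      then have w: "w \<in> space (M N)" "\<not> \<bar>V N w\<bar> \<le> ereal (\<delta> * s N)" by (simp_all add: not_le)
      with elim(2) have "\<not> \<bar>W1 N w\<bar> \<le> ereal (\<delta>' * r1 N) \<or> \<not> \<bar>W2 N w\<bar> \<le> ereal (K * r2 N)" by blast
      with w(1) show "w \<in> tail_event M W1 N (\<delta>' * r1 N) \<union> tail_event M W2 N (K * r2 N)"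
        by (simp add: not_le)
    qed
    then have "tail M V N (\<delta> * s N) \<le>
      tail M W1 N (\<delta>' * r1 N) + tail M W2 N (K * r2 N)"
      by (intro order_trans[OF outer_measure_of_mono outer_measure_of_Un] tail_event_subset)
    also have "\<dots> \<le> ennreal (\<epsilon>/2) + ennreal (\<epsilon>/2)" using elim by (intro add_mono)
    also have "\<dots> = ennreal \<epsilon>" using e by (simp flip: ennreal_plus)
    finally show ?case .
  qed
qed

lemma littleop_zero: "(\<And>N. N \<ge> 1 \<Longrightarrow> r N \<ge> 0) \<Longrightarrow> littleop M (\<lambda>N w. 0) r"
  unfolding littleop_iff
proof (intro allI impI eventually_mono[OF eventually_ge_at_top[of 1]])
  fix \<delta> \<epsilon> :: real and N :: nat assume "\<And>N. N \<ge> 1 \<Longrightarrow> r N \<ge> 0" "1 \<le> N" "\<delta> > 0"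
  then have "\<not> \<delta> * r N < 0" by (simp add: not_less)
  then have e: "tail_event M (\<lambda>N w. 0) N (\<delta> * r N) = {}" by auto
  show "tail M (\<lambda>N w. 0) N (\<delta> * r N) \<le> ennreal \<epsilon>" unfolding e by simp
qed

lemma littleop_mono:
  assumes "littleop M W r"
    and "\<And>\<delta>::real. \<delta> > 0 \<Longrightarrow> \<exists>\<delta>'>0. \<forall>\<^sub>F N in sequentially. \<forall>w\<in>space (M N).
      \<bar>W N w\<bar> \<le> ereal (\<delta>' * r N) \<longrightarrow> \<bar>V N w\<bar> \<le> ereal (\<delta> * s N)"
  shows "littleop M V s"
proof (rule littleop_mono2[OF assms(1) bigOp_zero[of "\<lambda>_. 0"]])
  fix K \<delta> :: real assume "\<delta> > 0"
  from assms(2)[OF this] show "\<exists>\<delta>'>0. \<forall>\<^sub>F N in sequentially. \<forall>w\<in>space (M N).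
      \<bar>W N w\<bar> \<le> ereal (\<delta>' * r N) \<longrightarrow> \<bar>0\<bar> \<le> ereal (K * 0) \<longrightarrow> \<bar>V N w\<bar> \<le> ereal (\<delta> * s N)"
    by simp
qed simp

lemma littleop_bigOp:
  assumes "bigOp M W r"
    and "\<And>K \<delta>::real. K > 0 \<Longrightarrow> \<delta> > 0 \<Longrightarrow> \<forall>\<^sub>F N in sequentially. \<forall>w\<in>space (M N).
      \<bar>W N w\<bar> \<le> ereal (K * r N) \<longrightarrow> \<bar>V N w\<bar> \<le> ereal (\<delta> * s N)"
  shows "littleop M V s"
proof (rule littleop_mono2[OF littleop_zero[of "\<lambda>_. 0"] assms(1)])
  fix K \<delta> :: real assume "K > 0" "\<delta> > 0"
  from assms(2)[OF this] show "\<exists>\<delta>'>0. \<forall>\<^sub>F N in sequentially. \<forall>w\<in>space (M N).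
      \<bar>0\<bar> \<le> ereal (\<delta>' * 0) \<longrightarrow> \<bar>W N w\<bar> \<le> ereal (K * r N) \<longrightarrow> \<bar>V N w\<bar> \<le> ereal (\<delta> * s N)"
    by (intro exI[of _ 1]) simp
qed simp

lemma littleop_add:
  fixes V1 V2 :: "nat \<Rightarrow> 'w \<Rightarrow> real"
  assumes "real_littleop M V1 r" "real_littleop M V2 r"
  shows "real_littleop M (\<lambda>N w. V1 N w + V2 N w) r"
  unfolding littleop_iff
proof (intro allI impI)
  fix \<delta> \<epsilon> :: real assume d: "\<delta> > 0" and e: "\<epsilon> > 0"
  have "\<forall>\<^sub>F N in sequentially. tail M (\<lambda>N w. ereal (V1 N w)) N (\<delta>/2 * r N) \<le> ennreal (\<epsilon>/2)"
    "\<forall>\<^sub>F N in sequentially. tail M (\<lambda>N w. ereal (V2 N w)) N (\<delta>/2 * r N) \<le> ennreal (\<epsilon>/2)"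
    using d e by (intro littleopD[OF assms(1)] littleopD[OF assms(2)]; simp)+
  then show "\<forall>\<^sub>F N in sequentially. tail M (\<lambda>N w. ereal (V1 N w + V2 N w)) N (\<delta> * r N) \<le> ennreal \<epsilon>"
  proof eventually_elim
    case (elim N)
    have "tail_event M (\<lambda>N w. ereal (V1 N w + V2 N w)) N (\<delta> * r N) \<subseteq>
      tail_event M (\<lambda>N w. ereal (V1 N w)) N (\<delta>/2 * r N) \<union> tail_event M (\<lambda>N w. ereal (V2 N w)) N (\<delta>/2 * r N)"
    proof (intro subsetI)
      fix w assume "w \<in> tail_event M (\<lambda>N w. ereal (V1 N w + V2 N w)) N (\<delta> * r N)"
      then have w: "w \<in> space (M N)" "\<delta> * r N < \<bar>V1 N w + V2 N w\<bar>" by simp_all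
      then have "\<delta>/2 * r N < \<bar>V1 N w\<bar> \<or> \<delta>/2 * r N < \<bar>V2 N w\<bar>" by linarith
      with w(1) show "w \<in> tail_event M (\<lambda>N w. ereal (V1 N w)) N (\<delta>/2 * r N) \<union>
          tail_event M (\<lambda>N w. ereal (V2 N w)) N (\<delta>/2 * r N)"
        by simp
    qed
    then have "tail M (\<lambda>N w. ereal (V1 N w + V2 N w)) N (\<delta> * r N) \<le>
      tail M (\<lambda>N w. ereal (V1 N w)) N (\<delta>/2 * r N) +
      tail M (\<lambda>N w. ereal (V2 N w)) N (\<delta>/2 * r N)"
      by (intro order_trans[OF outer_measure_of_mono outer_measure_of_Un] tail_event_subset)
    also have "\<dots> \<le> ennreal (\<epsilon>/2) + ennreal (\<epsilon>/2)" using elim by (intro add_mono)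
    also have "\<dots> = ennreal \<epsilon>" using e by (simp flip: ennreal_plus)
    finally show ?case .
  qed
qed

lemma littleop_sum:
  fixes V :: "'k \<Rightarrow> nat \<Rightarrow> 'w \<Rightarrow> real"
  assumes "finite A" "\<And>k. k \<in> A \<Longrightarrow> real_littleop M (V k) r" "\<And>N. N \<ge> 1 \<Longrightarrow> r N \<ge> 0"
  shows "real_littleop M (\<lambda>N w. \<Sum>k\<in>A. V k N w) r"
  using assms(1,2)
proof (induction A rule: finite_induct)
  case empty
  then show ?case using littleop_zero[OF assms(3)] by (simp add: zero_ereal_def)
next
  case (insert x A)
  then show ?case by (simp add: littleop_add)
qed

text \<open>Identities that rest on correct specification hold only off a null set; a measurable
  null cover of the exceptional outcomes adds nothing to the outer probability of a tail.\<close>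

lemma littleop_cong_AE:
  assumes V: "littleop M V r"
    and eq: "\<And>N. N \<ge> 1 \<Longrightarrow> AE w in M N. W N w = V N w"
  shows "littleop M W r"
  unfolding littleop_iff
proof (intro allI impI)
  fix \<delta> \<epsilon> :: real assume "\<delta> > 0" "\<epsilon> > 0"
  then have "\<forall>\<^sub>F N in sequentially. tail M V N (\<delta> * r N) \<le> ennreal \<epsilon>"
    by (rule littleopD[OF V])
  with eventually_ge_at_top[of 1]
  show "\<forall>\<^sub>F N in sequentially. tail M W N (\<delta> * r N) \<le> ennreal \<epsilon>"
  proof eventually_elim
    case (elim N)
    obtain B where B: "{w \<in> space (M N). W N w \<noteq> V N w} \<subseteq> B" "emeasure (M N) B = 0" "B \<in> sets (M N)"
      using eq[OF elim(1)] by (rule AE_E)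
    have "tail_event M W N (\<delta> * r N) \<subseteq> tail_event M V N (\<delta> * r N) \<union> B"
      using B(1) by auto
    then have "tail M W N (\<delta> * r N) \<le>
        tail M V N (\<delta> * r N) + outer_measure_of (M N) B"
      using B(3) sets.sets_into_space by (intro order_trans[OF outer_measure_of_mono outer_measure_of_Un]) auto
    with B elim show ?case by simp
  qed
qed

section \<open>Tail bounds for cross-fitted averages\<close>

lemma nn_integral_PiM_component:
  assumes "prob_space D" "i \<in> J" "f \<in> borel_measurable D"
  shows "(\<integral>\<^sup>+x. f (x i) \<partial>Pi\<^sub>M J (\<lambda>_. D)) = (\<integral>\<^sup>+z. f z \<partial>D)"
proof -
  have "(\<integral>\<^sup>+z. f z \<partial>D) = (\<integral>\<^sup>+z. f z \<partial>distr (Pi\<^sub>M J (\<lambda>_. D)) D (\<lambda>x. x i))"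
    using distr_PiM_component[of J "\<lambda>_. D" i] assms by simp
  also have "\<dots> = (\<integral>\<^sup>+x. f (x i) \<partial>Pi\<^sub>M J (\<lambda>_. D))"
    using assms by (intro nn_integral_distr) auto
  finally show ?thesis by simp
qed

lemma integral_PiM_component:
  fixes f :: "'a \<Rightarrow> real"
  assumes "prob_space D" "i \<in> J" "f \<in> borel_measurable D"
  shows "(\<integral>x. f (x i) \<partial>Pi\<^sub>M J (\<lambda>_. D)) = (\<integral>z. f z \<partial>D)"
proof -
  have "(\<integral>z. f z \<partial>D) = (\<integral>z. f z \<partial>distr (Pi\<^sub>M J (\<lambda>_. D)) D (\<lambda>x. x i))"
    using distr_PiM_component[of J "\<lambda>_. D" i] assms by simp
  also have "\<dots> = (\<integral>x. f (x i) \<partial>Pi\<^sub>M J (\<lambda>_. D))"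
    using assms by (intro integral_distr) auto
  finally show ?thesis by simp
qed

text \<open>Markov's inequality, with the sum of absolute values as majorant. Without centring the
  bound grows like \<open>card J\<close>, which the divisor \<open>N\<close> of an average
  compensates.\<close>

lemma sum_PiM_tail_L1:
  fixes g :: "'a \<Rightarrow> real"
  assumes D: "prob_space D" and J: "finite J" and g[measurable]: "g \<in> borel_measurable D"
    and B: "(\<integral>\<^sup>+z. ennreal \<bar>g z\<bar> \<partial>D) \<le> ennreal B" and t: "t > 0" and b: "real (card J) * B / t \<le> b"
    and B0: "B \<ge> 0"
  shows "emeasure (Pi\<^sub>M J (\<lambda>_. D)) {x \<in> space (Pi\<^sub>M J (\<lambda>_. D)). \<bar>\<Sum>i\<in>J. g (x i)\<bar> > t} \<le> ennreal b"
proof -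
  let ?P = "Pi\<^sub>M J (\<lambda>_. D)"
  have [measurable]: "(\<lambda>x. g (x i)) \<in> borel_measurable ?P" if "i \<in> J" for i
    using that by measurable
  have "emeasure ?P {x \<in> space ?P. \<bar>\<Sum>i\<in>J. g (x i)\<bar> > t} \<le>
      emeasure ?P {x \<in> space ?P. 1 \<le> ennreal (1/t) * (\<Sum>i\<in>J. ennreal \<bar>g (x i)\<bar>)}"
  proof (intro emeasure_mono subsetI)
    fix x assume x: "x \<in> {x \<in> space ?P. \<bar>\<Sum>i\<in>J. g (x i)\<bar> > t}"
    then have "t < \<bar>\<Sum>i\<in>J. g (x i)\<bar>" by simp
    also have "\<dots> \<le> (\<Sum>i\<in>J. \<bar>g (x i)\<bar>)" by (rule sum_abs)
    finally have "1 \<le> (1/t) * (\<Sum>i\<in>J. \<bar>g (x i)\<bar>)" using t by (simp add: field_simps)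
    then have "ennreal 1 \<le> ennreal ((1/t) * (\<Sum>i\<in>J. \<bar>g (x i)\<bar>))" by (rule ennreal_leI)
    also have "\<dots> = ennreal (1/t) * (\<Sum>i\<in>J. ennreal \<bar>g (x i)\<bar>)"
      using t by (subst ennreal_mult) (auto simp: sum_nonneg)
    finally show "x \<in> {x \<in> space ?P. 1 \<le> ennreal (1/t) * (\<Sum>i\<in>J. ennreal \<bar>g (x i)\<bar>)}" using x by simp
  qed measurable
  also have "\<dots> \<le> ennreal (1/t) * (\<integral>\<^sup>+x. (\<Sum>i\<in>J. ennreal \<bar>g (x i)\<bar>) * indicator (space ?P) x \<partial>?P)"
    using nn_integral_Markov_inequality[of "\<lambda>x. \<Sum>i\<in>J. ennreal \<bar>g (x i)\<bar>" "space ?P" ?P "ennreal (1/t)"] by simp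
  also have "(\<integral>\<^sup>+x. (\<Sum>i\<in>J. ennreal \<bar>g (x i)\<bar>) * indicator (space ?P) x \<partial>?P) =
      (\<integral>\<^sup>+x. (\<Sum>i\<in>J. ennreal \<bar>g (x i)\<bar>) \<partial>?P)"
    by (intro nn_integral_cong) simp
  also have "\<dots> = (\<Sum>i\<in>J. \<integral>\<^sup>+x. ennreal \<bar>g (x i)\<bar> \<partial>?P)"
    by (intro nn_integral_sum) measurable
  also have "\<dots> = (\<Sum>i\<in>J. \<integral>\<^sup>+z. ennreal \<bar>g z\<bar> \<partial>D)"
    by (intro sum.cong nn_integral_PiM_component[OF D, of _ J "\<lambda>z. ennreal \<bar>g z\<bar>"]) auto
  also have "\<dots> \<le> (\<Sum>i\<in>J. ennreal B)"
    using B by (intro sum_mono)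
  also have "\<dots> = ennreal (real (card J) * B)"
    using B0 by (simp add: ennreal_mult ennreal_of_nat_eq_real_of_nat)
  also have "ennreal (1/t) * ennreal (real (card J) * B) = ennreal (real (card J) * B / t)"
    using t B0 by (simp flip: ennreal_mult)
  finally show ?thesis using b by (meson ennreal_leI mult_left_mono order_trans zero_le)
qed

text \<open>Independence is read off from the joint law of the coordinates: on extensional functions
  the map \<open>\<lambda>x. \<lambda>i\<in>J. x i\<close> is the identity, so this law is the
  product measure again.\<close>

lemma indep_vars_PiM_coordinates:
  assumes "prob_space D"
  shows "prob_space.indep_vars (Pi\<^sub>M J (\<lambda>_. D)) (\<lambda>_. D) (\<lambda>i x. x i) J"
proof -
  let ?P = "Pi\<^sub>M J (\<lambda>_. D)"
  interpret P: prob_space ?P using assms by (intro prob_space_PiM)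
  show ?thesis
  proof (cases "J = {}")
    case True
    then show ?thesis unfolding P.indep_vars_def P.indep_sets_def by auto
  next
    case False
    have "distr ?P ?P (\<lambda>x. \<lambda>i\<in>J. x i) = distr ?P ?P (\<lambda>x. x)"
      by (intro distr_cong) (auto simp: space_PiM)
    also have "\<dots> = (\<Pi>\<^sub>M i\<in>J. distr ?P D (\<lambda>x. x i))"
      using distr_PiM_component[of J "\<lambda>_. D"] assms by (auto simp: distr_id intro!: PiM_cong)
    finally show ?thesis
      using False by (subst P.indep_vars_iff_distr_eq_PiM') auto
  qed
qed

text \<open>Expanding the square leaves only the diagonal: off it, independence factorises the
  integral and each factor has mean zero.\<close>

lemma sum_PiM_second_moment:
  fixes g :: "'a \<Rightarrow> real"
  assumes D: "prob_space D" and J: "finite J" and g[measurable]: "g \<in> borel_measurable D"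
    and sq: "integrable D (\<lambda>z. (g z)\<^sup>2)" and mean: "(\<integral>z. g z \<partial>D) = 0"
  shows "integrable (Pi\<^sub>M J (\<lambda>_. D)) (\<lambda>x. (\<Sum>i\<in>J. g (x i))\<^sup>2)"
    and "(\<integral>x. (\<Sum>i\<in>J. g (x i))\<^sup>2 \<partial>Pi\<^sub>M J (\<lambda>_. D)) = real (card J) * (\<integral>z. (g z)\<^sup>2 \<partial>D)"
proof -
  interpret D: prob_space D by fact
  let ?P = "Pi\<^sub>M J (\<lambda>_. D)"
  interpret P: prob_space ?P using D by (intro prob_space_PiM)
  have gi: "integrable D g" by (rule D.square_integrable_imp_integrable[OF g sq])
  have int: "integrable ?P (\<lambda>x. g (x i) * g (x j))"
    and val: "(\<integral>x. g (x i) * g (x j) \<partial>?P) = (if i = j then \<integral>z. (g z)\<^sup>2 \<partial>D else 0)"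
    if ij: "i \<in> J" "j \<in> J" for i j
  proof -
    have m: "(\<lambda>x. g (x i)) \<in> borel_measurable ?P" if "i \<in> J" for i using that by measurable
    have i2: "integrable ?P (\<lambda>x. h (x i))" if "integrable D h" "i \<in> J" for h :: "'a \<Rightarrow> real" and i
    proof -
      have "integrable (distr ?P D (\<lambda>x. x i)) h"
        using distr_PiM_component[of J "\<lambda>_. D" i] that D by simp
      then show ?thesis using that by (subst (asm) integrable_distr_eq) auto
    qed
    have "integrable ?P (\<lambda>x. g (x i) * g (x j)) \<and> (\<integral>x. g (x i) * g (x j) \<partial>?P) = (if i = j then \<integral>z. (g z)\<^sup>2 \<partial>D else 0)"
    proof (cases "i = j")
      case True
      then show ?thesis
        using i2[OF sq ij(1)] integral_PiM_component[OF D ij(1), of "\<lambda>z. (g z)\<^sup>2"] by (simp add: power2_eq_square)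
    next
      case False
      have ind: "P.indep_vars (\<lambda>_. borel) (\<lambda>k x. g (x k)) {i, j}"
        by (rule P.indep_vars_compose2[OF P.indep_vars_subset[OF indep_vars_PiM_coordinates[OF D]]]) (use ij in auto)
      have gk: "integrable ?P (\<lambda>x. g (x k))" if "k \<in> {i, j}" for k
        using i2[OF gi] ij that by auto
      have "(\<integral>x. g (x i) \<partial>?P) = 0"
        using integral_PiM_component[OF D ij(1) g] mean by simp
      then show ?thesis
        using P.indep_vars_lebesgue_integral[OF _ ind gk] P.indep_vars_integrable[OF _ ind gk] False by simp
    qed
    then show "integrable ?P (\<lambda>x. g (x i) * g (x j))"
      "(\<integral>x. g (x i) * g (x j) \<partial>?P) = (if i = j then \<integral>z. (g z)\<^sup>2 \<partial>D else 0)" by auto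
  qed
  have eq: "(\<Sum>i\<in>J. g (x i))\<^sup>2 = (\<Sum>i\<in>J. \<Sum>j\<in>J. g (x i) * g (x j))" for x
    by (simp add: power2_eq_square sum_product)
  show "integrable ?P (\<lambda>x. (\<Sum>i\<in>J. g (x i))\<^sup>2)"
    unfolding eq by (intro Bochner_Integration.integrable_sum int)
  have "(\<integral>x. (\<Sum>i\<in>J. g (x i))\<^sup>2 \<partial>?P) = (\<Sum>i\<in>J. \<Sum>j\<in>J. if i = j then \<integral>z. (g z)\<^sup>2 \<partial>D else 0)"
    unfolding eq using int val
    by (simp add: Bochner_Integration.integral_sum Bochner_Integration.integrable_sum cong: sum.cong)
  also have "\<dots> = real (card J) * (\<integral>z. (g z)\<^sup>2 \<partial>D)"
    using J by simp
  finally show "(\<integral>x. (\<Sum>i\<in>J. g (x i))\<^sup>2 \<partial>?P) = real (card J) * (\<integral>z. (g z)\<^sup>2 \<partial>D)" .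
qed

text \<open>Chebyshev's inequality. The finite bound \<open>B\<close> on the \<open>ennreal\<close>
  integral also supplies the square integrability behind the exact second moment of the sum.\<close>

lemma sum_PiM_tail_L2:
  fixes g :: "'a \<Rightarrow> real"
  assumes D: "prob_space D" and J: "finite J" and g[measurable]: "g \<in> borel_measurable D"
    and B: "(\<integral>\<^sup>+z. ennreal ((g z)\<^sup>2) \<partial>D) \<le> ennreal B" and mean: "(\<integral>z. g z \<partial>D) = 0"
    and t: "t > 0" and b: "real (card J) * B / t\<^sup>2 \<le> b" and B0: "B \<ge> 0"
  shows "emeasure (Pi\<^sub>M J (\<lambda>_. D)) {x \<in> space (Pi\<^sub>M J (\<lambda>_. D)). \<bar>\<Sum>i\<in>J. g (x i)\<bar> > t} \<le> ennreal b"
proof -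
  let ?P = "Pi\<^sub>M J (\<lambda>_. D)"
  interpret P: prob_space ?P using D by (intro prob_space_PiM)
  have [measurable]: "(\<lambda>x. g (x i)) \<in> borel_measurable ?P" if "i \<in> J" for i
    using that by measurable
  have sq: "integrable D (\<lambda>z. (g z)\<^sup>2)"
    by (intro integrableI_bounded) (use B in \<open>auto simp: order.strict_trans1[OF _ ennreal_less_top]\<close>)
  note m2 = sum_PiM_second_moment[OF D J g sq mean]
  have "ennreal (\<integral>z. (g z)\<^sup>2 \<partial>D) \<le> ennreal B"
    using B nn_integral_eq_integral[OF sq] by simp
  then have le: "(\<integral>z. (g z)\<^sup>2 \<partial>D) \<le> B" using B0 by simp
  have "P.prob {x \<in> space ?P. (\<Sum>i\<in>J. g (x i))\<^sup>2 \<ge> t\<^sup>2} \<le> (\<integral>x. (\<Sum>i\<in>J. g (x i))\<^sup>2 \<partial>?P) / t\<^sup>2"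
    using integral_Markov_inequality_measure[OF m2(1), of "space ?P" "t\<^sup>2"] t by simp
  also have "\<dots> \<le> real (card J) * B / t\<^sup>2"
    unfolding m2(2) using le by (intro divide_right_mono mult_left_mono) auto
  also have "\<dots> \<le> b" by fact
  finally have *: "emeasure ?P {x \<in> space ?P. (\<Sum>i\<in>J. g (x i))\<^sup>2 \<ge> t\<^sup>2} \<le> ennreal b"
    unfolding P.emeasure_eq_measure by (rule ennreal_leI)
  have "emeasure ?P {x \<in> space ?P. \<bar>\<Sum>i\<in>J. g (x i)\<bar> > t} \<le> emeasure ?P {x \<in> space ?P. (\<Sum>i\<in>J. g (x i))\<^sup>2 \<ge> t\<^sup>2}"
    using t by (intro emeasure_mono) (auto simp flip: abs_le_square_iff)
  with * show ?thesis by order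
qed

text \<open>Fubini along a splitting of the coordinates: those outside \<open>J\<close> are the
  training data, those in \<open>J\<close> the held-out observations. \<open>G\<close> is the good
  event for the trained function; off it the integrand vanishes, on it the inner integral is the
  tail of a sum for a fixed function.\<close>

lemma fold_tail_PiM:
  fixes F :: "('i \<Rightarrow> 'a) \<Rightarrow> 'a \<Rightarrow> real"
  assumes D: "prob_space D" and A: "finite A" "J \<subseteq> A"
    and F[measurable]: "(\<lambda>(x, z). F x z) \<in> borel_measurable (Pi\<^sub>M (A - J) (\<lambda>_. D) \<Otimes>\<^sub>M D)"
    and G[measurable]: "Measurable.pred (Pi\<^sub>M (A - J) (\<lambda>_. D)) G"
    and inner: "\<And>x. x \<in> space (Pi\<^sub>M (A - J) (\<lambda>_. D)) \<Longrightarrow> G x \<Longrightarrow>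
      emeasure (Pi\<^sub>M J (\<lambda>_. D)) {y \<in> space (Pi\<^sub>M J (\<lambda>_. D)). \<bar>\<Sum>i\<in>J. F x (y i)\<bar> > t} \<le> b"
  defines "S \<equiv> {x \<in> space (Pi\<^sub>M A (\<lambda>_. D)). G (restrict x (A - J)) \<and> \<bar>\<Sum>i\<in>J. F (restrict x (A - J)) (x i)\<bar> > t}"
  shows "S \<in> sets (Pi\<^sub>M A (\<lambda>_. D))" "emeasure (Pi\<^sub>M A (\<lambda>_. D)) S \<le> b"
proof -
  let ?P = "\<lambda>B. Pi\<^sub>M B (\<lambda>_. D)"
  interpret D: prob_space D by fact
  interpret product_sigma_finite "\<lambda>_. D" ..
  interpret P: prob_space "?P (A - J)" using D by (intro prob_space_PiM)
  have r: "(\<lambda>x. restrict x (A - J)) \<in> measurable (?P A) (?P (A - J))"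
    by (rule measurable_restrict_subset) auto
  have c: "(\<lambda>x. F (restrict x (A - J)) (x i)) \<in> borel_measurable (?P A)" if "i \<in> J" for i
  proof -
    have "(\<lambda>x. (restrict x (A - J), x i)) \<in> measurable (?P A) (?P (A - J) \<Otimes>\<^sub>M D)"
      using r that A by (intro measurable_Pair) auto
    from measurable_compose[OF this F] show ?thesis by simp
  qed
  have s: "(\<lambda>x. \<Sum>i\<in>J. F (restrict x (A - J)) (x i)) \<in> borel_measurable (?P A)"
    using c by (rule borel_measurable_sum)
  have g: "Measurable.pred (?P A) (\<lambda>x. G (restrict x (A - J)))"
    using measurable_compose[OF r G] by simp
  show S: "S \<in> sets (?P A)"
    unfolding S_def using s g by measurable
  have fin: "finite J" using A finite_subset by blast
  have AJ: "A - J \<union> J = A" using A by auto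
  have "indicator S \<in> borel_measurable (?P (A - J \<union> J))"
    unfolding AJ using S by simp
  from product_nn_integral_fold[OF _ _ fin this] A have foldeq: "(\<integral>\<^sup>+x. indicator S x \<partial>?P (A - J \<union> J)) =
      (\<integral>\<^sup>+x. \<integral>\<^sup>+y. indicator S (merge (A - J) J (x, y)) \<partial>?P J \<partial>?P (A - J))"
    by blast
  have "emeasure (?P A) S = (\<integral>\<^sup>+x. \<integral>\<^sup>+y. indicator S (merge (A - J) J (x, y)) \<partial>?P J \<partial>?P (A - J))"
    unfolding foldeq[symmetric] AJ using S by simp
  also have "\<dots> \<le> (\<integral>\<^sup>+x. b \<partial>?P (A - J))"
  proof (intro nn_integral_mono)
    fix x assume x: "x \<in> space (?P (A - J))"
    let ?T = "{y \<in> space (?P J). \<bar>\<Sum>i\<in>J. F x (y i)\<bar> > t}"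
    have T: "?T \<in> sets (?P J)"
    proof -
      have "(\<lambda>y. F x (y i)) \<in> borel_measurable (?P J)" if "i \<in> J" for i
      proof -
        have "(\<lambda>y. (x, y i)) \<in> measurable (?P J) (?P (A - J) \<Otimes>\<^sub>M D)"
          using x that by (intro measurable_Pair measurable_const) auto
        from measurable_compose[OF this F] show ?thesis by simp
      qed
      then have [measurable]: "(\<lambda>y. \<Sum>i\<in>J. F x (y i)) \<in> borel_measurable (?P J)"
        by (rule borel_measurable_sum)
      show ?thesis by measurable
    qed
    have "indicator S (merge (A - J) J (x, y)) = (if G x then indicator ?T y else (0::ennreal))" if y: "y \<in> space (?P J)" for y
    proof -
      have m: "merge (A - J) J (x, y) \<in> space (?P A)"
        using measurable_space[OF measurable_merge, of "(x, y)" "A - J" "\<lambda>_. D" J] x y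
        unfolding AJ by (simp add: space_pair_measure)
      \<comment> \<open>Points of the product space are extensional, so restricting the merged point
        returns the training data exactly.\<close>
      have "restrict (merge (A - J) J (x, y)) (A - J) = x"
        using x by (auto simp: space_PiM merge_def restrict_def PiE_def extensional_def fun_eq_iff)
      moreover have "merge (A - J) J (x, y) i = y i" if "i \<in> J" for i
        using that by (simp add: merge_def)
      ultimately show ?thesis
        using m y unfolding S_def by (auto simp: indicator_def cong: sum.cong)
    qed
    then have "(\<integral>\<^sup>+y. indicator S (merge (A - J) J (x, y)) \<partial>?P J) =
        (\<integral>\<^sup>+y. (if G x then indicator ?T y else 0) \<partial>?P J)"
      by (intro nn_integral_cong) auto
    also have "\<dots> \<le> b"
      using inner[OF x] T by (cases "G x") auto
    finally show "(\<integral>\<^sup>+y. indicator S (merge (A - J) J (x, y)) \<partial>?P J) \<le> b" .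
  qed
  also have "\<dots> = b" by (simp add: P.emeasure_space_1)
  finally show "emeasure (?P A) S \<le> b" .
qed

text \<open>The folds are independent of the data, so it suffices to bound the tail for each fixed fold.\<close>

lemma random_fold_tail:
  fixes Zs :: "nat \<Rightarrow> 'w \<Rightarrow> 'z::topological_space"
  assumes M: "prob_space M" and N: "N \<ge> 1"
    and iid: "iid_copies M {1..N} Zs Q Z"
    and part: "random_partition M N K I Zs" and k: "k \<in> {1..K}"
    and E: "\<And>J. J \<subseteq> {1..N} \<Longrightarrow> E J \<in> sets (Pi\<^sub>M {1..N} (\<lambda>_. distr Q borel Z))"
      "\<And>J. J \<subseteq> {1..N} \<Longrightarrow> emeasure (Pi\<^sub>M {1..N} (\<lambda>_. distr Q borel Z)) (E J) \<le> b"
  shows "outer_measure_of M {w \<in> space M. restrict (\<lambda>i. Zs i w) {1..N} \<in> E (I k w)} \<le> b"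
proof -
  interpret prob_space M by fact
  let ?D = "distr Q borel Z"
  let ?data = "\<lambda>w. restrict (\<lambda>i. Zs i w) {1..N}"
  let ?P = "Pi\<^sub>M {1..N} (\<lambda>_. ?D)"
  let ?B = "Pi\<^sub>M {1..N} (\<lambda>_. borel :: 'z measure)"
  have ind: "indep_vars (\<lambda>_. borel) Zs {1..N}" and law: "\<And>i. i \<in> {1..N} \<Longrightarrow> distr M borel (Zs i) = ?D"
    using iid by (auto simp: iid_copies_def)
  have rv: "i \<in> {1..N} \<Longrightarrow> Zs i \<in> borel_measurable M" for i
    using ind by (auto simp: indep_vars_def)
  have dm: "?data \<in> measurable M ?B"
    using rv by (intro measurable_restrict) auto
  have setsP: "sets ?P = sets ?B" by (intro sets_PiM_cong) auto
  have dist: "distr M ?B ?data = ?P"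
  proof -
    have "distr M ?B ?data = (\<Pi>\<^sub>M i\<in>{1..N}. distr M borel (Zs i))"
      using ind rv N by (subst (asm) indep_vars_iff_distr_eq_PiM') auto
    also have "\<dots> = ?P" using law by (intro PiM_cong) auto
    finally show ?thesis .
  qed
  let ?FA = "sets (vimage_algebra (space M) (\<lambda>w. restrict (\<lambda>k. I k w) {1..K}) (count_space UNIV))"
  let ?DA = "sets (vimage_algebra (space M) ?data ?B)"
  have indep: "indep_set ?FA ?DA" using part unfolding random_partition_def by blast
  have cover: "I k w \<subseteq> {1..N}" if "w \<in> space M" for w
  proof -
    have "(\<Union>k\<in>{1..K}. I k w) = {1..N}" using part that unfolding random_partition_def by blast
    then show ?thesis using k by blast
  qed
  let ?fold = "\<lambda>J. {w \<in> space M. I k w = J}"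
  let ?dat = "\<lambda>J. {w \<in> space M. ?data w \<in> E J}"
  have F: "?fold J \<in> ?FA" for J
  proof -
    have "(\<lambda>w. restrict (\<lambda>k. I k w) {1..K}) -` {f. f k = J} \<inter> space M \<in> ?FA"
      by (rule in_vimage_algebra) simp
    also have "(\<lambda>w. restrict (\<lambda>k. I k w) {1..K}) -` {f. f k = J} \<inter> space M = ?fold J"
      using k by auto
    finally show ?thesis .
  qed
  have Dt: "?dat J \<in> ?DA" if "J \<subseteq> {1..N}" for J
  proof -
    have "?data -` E J \<inter> space M \<in> ?DA"
      using E(1)[OF that] setsP by (intro in_vimage_algebra) simp
    also have "?data -` E J \<inter> space M = ?dat J" by auto
    finally show ?thesis .
  qed
  have ev: "?FA \<subseteq> events" "?DA \<subseteq> events"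
    using indep unfolding indep_set_def indep_sets_def by (auto simp: UNIV_bool)
  have prob_dat: "emeasure M (?dat J) \<le> b" if "J \<subseteq> {1..N}" for J
  proof -
    have "emeasure M (?dat J) = emeasure (distr M ?B ?data) (E J)"
      using E(1)[OF that] setsP by (subst emeasure_distr[OF dm]) (auto intro!: arg_cong[where f = "emeasure M"])
    then show ?thesis using E(2)[OF that] dist by simp
  qed
  \<comment> \<open>Only subsets of \<open>{1..N}\<close> occur as folds, so splitting by the
    realised fold is a finite disjoint union. Each piece factorises by independence, and the fold
    probabilities sum to at most 1.\<close>
  let ?S = "\<lambda>J. ?fold J \<inter> ?dat J"
  have S: "?S J \<in> events" if "J \<subseteq> {1..N}" for J
    using F Dt[OF that] ev by blast
  have eqU: "{w \<in> space M. ?data w \<in> E (I k w)} = (\<Union>J\<in>Pow {1..N}. ?S J)"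
    using cover by fastforce
  have disj: "disjoint_family_on ?S (Pow {1..N})" "disjoint_family_on ?fold (Pow {1..N})"
    by (auto simp: disjoint_family_on_def)
  have "outer_measure_of M {w \<in> space M. ?data w \<in> E (I k w)} = emeasure M (\<Union>J\<in>Pow {1..N}. ?S J)"
    unfolding eqU using S by (intro outer_measure_of_eq sets.finite_UN) auto
  also have "\<dots> = (\<Sum>J\<in>Pow {1..N}. emeasure M (?S J))"
    using S disj by (intro sum_emeasure[symmetric]) auto
  also have "\<dots> = (\<Sum>J\<in>Pow {1..N}. emeasure M (?fold J) * emeasure M (?dat J))"
  proof (intro sum.cong refl)
    fix J assume "J \<in> Pow {1..N}"
    then have "prob (?S J) = prob (?fold J) * prob (?dat J)"
      using indep_setD[OF indep F Dt] by auto
    then show "emeasure M (?S J) = emeasure M (?fold J) * emeasure M (?dat J)"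
      by (simp add: emeasure_eq_measure ennreal_mult)
  qed
  also have "\<dots> \<le> (\<Sum>J\<in>Pow {1..N}. emeasure M (?fold J) * b)"
    using prob_dat by (intro sum_mono mult_left_mono) auto
  also have "\<dots> = emeasure M (\<Union>J\<in>Pow {1..N}. ?fold J) * b"
    using F ev disj by (subst sum_emeasure[symmetric]) (auto simp: sum_distrib_right)
  also have "\<dots> \<le> 1 * b"
    by (intro mult_right_mono emeasure_le_1) auto
  finally show ?thesis by simp
qed

text \<open>Common shape of all summands: the index set \<open>T\<close> and the data
  \<open>x\<close> train a function, which is then evaluated at an observation \<open>z\<close>.
  Joint measurability in \<open>x\<close> and \<open>z\<close> serves Fubini and makes conditional
  moments measurable in the training data.\<close>

definition measurable_statistic :: "nat \<Rightarrow> (nat set \<Rightarrow> (nat \<Rightarrow> 'z::topological_space) \<Rightarrow> 'z \<Rightarrow> real) \<Rightarrow> bool" where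
  "measurable_statistic N F \<longleftrightarrow>
    (\<forall>T\<subseteq>{1..N}. (\<lambda>(x, z). F T x z) \<in> borel_measurable (Pi\<^sub>M T (\<lambda>_. borel) \<Otimes>\<^sub>M borel))"

definition fold_stat ::
  "(nat set \<Rightarrow> (nat \<Rightarrow> 'z) \<Rightarrow> 'z \<Rightarrow> real) \<Rightarrow> nat \<Rightarrow> nat set \<Rightarrow> (nat \<Rightarrow> 'z) \<Rightarrow> 'z \<Rightarrow> real" where
  "fold_stat F N J z = F ({1..N} - J) (restrict z ({1..N} - J))"

definition cross_mean ::
  "(nat set \<Rightarrow> (nat \<Rightarrow> 'z) \<Rightarrow> 'z \<Rightarrow> real) \<Rightarrow> nat \<Rightarrow> nat \<Rightarrow> (nat \<Rightarrow> nat set) \<Rightarrow> (nat \<Rightarrow> 'z) \<Rightarrow> real" where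
  "cross_mean F N K I z = (\<Sum>i=1..N. fold_stat F N (I (fold_of K I i)) z (z i)) / real N"

lemma fold_of_eq:
  assumes "disjoint_family_on I {1..K}" "k \<in> {1..K}" "i \<in> I k"
  shows "fold_of K I i = k"
  unfolding fold_of_def
proof (intro the_equality)
  fix k' assume "k' \<in> {1..K} \<and> i \<in> I k'"
  then show "k' = k" using assms disjoint_family_onD[OF assms(1), of k' k] by blast
qed (use assms in simp)

text \<open>Each fold sum keeps the divisor \<open>N\<close> instead of its own size. Some folds may
  be empty or contain nearly everything, and both cases are harmless in this normalisation.\<close>

lemma cross_mean_eq_sum_folds:
  assumes "disjoint_family_on I {1..K}" "(\<Union>k\<in>{1..K}. I k) = {1..N}"
  shows "cross_mean F N K I z = (\<Sum>k\<in>{1..K}. (\<Sum>i\<in>I k. fold_stat F N (I k) z (z i)) / real N)"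
proof -
  have fin: "finite (I k)" if "k \<in> {1..K}" for k
    using assms(2) that by (metis UN_upper finite_atLeastAtMost finite_subset)
  have "(\<Sum>i=1..N. fold_stat F N (I (fold_of K I i)) z (z i)) =
      (\<Sum>k\<in>{1..K}. \<Sum>i\<in>I k. fold_stat F N (I (fold_of K I i)) z (z i))"
    unfolding assms(2)[symmetric] using fin assms(1)
    by (intro sum.UNION_disjoint) (auto simp: disjoint_family_on_def)
  also have "\<dots> = (\<Sum>k\<in>{1..K}. \<Sum>i\<in>I k. fold_stat F N (I k) z (z i))"
    using fold_of_eq[OF assms(1)] by (intro sum.cong) auto
  finally show ?thesis by (simp add: cross_mean_def sum_divide_distrib)
qed

lemma measurable_statistic_distr:
  fixes Z :: "'q \<Rightarrow> 'z::topological_space"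
  assumes "measurable_statistic N F" "T \<subseteq> {1..N}"
  shows "(\<lambda>(x, z). F T x z) \<in> borel_measurable (Pi\<^sub>M T (\<lambda>_. distr Q borel Z) \<Otimes>\<^sub>M distr Q borel Z)"
proof -
  have "sets (Pi\<^sub>M T (\<lambda>_. distr Q borel Z) \<Otimes>\<^sub>M distr Q borel Z) =
      sets (Pi\<^sub>M T (\<lambda>_. borel :: 'z measure) \<Otimes>\<^sub>M (borel :: 'z measure))"
    by (intro sets_pair_measure_cong sets_PiM_cong) auto
  from measurable_cong_sets[OF this refl] assms show ?thesis unfolding measurable_statistic_def by blast
qed

text \<open>Two reductions in a row: from the random fold to a fixed one, then by Fubini to a fixed
  trained function. What remains is a tail bound for i.i.d. sums of a deterministic \<open>f\<close>
  with property \<open>G\<close>, required for every \<open>J\<close> of at most \<open>N\<close>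
  elements because the fold size is not controlled.\<close>

lemma cross_fold_tail:
  fixes Zs :: "nat \<Rightarrow> 'w \<Rightarrow> 'z::topological_space"
  assumes M: "prob_space M" and Q: "prob_space Q" "Z \<in> borel_measurable Q" and N: "N \<ge> 1"
    and iid: "iid_copies M {1..N} Zs Q Z"
    and part: "random_partition M N K I Zs" and k: "k \<in> {1..K}"
    and F: "measurable_statistic N F"
    and G: "\<And>f (J::nat set). f \<in> borel_measurable (distr Q borel Z) \<Longrightarrow> G f \<Longrightarrow> finite J \<Longrightarrow> card J \<le> N \<Longrightarrow>
      emeasure (Pi\<^sub>M J (\<lambda>_. distr Q borel Z)) {y \<in> space (Pi\<^sub>M J (\<lambda>_. distr Q borel Z)). \<bar>\<Sum>i\<in>J. f (y i)\<bar> > t} \<le> b"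
    and G_meas: "\<And>T. T \<subseteq> {1..N} \<Longrightarrow> Measurable.pred (Pi\<^sub>M T (\<lambda>_. distr Q borel Z)) (\<lambda>x. G (F T x))"
  shows "outer_measure_of M {w \<in> space M. G (fold_stat F N (I k w) (\<lambda>i. Zs i w)) \<and>
    \<bar>\<Sum>i\<in>I k w. fold_stat F N (I k w) (\<lambda>i. Zs i w) (Zs i w)\<bar> > t} \<le> b"
proof -
  let ?D = "distr Q borel Z"
  have D: "prob_space ?D" using prob_space.prob_space_distr[OF Q] .
  define E where "E J = {x \<in> space (Pi\<^sub>M {1..N} (\<lambda>_. ?D)). G (F ({1..N} - J) (restrict x ({1..N} - J))) \<and>
      \<bar>\<Sum>i\<in>J. F ({1..N} - J) (restrict x ({1..N} - J)) (x i)\<bar> > t}" for J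
  note F' = measurable_statistic_distr[OF F, of _ Q Z]
  have EJ: "E J \<in> sets (Pi\<^sub>M {1..N} (\<lambda>_. ?D))" "emeasure (Pi\<^sub>M {1..N} (\<lambda>_. ?D)) (E J) \<le> b" if J: "J \<subseteq> {1..N}" for J
  proof -
    have fin: "finite J" "card J \<le> N" using J card_mono[OF _ J] finite_subset by auto
    have m: "F ({1..N} - J) x \<in> borel_measurable ?D" if x: "x \<in> space (Pi\<^sub>M ({1..N} - J) (\<lambda>_. ?D))" for x
      using measurable_compose[OF measurable_Pair1'[OF x] F'[of "{1..N} - J"]] by simp
    have inner: "emeasure (Pi\<^sub>M J (\<lambda>_. ?D)) {y \<in> space (Pi\<^sub>M J (\<lambda>_. ?D)). \<bar>\<Sum>i\<in>J. F ({1..N} - J) x (y i)\<bar> > t} \<le> b"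
      if "x \<in> space (Pi\<^sub>M ({1..N} - J) (\<lambda>_. ?D))" "G (F ({1..N} - J) x)" for x
      by (rule G[OF m[OF that(1)] that(2) fin])
    note * = fold_tail_PiM[OF D finite_atLeastAtMost J F'[OF Diff_subset] G_meas[OF Diff_subset] inner, folded E_def]
    show "E J \<in> sets (Pi\<^sub>M {1..N} (\<lambda>_. ?D))" "emeasure (Pi\<^sub>M {1..N} (\<lambda>_. ?D)) (E J) \<le> b"
      by (rule *; assumption)+
  qed
  have "{w \<in> space M. G (fold_stat F N (I k w) (\<lambda>i. Zs i w)) \<and>
    \<bar>\<Sum>i\<in>I k w. fold_stat F N (I k w) (\<lambda>i. Zs i w) (Zs i w)\<bar> > t} \<subseteq>
    {w \<in> space M. restrict (\<lambda>i. Zs i w) {1..N} \<in> E (I k w)}"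
  proof (intro subsetI)
    fix w assume w: "w \<in> {w \<in> space M. G (fold_stat F N (I k w) (\<lambda>i. Zs i w)) \<and>
      \<bar>\<Sum>i\<in>I k w. fold_stat F N (I k w) (\<lambda>i. Zs i w) (Zs i w)\<bar> > t}"
    have "(\<Union>k\<in>{1..K}. I k w) = {1..N}" using part w unfolding random_partition_def by blast
    then have J: "I k w \<subseteq> {1..N}" using k by blast
    have r: "restrict (restrict (\<lambda>i. Zs i w) {1..N}) ({1..N} - I k w) = restrict (\<lambda>i. Zs i w) ({1..N} - I k w)"
      by (auto simp: fun_eq_iff)
    have s: "(\<Sum>i\<in>I k w. F ({1..N} - I k w) x (restrict (\<lambda>i. Zs i w) {1..N} i)) =
        (\<Sum>i\<in>I k w. F ({1..N} - I k w) x (Zs i w))" for x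
      using J by (intro sum.cong) auto
    show "w \<in> {w \<in> space M. restrict (\<lambda>i. Zs i w) {1..N} \<in> E (I k w)}"
      using w unfolding E_def mem_Collect_eq r s fold_stat_def by (simp add: space_PiM)
  qed
  then have "outer_measure_of M {w \<in> space M. G (fold_stat F N (I k w) (\<lambda>i. Zs i w)) \<and>
    \<bar>\<Sum>i\<in>I k w. fold_stat F N (I k w) (\<lambda>i. Zs i w) (Zs i w)\<bar> > t} \<le>
    outer_measure_of M {w \<in> space M. restrict (\<lambda>i. Zs i w) {1..N} \<in> E (I k w)}"
    by (rule outer_measure_of_mono)
  also have "\<dots> \<le> b"
    using EJ by (intro random_fold_tail[OF M N iid part k])
  finally show ?thesis .
qed

section \<open>Cross-fitted averages along a sequence of samples\<close>

locale cross_fitting =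
  fixes Q :: "'q measure" and Z :: "nat \<Rightarrow> 'q \<Rightarrow> 'z::topological_space"
    and M :: "nat \<Rightarrow> 'w measure" and Zs :: "nat \<Rightarrow> nat \<Rightarrow> 'w \<Rightarrow> 'z"
    and K :: nat and I :: "nat \<Rightarrow> nat \<Rightarrow> 'w \<Rightarrow> nat set"
  assumes Q: "prob_space Q"
    and Z: "\<And>N. N \<ge> 1 \<Longrightarrow> Z N \<in> borel_measurable Q"
    and M: "\<And>N. N \<ge> 1 \<Longrightarrow> prob_space (M N)"
    and iid: "\<And>N. N \<ge> 1 \<Longrightarrow> iid_copies (M N) {1..N} (Zs N) Q (Z N)"
    and part: "\<And>N. N \<ge> 1 \<Longrightarrow> random_partition (M N) N K (I N) (Zs N)"
begin

abbreviation law :: "nat \<Rightarrow> 'z measure" where "law N \<equiv> distr Q borel (Z N)"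

lemma prob_law: "N \<ge> 1 \<Longrightarrow> prob_space (law N)"
  by (rule prob_space.prob_space_distr[OF Q Z])

abbreviation trained :: "(nat \<Rightarrow> nat set \<Rightarrow> (nat \<Rightarrow> 'z) \<Rightarrow> 'z \<Rightarrow> real) \<Rightarrow> nat \<Rightarrow> nat \<Rightarrow> 'w \<Rightarrow> 'z \<Rightarrow> real" where
  "trained F N k w \<equiv> fold_stat (F N) N (I N k w) (\<lambda>i. Zs N i w)"

abbreviation cross_avg :: "(nat \<Rightarrow> nat set \<Rightarrow> (nat \<Rightarrow> 'z) \<Rightarrow> 'z \<Rightarrow> real) \<Rightarrow> nat \<Rightarrow> 'w \<Rightarrow> real" where
  "cross_avg F N w \<equiv> cross_mean (F N) N K (\<lambda>k. I N k w) (\<lambda>i. Zs N i w)"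

abbreviation fold_avg :: "(nat \<Rightarrow> nat set \<Rightarrow> (nat \<Rightarrow> 'z) \<Rightarrow> 'z \<Rightarrow> real) \<Rightarrow> nat \<Rightarrow> nat \<Rightarrow> 'w \<Rightarrow> real" where
  "fold_avg F k N w \<equiv> (\<Sum>i\<in>I N k w. trained F N k w (Zs N i w)) / real N"

lemma cross_avg_eq: "N \<ge> 1 \<Longrightarrow> w \<in> space (M N) \<Longrightarrow> cross_avg F N w = (\<Sum>k\<in>{1..K}. fold_avg F k N w)"
  using part[of N] unfolding random_partition_def by (intro cross_mean_eq_sum_folds) auto

text \<open>The budget is halved: \<epsilon>/2 for the control variable \<open>W\<close> exceeding
  \<open>u\<close>, the only way for \<open>G\<close> to fail, and \<epsilon>/2 for a large average
  while \<open>G\<close> holds. Only \<open>G\<close> has to be measurable; \<open>W\<close> enters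
  through outer probability.\<close>

lemma fold_avg_tail:
  assumes N: "N \<ge> 1" and k: "k \<in> {1..K}" and F: "measurable_statistic N (F N)" and \<epsilon>: "\<epsilon> > 0"
    and G: "\<And>f (J :: nat set). f \<in> borel_measurable (law N) \<Longrightarrow> G f \<Longrightarrow> finite J \<Longrightarrow> card J \<le> N \<Longrightarrow>
      emeasure (Pi\<^sub>M J (\<lambda>_. law N)) {y \<in> space (Pi\<^sub>M J (\<lambda>_. law N)). \<bar>\<Sum>i\<in>J. f (y i)\<bar> > t * real N} \<le> ennreal (\<epsilon>/2)"
    and G_meas: "\<And>T. T \<subseteq> {1..N} \<Longrightarrow> Measurable.pred (Pi\<^sub>M T (\<lambda>_. law N)) (\<lambda>x. G (F N T x))"
    and A: "tail M W N u \<le> ennreal (\<epsilon>/2)" "\<And>w. w \<in> space (M N) \<Longrightarrow> \<bar>W N w\<bar> \<le> ereal u \<Longrightarrow> G (trained F N k w)"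
  shows "tail M (\<lambda>N w. ereal (fold_avg F k N w)) N t \<le> ennreal \<epsilon>"
proof -
  let ?B = "{w \<in> space (M N). G (trained F N k w) \<and> \<bar>\<Sum>i\<in>I N k w. trained F N k w (Zs N i w)\<bar> > t * real N}"
  have B: "outer_measure_of (M N) ?B \<le> ennreal (\<epsilon>/2)"
    by (rule cross_fold_tail[OF M[OF N] Q Z[OF N] N iid[OF N] part[OF N] k F G G_meas])
  have "tail_event M (\<lambda>N w. ereal (fold_avg F k N w)) N t \<subseteq> tail_event M W N u \<union> ?B"
  proof (intro subsetI)
    fix w assume "w \<in> tail_event M (\<lambda>N w. ereal (fold_avg F k N w)) N t"
    then have w: "w \<in> space (M N)" "t < \<bar>\<Sum>i\<in>I N k w. trained F N k w (Zs N i w)\<bar> / real N" by simp_all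
    have "t * real N < \<bar>\<Sum>i\<in>I N k w. trained F N k w (Zs N i w)\<bar>"
      using w(2) N by (subst (asm) pos_less_divide_eq) auto
    with w(1) A(2)[OF w(1)] show "w \<in> tail_event M W N u \<union> ?B" by (auto simp: not_le[symmetric])
  qed
  then have "tail M (\<lambda>N w. ereal (fold_avg F k N w)) N t \<le> tail M W N u + outer_measure_of (M N) ?B"
    by (intro order_trans[OF outer_measure_of_mono outer_measure_of_Un]) auto
  also have "\<dots> \<le> ennreal (\<epsilon>/2) + ennreal (\<epsilon>/2)" using A(1) B by (rule add_mono)
  also have "\<dots> = ennreal \<epsilon>" using \<epsilon> by (simp flip: ennreal_plus)
  finally show ?thesis .
qed

lemma bigOp_cross_avg:
  assumes F: "\<And>N. N \<ge> 1 \<Longrightarrow> measurable_statistic N (F N)"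
    and r: "\<And>N. N \<ge> 1 \<Longrightarrow> r N > 0"
    and L1: "\<And>k. k \<in> {1..K} \<Longrightarrow> bigOp M (\<lambda>N w. enn2ereal (\<integral>\<^sup>+z. ennreal \<bar>trained F N k w z\<bar> \<partial>law N)) r"
  shows "real_bigOp M (cross_avg F) r"
proof -
  have fold: "real_bigOp M (fold_avg F k) r" if k: "k \<in> {1..K}" for k
    unfolding bigOp_def
  proof (intro allI impI)
    fix \<epsilon> :: real assume e: "\<epsilon> > 0"
    let ?W = "\<lambda>N w. enn2ereal (\<integral>\<^sup>+z. ennreal \<bar>trained F N k w z\<bar> \<partial>law N)"
    obtain K1 where K1: "K1 > 0" "\<forall>\<^sub>F N in sequentially. tail M ?W N (K1 * r N) \<le> ennreal (\<epsilon>/2)"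
      using bigOpD[OF L1[OF k], of "\<epsilon>/2"] e by auto
    \<comment> \<open>Markov gives the tail bound \<open>card J / N * (K1 / K2)\<close>, and this
      choice makes \<open>K1 / K2\<close> equal to \<epsilon>/2.\<close>
    define K2 where "K2 = 2 * K1 / \<epsilon>"
    have K2: "K2 > 0" using K1 e by (simp add: K2_def)
    have "\<forall>\<^sub>F N in sequentially. tail M (\<lambda>N w. ereal (fold_avg F k N w)) N (K2 * r N) \<le> ennreal \<epsilon>"
      using K1(2) eventually_ge_at_top[of 1]
    proof eventually_elim
      case (elim N)
      note N = elim(2)
      interpret D: prob_space "law N" using prob_law[OF N] .
      let ?G = "\<lambda>f. (\<integral>\<^sup>+z. ennreal \<bar>f z\<bar> \<partial>law N) \<le> ennreal (K1 * r N)"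
      show ?case
      proof (rule fold_avg_tail[where G = ?G and F = F and W = ?W and u = "K1 * r N", OF N k F[OF N] e _ _ elim(1)])
        fix f and J :: "nat set" assume f: "f \<in> borel_measurable (law N)" "?G f" "finite J" "card J \<le> N"
        have "real (card J) * (K1 * r N) / (K2 * r N * real N) = (real (card J) / real N) * (\<epsilon> / 2)"
          using r[OF N] K1 e N by (simp add: K2_def field_simps)
        also have "\<dots> \<le> 1 * (\<epsilon> / 2)"
          using f(4) N e by (intro mult_right_mono) auto
        finally show "emeasure (Pi\<^sub>M J (\<lambda>_. law N)) {y \<in> space (Pi\<^sub>M J (\<lambda>_. law N)). \<bar>\<Sum>i\<in>J. f (y i)\<bar> > K2 * r N * real N} \<le> ennreal (\<epsilon>/2)"
          using r[OF N] K1 K2 N by (intro sum_PiM_tail_L1[OF prob_law[OF N] f(3) f(1) f(2)]) (auto intro: less_imp_le)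
      next
        fix T :: "nat set" assume T: "T \<subseteq> {1..N}"
        have "(\<lambda>x. \<integral>\<^sup>+z. ennreal \<bar>F N T x z\<bar> \<partial>law N) \<in> borel_measurable (Pi\<^sub>M T (\<lambda>_. law N))"
          using measurable_statistic_distr[OF F[OF N] T, of Q "Z N"]
          by (intro D.borel_measurable_nn_integral) (simp add: split_beta')
        then show "Measurable.pred (Pi\<^sub>M T (\<lambda>_. law N)) (\<lambda>x. ?G (F N T x))" by measurable
      next
        fix w assume "\<bar>?W N w\<bar> \<le> ereal (K1 * r N)"
        then show "?G (trained F N k w)"
          using r[OF N] K1(1) by (simp add: less_eq_ennreal.rep_eq enn2ereal_ennreal)
      qed
    qed
    with K2 show "\<exists>K>0. \<forall>\<^sub>F N in sequentially. tail M (\<lambda>N w. ereal (fold_avg F k N w)) N (K * r N) \<le> ennreal \<epsilon>"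
      by blast
  qed
  have r0: "r N \<ge> 0" if "N \<ge> 1" for N using r[OF that] by simp
  have sum: "real_bigOp M (\<lambda>N w. \<Sum>k\<in>{1..K}. fold_avg F k N w) r"
    by (rule bigOp_sum[OF _ fold r0]) auto
  show ?thesis
  proof (rule bigOp_mono[OF sum _ r0])
    fix L :: real assume "L > 0"
    then show "\<exists>K'>0. \<forall>\<^sub>F N in sequentially. \<forall>w\<in>space (M N).
        \<bar>ereal (\<Sum>k\<in>{1..K}. fold_avg F k N w)\<bar> \<le> ereal (L * r N) \<longrightarrow> \<bar>ereal (cross_avg F N w)\<bar> \<le> ereal (K' * r N)"
      by (intro exI[of _ L] conjI eventually_mono[OF eventually_ge_at_top[of 1]]) (simp_all add: cross_avg_eq)
  qed
qed

text \<open>The infinite value off the conditionally centred case turns \<open>L2\<close> into the statement that the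
  average is conditionally centred with probability tending to one.\<close>

lemma littleop_cross_avg:
  assumes F: "\<And>N. N \<ge> 1 \<Longrightarrow> measurable_statistic N (F N)"
    and s: "\<And>N. N \<ge> 1 \<Longrightarrow> s N > 0"
    and L2: "\<And>k. k \<in> {1..K} \<Longrightarrow> littleop M (\<lambda>N w. if (\<integral>z. trained F N k w z \<partial>law N) = 0
        then enn2ereal (\<integral>\<^sup>+z. ennreal ((trained F N k w z)\<^sup>2) \<partial>law N) else \<infinity>) s"
  shows "real_littleop M (cross_avg F) (\<lambda>N. sqrt (s N / real N))"
proof -
  let ?W = "\<lambda>k N w. if (\<integral>z. trained F N k w z \<partial>law N) = 0
        then enn2ereal (\<integral>\<^sup>+z. ennreal ((trained F N k w z)\<^sup>2) \<partial>law N) else \<infinity>"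
  have fold: "real_littleop M (fold_avg F k) (\<lambda>N. sqrt (s N / real N))" if k: "k \<in> {1..K}" for k
    unfolding littleop_iff
  proof (intro allI impI)
    fix \<delta> \<epsilon> :: real assume d: "\<delta> > 0" and e: "\<epsilon> > 0"
    \<comment> \<open>Chebyshev gives the tail bound
      \<open>card J / N * (\<delta>' / \<delta>\<^sup>2)\<close>; the choice of
      \<open>\<delta>'\<close> turns the last quotient into \<epsilon>/2.\<close>
    define \<delta>' where "\<delta>' = \<delta>\<^sup>2 * \<epsilon> / 2"
    have d': "\<delta>' > 0" using d e by (simp add: \<delta>'_def)
    have "\<forall>\<^sub>F N in sequentially. tail M (?W k) N (\<delta>' * s N) \<le> ennreal (\<epsilon>/2)"
      using e by (intro littleopD[OF L2[OF k] d']) simp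
    then show "\<forall>\<^sub>F N in sequentially. tail M (\<lambda>N w. ereal (fold_avg F k N w)) N (\<delta> * sqrt (s N / real N)) \<le> ennreal \<epsilon>"
      using eventually_ge_at_top[of 1]
    proof eventually_elim
      case (elim N)
      note N = elim(2)
      interpret D: prob_space "law N" using prob_law[OF N] .
      let ?t = "\<delta> * sqrt (s N / real N) * real N"
      let ?G = "\<lambda>f. (\<integral>\<^sup>+z. ennreal ((f z)\<^sup>2) \<partial>law N) \<le> ennreal (\<delta>' * s N) \<and> (\<integral>z. f z \<partial>law N) = 0"
      show ?case
      proof (rule fold_avg_tail[where G = ?G and F = F and W = "?W k" and u = "\<delta>' * s N", OF N k F[OF N] e _ _ elim(1)])
        fix f and J :: "nat set" assume f: "f \<in> borel_measurable (law N)" "?G f" "finite J" "card J \<le> N"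
        have t2: "?t\<^sup>2 = \<delta>\<^sup>2 * s N * real N"
          unfolding power_mult_distrib using s[OF N] N by (simp add: power2_eq_square)
        have "real (card J) * (\<delta>' * s N) / ?t\<^sup>2 = (real (card J) / real N) * (\<epsilon> / 2)"
          unfolding t2 \<delta>'_def using s[OF N] d N by (simp add: field_simps power2_eq_square)
        also have "\<dots> \<le> 1 * (\<epsilon> / 2)"
          using f(4) N e by (intro mult_right_mono) auto
        finally have le: "real (card J) * (\<delta>' * s N) / ?t\<^sup>2 \<le> \<epsilon> / 2" by simp
        have t0: "?t > 0" using s[OF N] d N by simp
        show "emeasure (Pi\<^sub>M J (\<lambda>_. law N)) {y \<in> space (Pi\<^sub>M J (\<lambda>_. law N)). \<bar>\<Sum>i\<in>J. f (y i)\<bar> > ?t} \<le> ennreal (\<epsilon>/2)"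
          by (rule sum_PiM_tail_L2[OF prob_law[OF N] f(3) f(1) conjunct1[OF f(2)] conjunct2[OF f(2)] t0 le])
             (use d' s[OF N] in simp)
      next
        fix T :: "nat set" assume T: "T \<subseteq> {1..N}"
        note m = measurable_statistic_distr[OF F[OF N] T, of Q "Z N"]
        have 1: "(\<lambda>x. \<integral>\<^sup>+z. ennreal ((F N T x z)\<^sup>2) \<partial>law N) \<in> borel_measurable (Pi\<^sub>M T (\<lambda>_. law N))"
          using m by (intro D.borel_measurable_nn_integral) (simp add: split_beta')
        have 2: "(\<lambda>x. \<integral>z. F N T x z \<partial>law N) \<in> borel_measurable (Pi\<^sub>M T (\<lambda>_. law N))"
          using m by (rule D.borel_measurable_lebesgue_integral)
        show "Measurable.pred (Pi\<^sub>M T (\<lambda>_. law N)) (\<lambda>x. ?G (F N T x))" using 1 2 by measurable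
      next
        fix w assume "\<bar>?W k N w\<bar> \<le> ereal (\<delta>' * s N)"
        then show "?G (trained F N k w)"
          using s[OF N] d' by (simp add: less_eq_ennreal.rep_eq enn2ereal_ennreal split: if_splits)
      qed
    qed
  qed
  have r0: "sqrt (s N / real N) \<ge> 0" if "N \<ge> 1" for N using s[OF that] by simp
  have sum: "real_littleop M (\<lambda>N w. \<Sum>k\<in>{1..K}. fold_avg F k N w) (\<lambda>N. sqrt (s N / real N))"
    by (rule littleop_sum[OF _ fold r0]) auto
  show ?thesis
    by (rule littleop_cong_AE[OF sum]) (intro AE_I2, simp add: cross_avg_eq)
qed

end

section \<open>Conditioning on the covariates\<close>

text \<open>The complement of the support is covered by those members of a countable basis that are
  null. This turns conditions imposed on the support, such as overlap, into almost sure
  ones.\<close>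

lemma AE_law_support:
  fixes P :: "'x::second_countable_topology measure"
  assumes P: "sets P = sets borel"
  shows "AE x in P. x \<in> law_support P"
proof -
  obtain B :: "'x set set" where B: "countable B" "topological_basis B"
    using ex_countable_basis by blast
  define U where "U = (\<Union>b\<in>{b\<in>B. emeasure P b = 0}. b)"
  have bo: "b \<in> sets P" if "b \<in> B" for b
    using topological_basis_open[OF B(2) that] P by auto
  have "U \<in> null_sets P"
    unfolding U_def using B(1) bo by (intro null_sets_UN') (auto simp: null_setsI)
  moreover have "{x \<in> space P. \<not> x \<in> law_support P} \<subseteq> U"
  proof
    fix x assume "x \<in> {x \<in> space P. \<not> x \<in> law_support P}"
    then obtain V where V: "open V" "x \<in> V" "emeasure P V = 0"
      by (auto simp: law_support_def)
    then obtain b where b: "b \<in> B" "x \<in> b" "b \<subseteq> V"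
      using topological_basisE[OF B(2) V(1,2)] by blast
    have "emeasure P b \<le> emeasure P V"
      using b V P by (intro emeasure_mono) auto
    with V(3) b show "x \<in> U" by (auto simp: U_def)
  qed
  ultimately show ?thesis by (rule AE_I')
qed

lemma subalgebra_sigma_of:
  "X \<in> borel_measurable Q \<Longrightarrow> subalgebra Q (sigma_of Q X)"
  by (auto simp: subalgebra_def sigma_of_def sets_vimage_algebra2 measurable_sets)

lemma measurable_sigma_of: "X \<in> borel_measurable (sigma_of Q X)"
  unfolding sigma_of_def by (rule measurable_vimage_algebra1) simp

lemma finite_measure_subalgebra_sigma_of:
  assumes "prob_space Q" "X \<in> borel_measurable Q"
  shows "finite_measure_subalgebra Q (sigma_of Q X)"
  using assms by (simp add: finite_measure_subalgebra_def finite_measure_subalgebra_axioms_def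
      subalgebra_sigma_of prob_space.finite_measure)

lemma measurable_comp_sigma_of:
  "f \<in> measurable borel N \<Longrightarrow> (\<lambda>w. f (X w)) \<in> measurable (sigma_of Q X) N"
  by (rule measurable_compose[OF measurable_sigma_of])

lemma nn_integral_le_of_cond_le:
  assumes "prob_space Q" "X \<in> borel_measurable Q"
    and f: "f \<in> borel_measurable borel" and W: "W \<in> borel_measurable Q"
    and le: "AE w in Q. nn_cond_exp Q (sigma_of Q X) W w \<le> b"
  shows "(\<integral>\<^sup>+w. f (X w) * W w \<partial>Q) \<le> b * (\<integral>\<^sup>+w. f (X w) \<partial>Q)"
proof -
  interpret finite_measure_subalgebra Q "sigma_of Q X"
    using assms finite_measure_subalgebra_sigma_of by blast
  have "(\<integral>\<^sup>+w. f (X w) * W w \<partial>Q) = (\<integral>\<^sup>+w. f (X w) * nn_cond_exp Q (sigma_of Q X) W w \<partial>Q)"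
    using W measurable_comp_sigma_of[OF f] by (intro nn_cond_exp_intg[symmetric])
  also have "\<dots> \<le> (\<integral>\<^sup>+w. b * f (X w) \<partial>Q)"
    using le by (intro nn_integral_mono_AE) (auto elim!: eventually_mono simp: mult.commute[of b] intro!: mult_left_mono)
  also have "\<dots> = b * (\<integral>\<^sup>+w. f (X w) \<partial>Q)"
    using f assms(2) by (intro nn_integral_cmult measurable_compose[OF assms(2)])
  finally show ?thesis .
qed

lemma nn_integral_ge_of_cond_ge:
  assumes "prob_space Q" "X \<in> borel_measurable Q"
    and f: "f \<in> borel_measurable borel" and W: "W \<in> borel_measurable Q"
    and le: "AE w in Q. nn_cond_exp Q (sigma_of Q X) W w \<ge> b"
  shows "(\<integral>\<^sup>+w. f (X w) * W w \<partial>Q) \<ge> b * (\<integral>\<^sup>+w. f (X w) \<partial>Q)"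
proof -
  interpret finite_measure_subalgebra Q "sigma_of Q X"
    using assms finite_measure_subalgebra_sigma_of by blast
  have "b * (\<integral>\<^sup>+w. f (X w) \<partial>Q) = (\<integral>\<^sup>+w. b * f (X w) \<partial>Q)"
    using f assms(2) by (intro nn_integral_cmult[symmetric] measurable_compose[OF assms(2)])
  also have "\<dots> \<le> (\<integral>\<^sup>+w. f (X w) * nn_cond_exp Q (sigma_of Q X) W w \<partial>Q)"
    using le by (intro nn_integral_mono_AE) (auto elim!: eventually_mono simp: mult.commute[of b] intro!: mult_left_mono)
  also have "\<dots> = (\<integral>\<^sup>+w. f (X w) * W w \<partial>Q)"
    using W measurable_comp_sigma_of[OF f] by (intro nn_cond_exp_intg)
  finally show ?thesis .
qed

text \<open>A version of a conditional probability is an arbitrary Borel function off a null set, so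
  even its range is known only almost surely.\<close>

lemma is_cond_mean_prob_bounds:
  assumes Q: "prob_space Q" and X: "X \<in> borel_measurable Q"
    and p: "is_cond_mean Q X (\<lambda>w. of_bool (P w)) p"
  shows "AE w in Q. 0 \<le> p (X w) \<and> p (X w) \<le> 1"
proof -
  interpret finite_measure_subalgebra Q "sigma_of Q X"
    using finite_measure_subalgebra_sigma_of[OF Q X] .
  have i: "integrable Q (\<lambda>w. of_bool (P w) :: real)" using p by (simp add: is_cond_mean_def)
  have "AE w in Q. real_cond_exp Q (sigma_of Q X) (\<lambda>w. of_bool (P w)) w = p (X w)"
    using p by (simp add: is_cond_mean_def)
  moreover have "AE w in Q. real_cond_exp Q (sigma_of Q X) (\<lambda>w. of_bool (P w)) w \<ge> 0"
    using i by (intro real_cond_exp_pos) auto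
  moreover have "AE w in Q. real_cond_exp Q (sigma_of Q X) (\<lambda>w. of_bool (P w)) w \<le> 1"
    by (rule real_cond_exp_le_c[OF i]) auto
  ultimately show ?thesis by eventually_elim auto
qed

text \<open>Conditional independence is only given on rectangles of events; agreement of the two
  weighted joint laws extends it to all integrands.\<close>

lemma cond_indep_weighted_law:
  fixes V :: "'q \<Rightarrow> 'a::second_countable_topology" and X :: "'q \<Rightarrow> 'x::second_countable_topology"
  assumes Q: "prob_space Q" and X[measurable]: "X \<in> borel_measurable Q"
    and V[measurable]: "V \<in> borel_measurable Q" and W[measurable]: "W \<in> borel_measurable Q"
    and ci: "cond_indep Q V W X" and B[measurable]: "B \<in> sets borel"
    and p: "is_cond_mean Q X (\<lambda>w. of_bool (W w \<in> B)) p"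
  shows "distr (density Q (\<lambda>w. ennreal (of_bool (W w \<in> B)))) (borel \<Otimes>\<^sub>M borel) (\<lambda>w. (V w, X w)) =
    distr (density Q (\<lambda>w. ennreal (p (X w)))) (borel \<Otimes>\<^sub>M borel) (\<lambda>w. (V w, X w))"
    (is "?L = ?R")
proof -
  interpret Q: prob_space Q by fact
  interpret finite_measure_subalgebra Q "sigma_of Q X"
    using finite_measure_subalgebra_sigma_of[OF Q X] .
  have pm[measurable]: "p \<in> borel_measurable borel" using p by (simp add: is_cond_mean_def)
  have pb: "AE w in Q. 0 \<le> p (X w) \<and> p (X w) \<le> 1" by (rule is_cond_mean_prob_bounds[OF Q X p])
  let ?E = "real_cond_exp Q (sigma_of Q X)"
  \<comment> \<open>The rectangle identity is tested against \<open>indicator C (X w)\<close>: the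
    joint conditional probability factors, \<open>p\<close> takes the place of that of
    \<open>W\<close>, and the remaining conditional expectation is integrated out.\<close>
  have key: "(\<integral>w. indicator C (X w) * of_bool (V w \<in> A \<and> W w \<in> B) \<partial>Q) =
      (\<integral>w. (indicator C (X w) * p (X w)) * of_bool (V w \<in> A) \<partial>Q)"
    and int2: "integrable Q (\<lambda>w. (indicator C (X w) * p (X w)) * of_bool (V w \<in> A))"
    and int1: "integrable Q (\<lambda>w. indicator C (X w) * of_bool (V w \<in> A \<and> W w \<in> B) :: real)"
    if A[measurable]: "A \<in> sets borel" and C[measurable]: "C \<in> sets borel" for A C
  proof -
    show i1: "integrable Q (\<lambda>w. indicator C (X w) * of_bool (V w \<in> A \<and> W w \<in> B) :: real)"
      by (rule Q.integrable_const_bound[of _ 1]) (auto split: split_indicator)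
    show i2: "integrable Q (\<lambda>w. (indicator C (X w) * p (X w)) * of_bool (V w \<in> A))"
    proof (rule Q.integrable_const_bound[of _ 1])
      show "AE w in Q. norm ((indicator C (X w) * p (X w)) * of_bool (V w \<in> A)) \<le> 1"
        using pb by eventually_elim (auto split: split_indicator)
    qed measurable
    have m1: "(\<lambda>w. indicator C (X w) :: real) \<in> borel_measurable (sigma_of Q X)"
      by (rule measurable_comp_sigma_of) simp
    have m2: "(\<lambda>w. indicator C (X w) * p (X w)) \<in> borel_measurable (sigma_of Q X)"
      by (rule measurable_comp_sigma_of) simp
    have "(\<integral>w. indicator C (X w) * of_bool (V w \<in> A \<and> W w \<in> B) \<partial>Q) =
        (\<integral>w. indicator C (X w) * ?E (\<lambda>w. of_bool (V w \<in> A \<and> W w \<in> B)) w \<partial>Q)"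
      by (rule real_cond_exp_intg(2)[OF i1 m1, symmetric]) simp
    also have "\<dots> = (\<integral>w. (indicator C (X w) * p (X w)) * ?E (\<lambda>w. of_bool (V w \<in> A)) w \<partial>Q)"
    proof (intro integral_cong_AE)
      show "AE w in Q. indicator C (X w) * ?E (\<lambda>w. of_bool (V w \<in> A \<and> W w \<in> B)) w =
          indicator C (X w) * p (X w) * ?E (\<lambda>w. of_bool (V w \<in> A)) w"
        using ci[unfolded cond_indep_def, rule_format, OF A B] p[unfolded is_cond_mean_def, THEN conjunct2, THEN conjunct2]
        by eventually_elim simp
    qed measurable
    also have "\<dots> = (\<integral>w. (indicator C (X w) * p (X w)) * of_bool (V w \<in> A) \<partial>Q)"
      by (rule real_cond_exp_intg(2)[OF i2 m2]) simp
    finally show "(\<integral>w. indicator C (X w) * of_bool (V w \<in> A \<and> W w \<in> B) \<partial>Q) =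
      (\<integral>w. (indicator C (X w) * p (X w)) * of_bool (V w \<in> A) \<partial>Q)" .
  qed
  let ?G = "{a \<times> b | a b. a \<in> sets (borel :: 'a measure) \<and> b \<in> sets (borel :: 'x measure)}"
  have VX: "(\<lambda>w. (V w, X w)) \<in> measurable Q (borel \<Otimes>\<^sub>M borel)" by measurable
  show ?thesis
  \<comment> \<open>Rectangles are an intersection-stable generator. The whole space is itself a
    rectangle of mass at most 1, so the constant sequence serves as the exhaustion.\<close>
  proof (rule measure_eqI_generator_eq[OF Int_stable_pair_measure_generator, of borel borel UNIV _ _ "\<lambda>_. UNIV"])
    fix S assume "S \<in> ?G"
    then obtain A C where S: "S = A \<times> C" and A[measurable]: "A \<in> sets borel" and C[measurable]: "C \<in> sets borel" by auto
    have "emeasure ?L S = (\<integral>\<^sup>+w. ennreal (of_bool (W w \<in> B)) * indicator ((\<lambda>w. (V w, X w)) -` S \<inter> space Q) w \<partial>Q)"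
      using VX A C unfolding S by (simp add: emeasure_distr emeasure_density measurable_sets)
    also have "\<dots> = (\<integral>\<^sup>+w. ennreal (indicator C (X w) * of_bool (V w \<in> A \<and> W w \<in> B)) \<partial>Q)"
      unfolding S by (intro nn_integral_cong) (auto split: split_indicator)
    also have "\<dots> = ennreal (\<integral>w. indicator C (X w) * of_bool (V w \<in> A \<and> W w \<in> B) \<partial>Q)"
      by (rule nn_integral_eq_integral[OF int1[OF A C]]) simp
    also have "\<dots> = ennreal (\<integral>w. (indicator C (X w) * p (X w)) * of_bool (V w \<in> A) \<partial>Q)"
      unfolding key[OF A C] ..
    also have "\<dots> = (\<integral>\<^sup>+w. ennreal ((indicator C (X w) * p (X w)) * of_bool (V w \<in> A)) \<partial>Q)"
      using pb by (intro nn_integral_eq_integral[symmetric] int2[OF A C]) (auto elim!: eventually_mono)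
    also have "\<dots> = (\<integral>\<^sup>+w. ennreal (p (X w)) * indicator ((\<lambda>w. (V w, X w)) -` S \<inter> space Q) w \<partial>Q)"
      unfolding S by (intro nn_integral_cong) (auto split: split_indicator)
    also have "\<dots> = emeasure ?R S"
      using VX A C unfolding S by (simp add: emeasure_distr emeasure_density measurable_sets)
    finally show "emeasure ?L S = emeasure ?R S" .
  next
    fix i :: nat
    have U: "UNIV \<in> sets ((borel :: 'a measure) \<Otimes>\<^sub>M (borel :: 'x measure))"
      using sets.top[of "(borel :: 'a measure) \<Otimes>\<^sub>M (borel :: 'x measure)"] by (simp add: space_pair_measure)
    have "emeasure ?L UNIV = emeasure (density Q (\<lambda>w. ennreal (of_bool (W w \<in> B)))) (space Q)"
      using VX U by (subst emeasure_distr) auto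
    also have "\<dots> = (\<integral>\<^sup>+w. ennreal (of_bool (W w \<in> B)) * indicator (space Q) w \<partial>Q)"
      by (rule emeasure_density) measurable
    also have "\<dots> = (\<integral>\<^sup>+w. ennreal (of_bool (W w \<in> B)) \<partial>Q)"
      by (intro nn_integral_cong) simp
    also have "\<dots> \<le> (\<integral>\<^sup>+w. 1 \<partial>Q)" by (intro nn_integral_mono) simp
    finally show "emeasure ?L UNIV \<noteq> \<infinity>" by (auto simp: Q.emeasure_space_1 top_unique)
  qed (auto simp: sets_pair_measure intro!: exI[of _ UNIV])
qed

text \<open>Conditional Jensen: \<open>m - \<mu>\<close> is the conditional mean of
  \<open>Y - \<mu>\<close>, so its square is at most the conditional second moment. The argument
  integrates over the set where the claim fails and shows that set to be null.\<close>

lemma cond_mean_bias_bound: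
  fixes Y :: "'q \<Rightarrow> real"
  assumes Q: "prob_space Q" and X[measurable]: "X \<in> borel_measurable Q"
    and cm: "is_cond_mean Q X Y m" and \<mu>[measurable]: "\<mu> \<in> borel_measurable borel"
    and sq: "integrable Q (\<lambda>w. (Y w)\<^sup>2)" and s: "s \<ge> 0"
    and le: "AE w in Q. nn_cond_exp Q (sigma_of Q X) (\<lambda>w. ennreal ((Y w - \<mu> (X w))\<^sup>2)) w \<le> ennreal s"
  shows "AE w in Q. (m (X w) - \<mu> (X w))\<^sup>2 \<le> s"
proof -
  interpret Q: prob_space Q by fact
  interpret finite_measure_subalgebra Q "sigma_of Q X"
    using finite_measure_subalgebra_sigma_of[OF Q X] .
  have Y[measurable]: "Y \<in> borel_measurable Q" and Yi: "integrable Q Y" and m[measurable]: "m \<in> borel_measurable borel"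
    and rce: "AE w in Q. real_cond_exp Q (sigma_of Q X) Y w = m (X w)"
    using cm by (auto simp: is_cond_mean_def)
  define g where "g x = m x - \<mu> x" for x
  have g[measurable]: "g \<in> borel_measurable borel" unfolding g_def by measurable
  let ?D = "\<lambda>w. Y w - \<mu> (X w)"
  have D2: "(\<integral>\<^sup>+w. f (X w) * ennreal ((?D w)\<^sup>2) \<partial>Q) \<le> ennreal s * (\<integral>\<^sup>+w. f (X w) \<partial>Q)"
    if "f \<in> borel_measurable borel" for f
    using that le by (intro nn_integral_le_of_cond_le[OF Q X]) auto
  have "(\<integral>\<^sup>+w. ennreal ((?D w)\<^sup>2) \<partial>Q) \<le> ennreal s"
    using D2[of "\<lambda>_. 1"] by (simp add: Q.emeasure_space_1)
  then have D2i: "integrable Q (\<lambda>w. (?D w)\<^sup>2)"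
    by (intro integrableI_bounded) (auto intro: order.strict_trans1)
  then have Di: "integrable Q ?D" by (intro Q.square_integrable_imp_integrable[OF _ D2i]) measurable
  have \<mu>i: "integrable Q (\<lambda>w. \<mu> (X w))"
    using Bochner_Integration.integrable_diff[OF Yi Di] by simp
  have rceD: "AE w in Q. real_cond_exp Q (sigma_of Q X) ?D w = g (X w)"
    using real_cond_exp_diff[OF Yi \<mu>i] real_cond_exp_F_meas[OF \<mu>i measurable_comp_sigma_of[OF \<mu>]] rce
    by eventually_elim (simp add: g_def)
  have null: "AE w in Q. \<not> (s < (g (X w))\<^sup>2 \<and> \<bar>g (X w)\<bar> \<le> real n)" for n
  proof -
    \<comment> \<open>Truncation at \<open>n\<close> keeps all integrals over the bad set finite.
      There \<open>g\<^sup>2\<close> exceeds \<open>s\<close> strictly, while its integral will turn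
      out to be at most \<open>s\<close> times the mass of the set.\<close>
    define A where "A = {x. s < (g x)\<^sup>2 \<and> \<bar>g x\<bar> \<le> real n}"
    have A[measurable]: "A \<in> sets borel" unfolding A_def by measurable
    let ?i = "\<lambda>w. indicator A (X w) :: real"
    have bg: "integrable Q (\<lambda>w. ?i w * (g (X w))\<^sup>2)"
      by (rule Q.integrable_const_bound[of _ "(real n)\<^sup>2"])
         (auto split: split_indicator simp: A_def abs_le_square_iff[of _ "real n", simplified])
    have hD: "integrable Q (\<lambda>w. (?i w * g (X w)) * ?D w)"
    proof (rule Bochner_Integration.integrable_bound[OF integrable_mult_right[OF Di, of "real n"]])
      show "AE w in Q. norm ((?i w * g (X w)) * ?D w) \<le> norm (real n * ?D w)"
        by (intro AE_I2) (auto split: split_indicator simp: A_def abs_mult intro!: mult_right_mono)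
    qed measurable
    have iD: "integrable Q (\<lambda>w. ?i w * (?D w)\<^sup>2)"
      by (rule Bochner_Integration.integrable_bound[OF D2i]) (auto split: split_indicator)
    have mA: "(\<lambda>w. ?i w * g (X w)) \<in> borel_measurable (sigma_of Q X)"
      by (rule measurable_comp_sigma_of) simp
    have "(\<integral>w. ?i w * (g (X w))\<^sup>2 \<partial>Q) = (\<integral>w. (?i w * g (X w)) * real_cond_exp Q (sigma_of Q X) ?D w \<partial>Q)"
      using rceD by (intro integral_cong_AE) (auto elim!: eventually_mono simp: power2_eq_square)
    also have "\<dots> = (\<integral>w. (?i w * g (X w)) * ?D w \<partial>Q)"
      by (rule real_cond_exp_intg(2)[OF hD mA]) measurable
    \<comment> \<open>The arithmetic-geometric mean inequality replaces Cauchy-Schwarz: the half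
      containing \<open>g\<^sup>2\<close> is absorbed into the left-hand side.\<close>
    also have "\<dots> \<le> (\<integral>w. (?i w * (g (X w))\<^sup>2 + ?i w * (?D w)\<^sup>2) / 2 \<partial>Q)"
    proof (rule integral_mono[OF hD])
      show "integrable Q (\<lambda>w. (?i w * (g (X w))\<^sup>2 + ?i w * (?D w)\<^sup>2) / 2)"
        using bg iD by simp
      fix w show "?i w * g (X w) * ?D w \<le> (?i w * (g (X w))\<^sup>2 + ?i w * (?D w)\<^sup>2) / 2"
        using sum_squares_bound[of "g (X w)" "?D w"] by (auto split: split_indicator)
    qed
    also have "\<dots> = ((\<integral>w. ?i w * (g (X w))\<^sup>2 \<partial>Q) + (\<integral>w. ?i w * (?D w)\<^sup>2 \<partial>Q)) / 2"
      using bg iD by simp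
    finally have le1: "(\<integral>w. ?i w * (g (X w))\<^sup>2 \<partial>Q) \<le> (\<integral>w. ?i w * (?D w)\<^sup>2 \<partial>Q)" by simp
    have ii: "integrable Q ?i" by (rule Q.integrable_const_bound[of _ 1]) (auto split: split_indicator)
    have "ennreal (\<integral>w. ?i w * (?D w)\<^sup>2 \<partial>Q) = (\<integral>\<^sup>+w. ennreal (?i w * (?D w)\<^sup>2) \<partial>Q)"
      by (rule nn_integral_eq_integral[OF iD, symmetric]) simp
    also have "\<dots> = (\<integral>\<^sup>+w. indicator A (X w) * ennreal ((?D w)\<^sup>2) \<partial>Q)"
      by (intro nn_integral_cong) (simp split: split_indicator)
    also have "\<dots> \<le> ennreal s * (\<integral>\<^sup>+w. indicator A (X w) \<partial>Q)"
      by (rule D2) measurable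
    also have "(\<integral>\<^sup>+w. indicator A (X w) \<partial>Q) = (\<integral>\<^sup>+w. ennreal (?i w) \<partial>Q)"
      by (intro nn_integral_cong) (simp split: split_indicator)
    also have "\<dots> = ennreal (\<integral>w. ?i w \<partial>Q)" by (rule nn_integral_eq_integral[OF ii]) simp
    also have "ennreal s * \<dots> = ennreal (s * (\<integral>w. ?i w \<partial>Q))" using s by (simp add: ennreal_mult)
    finally have "(\<integral>w. ?i w * (?D w)\<^sup>2 \<partial>Q) \<le> s * (\<integral>w. ?i w \<partial>Q)"
      using s by (subst (asm) ennreal_le_iff) (auto intro!: mult_nonneg_nonneg integral_nonneg_AE)
    with le1 have "(\<integral>w. ?i w * ((g (X w))\<^sup>2 - s) \<partial>Q) \<le> 0"
      using bg ii by (simp add: right_diff_distrib mult.commute)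
    moreover have nn: "AE w in Q. 0 \<le> ?i w * ((g (X w))\<^sup>2 - s)"
      by (intro AE_I2) (auto split: split_indicator simp: A_def)
    ultimately have "(\<integral>w. ?i w * ((g (X w))\<^sup>2 - s) \<partial>Q) = 0"
      using integral_nonneg_AE[OF nn] by simp
    moreover have "integrable Q (\<lambda>w. ?i w * ((g (X w))\<^sup>2 - s))"
      using bg ii by (simp add: right_diff_distrib)
    ultimately have "AE w in Q. ?i w * ((g (X w))\<^sup>2 - s) = 0"
      using integral_nonneg_eq_0_iff_AE[OF _ nn] by simp
    then show ?thesis by eventually_elim (auto simp: A_def split: split_indicator_asm)
  qed
  \<comment> \<open>Every real is below some \<open>n\<close>, so countably many truncated bad sets
    exhaust the whole bad set.\<close>
  have "AE w in Q. \<forall>n. \<not> (s < (g (X w))\<^sup>2 \<and> \<bar>g (X w)\<bar> \<le> real n)"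
    unfolding AE_all_countable using null by blast
  then show ?thesis
  proof eventually_elim
    case (elim w)
    obtain n :: nat where "\<bar>g (X w)\<bar> \<le> real n" using real_arch_simple by blast
    with elim show ?case by (auto simp: g_def not_less)
  qed
qed

text \<open>One interface for both arms: arm 0 is the case of indicator \<open>1 - R\<close> and
  propensity \<open>1 - \<pi>\<close>. Unconfoundedness enters as equality of the laws of
  \<open>(Y, X)\<close> weighted by \<open>T\<close> and by \<open>p (X w)\<close>;
  \<open>var\<close> is the conditional variance bound, tested against all nonnegative functions of
  \<open>X\<close>.\<close>

locale treatment_arm =
  fixes Q :: "'q measure" and X :: "'q \<Rightarrow> 'x::second_countable_topology" and Y T :: "'q \<Rightarrow> real"
    and p m :: "'x \<Rightarrow> real" and s :: real
  assumes prob: "prob_space Q" and X[measurable]: "X \<in> borel_measurable Q"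
    and Y[measurable]: "Y \<in> borel_measurable Q" and T[measurable]: "T \<in> borel_measurable Q"
    and T01: "\<And>w. w \<in> space Q \<Longrightarrow> T w \<in> {0, 1}"
    and p[measurable]: "p \<in> borel_measurable borel"
    and p01: "AE w in Q. 0 \<le> p (X w) \<and> p (X w) \<le> 1"
    and law: "distr (density Q (\<lambda>w. ennreal (T w))) (borel \<Otimes>\<^sub>M borel) (\<lambda>w. (Y w, X w)) =
      distr (density Q (\<lambda>w. ennreal (p (X w)))) (borel \<Otimes>\<^sub>M borel) (\<lambda>w. (Y w, X w))"
    and cm: "is_cond_mean Q X Y m"
    and s: "s \<ge> 0"
    and var: "\<And>f. f \<in> borel_measurable borel \<Longrightarrow>
      (\<integral>\<^sup>+w. f (X w) * ennreal ((Y w - m (X w))\<^sup>2) \<partial>Q) \<le> ennreal s * (\<integral>\<^sup>+w. f (X w) \<partial>Q)"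
begin

sublocale prob_space Q by (rule prob)

lemma m[measurable]: "m \<in> borel_measurable borel"
  using cm by (simp add: is_cond_mean_def)

text \<open>Under an integral the treatment indicator may be exchanged for the propensity, whatever
  function of outcome and covariates it multiplies. Unconfoundedness is used only in this form from
  here on.\<close>

lemma nn_transfer:
  assumes g: "g \<in> borel_measurable (borel \<Otimes>\<^sub>M borel)"
  shows "(\<integral>\<^sup>+w. ennreal (T w) * g (Y w, X w) \<partial>Q) = (\<integral>\<^sup>+w. ennreal (p (X w)) * g (Y w, X w) \<partial>Q)"
proof -
  have YX: "(\<lambda>w. (Y w, X w)) \<in> measurable Q (borel \<Otimes>\<^sub>M borel)" by measurable
  have *: "(\<integral>\<^sup>+z. g z \<partial>distr (density Q (\<lambda>w. ennreal (wt w))) (borel \<Otimes>\<^sub>M borel) (\<lambda>w. (Y w, X w))) =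
      (\<integral>\<^sup>+w. ennreal (wt w) * g (Y w, X w) \<partial>Q)" if wt: "wt \<in> borel_measurable Q" for wt
    using YX g wt by (subst nn_integral_distr) (auto intro!: nn_integral_density measurable_compose[OF YX g])
  show ?thesis using *[of T] *[of "\<lambda>w. p (X w)"] law by simp
qed

lemma nn_transfer_X:
  assumes f: "f \<in> borel_measurable borel"
  shows "(\<integral>\<^sup>+w. ennreal (T w) * f (X w) \<partial>Q) = (\<integral>\<^sup>+w. ennreal (p (X w)) * f (X w) \<partial>Q)"
  using nn_transfer[OF measurable_compose[OF measurable_snd f]] by simp

lemma integral_transfer:
  fixes g :: "real \<times> 'x \<Rightarrow> real"
  assumes g: "g \<in> borel_measurable (borel \<Otimes>\<^sub>M borel)"
  shows "(\<integral>w. T w * g (Y w, X w) \<partial>Q) = (\<integral>w. p (X w) * g (Y w, X w) \<partial>Q)"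
    and "integrable Q (\<lambda>w. T w * g (Y w, X w)) \<longleftrightarrow> integrable Q (\<lambda>w. p (X w) * g (Y w, X w))"
proof -
  have YX: "(\<lambda>w. (Y w, X w)) \<in> measurable Q (borel \<Otimes>\<^sub>M borel)" by measurable
  have T0: "AE w in Q. 0 \<le> T w" using T01 by (intro AE_I2) fastforce
  have p0: "AE w in Q. 0 \<le> p (X w)" using p01 by eventually_elim simp
  have *: "(\<integral>z. g z \<partial>distr (density Q (\<lambda>w. ennreal (wt w))) (borel \<Otimes>\<^sub>M borel) (\<lambda>w. (Y w, X w))) =
      (\<integral>w. wt w * g (Y w, X w) \<partial>Q)"
    "integrable (distr (density Q (\<lambda>w. ennreal (wt w))) (borel \<Otimes>\<^sub>M borel) (\<lambda>w. (Y w, X w))) g \<longleftrightarrow>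
      integrable Q (\<lambda>w. wt w * g (Y w, X w))"
    if wt: "wt \<in> borel_measurable Q" "AE w in Q. 0 \<le> wt w" for wt
  proof -
    have gm: "(\<lambda>w. g (Y w, X w)) \<in> borel_measurable Q" by (rule measurable_compose[OF YX g])
    have YX': "(\<lambda>w. (Y w, X w)) \<in> measurable (density Q (\<lambda>w. ennreal (wt w))) (borel \<Otimes>\<^sub>M borel)"
      using YX by simp
    show "(\<integral>z. g z \<partial>distr (density Q (\<lambda>w. ennreal (wt w))) (borel \<Otimes>\<^sub>M borel) (\<lambda>w. (Y w, X w))) =
      (\<integral>w. wt w * g (Y w, X w) \<partial>Q)"
      unfolding integral_distr[OF YX' g] integral_density[OF gm wt] by simp
    show "integrable (distr (density Q (\<lambda>w. ennreal (wt w))) (borel \<Otimes>\<^sub>M borel) (\<lambda>w. (Y w, X w))) g \<longleftrightarrow>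
      integrable Q (\<lambda>w. wt w * g (Y w, X w))"
      unfolding integrable_distr_eq[OF YX' g] integrable_density[OF gm wt] by simp
  qed
  show "(\<integral>w. T w * g (Y w, X w) \<partial>Q) = (\<integral>w. p (X w) * g (Y w, X w) \<partial>Q)"
    using *(1)[OF T T0] *(1)[OF _ p0] law by simp
  show "integrable Q (\<lambda>w. T w * g (Y w, X w)) \<longleftrightarrow> integrable Q (\<lambda>w. p (X w) * g (Y w, X w))"
    using *(2)[OF T T0] *(2)[OF _ p0] law by simp
qed

text \<open>The residual is orthogonal to functions of \<open>X\<close>. Integrability is asked of
  the product only, since the weights \<open>h\<close> below need not be bounded.\<close>

lemma integral_residual:
  assumes h[measurable]: "h \<in> borel_measurable borel"
    and i: "integrable Q (\<lambda>w. h (X w) * (Y w - m (X w)))"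
  shows "(\<integral>w. h (X w) * (Y w - m (X w)) \<partial>Q) = 0"
proof -
  interpret S: finite_measure_subalgebra Q "sigma_of Q X"
    using finite_measure_subalgebra_sigma_of[OF prob X] .
  have Yi: "integrable Q Y" and rce: "AE w in Q. real_cond_exp Q (sigma_of Q X) Y w = m (X w)"
    using cm by (auto simp: is_cond_mean_def)
  have "integrable Q (\<lambda>w. real_cond_exp Q (sigma_of Q X) Y w)" by (rule S.real_cond_exp_int(1)[OF Yi])
  then have mi: "integrable Q (\<lambda>w. m (X w))"
    by (rule integrable_cong_AE_imp[OF _ _ rce]) measurable
  have r0: "AE w in Q. real_cond_exp Q (sigma_of Q X) (\<lambda>w. Y w - m (X w)) w = 0"
    using S.real_cond_exp_diff[OF Yi mi] S.real_cond_exp_F_meas[OF mi measurable_comp_sigma_of[OF m]] rce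
    by eventually_elim simp
  have "(\<integral>w. h (X w) * (Y w - m (X w)) \<partial>Q) =
      (\<integral>w. h (X w) * real_cond_exp Q (sigma_of Q X) (\<lambda>w. Y w - m (X w)) w \<partial>Q)"
    by (rule S.real_cond_exp_intg(2)[OF i measurable_comp_sigma_of[OF h], symmetric]) measurable
  also have "\<dots> = (\<integral>w. 0 \<partial>Q)"
    using r0 by (intro integral_cong_AE) (auto elim!: eventually_mono)
  finally show ?thesis by simp
qed

text \<open>As \<open>T\<close> is its own square, a single factor \<open>p\<close> survives against
  \<open>h\<^sup>2\<close>. For inverse propensity weights this leaves one uncompensated factor, the
  origin of the order 1/pbar.\<close>

lemma treated_residual_second_moment:
  assumes h[measurable]: "h \<in> borel_measurable borel"
  shows "(\<integral>\<^sup>+w. ennreal ((T w * h (X w) * (Y w - m (X w)))\<^sup>2) \<partial>Q) \<le>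
    ennreal s * (\<integral>\<^sup>+w. ennreal (p (X w) * (h (X w))\<^sup>2) \<partial>Q)"
proof -
  have "(\<integral>\<^sup>+w. ennreal ((T w * h (X w) * (Y w - m (X w)))\<^sup>2) \<partial>Q) =
      (\<integral>\<^sup>+w. ennreal (T w) * ennreal ((h (X w) * (Y w - m (X w)))\<^sup>2) \<partial>Q)"
  proof (intro nn_integral_cong)
    fix w assume "w \<in> space Q"
    from T01[OF this] show "ennreal ((T w * h (X w) * (Y w - m (X w)))\<^sup>2) =
        ennreal (T w) * ennreal ((h (X w) * (Y w - m (X w)))\<^sup>2)" by auto
  qed
  also have "\<dots> = (\<integral>\<^sup>+w. ennreal (p (X w)) * ennreal ((h (X w) * (Y w - m (X w)))\<^sup>2) \<partial>Q)"
    using nn_transfer[of "\<lambda>(y, x). ennreal ((h x * (y - m x))\<^sup>2)"] by simp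
  also have "\<dots> = (\<integral>\<^sup>+w. ennreal (p (X w) * (h (X w))\<^sup>2) * ennreal ((Y w - m (X w))\<^sup>2) \<partial>Q)"
    using p01 by (intro nn_integral_cong_AE) (auto elim!: eventually_mono simp: power_mult_distrib mult.assoc simp flip: ennreal_mult)
  also have "\<dots> \<le> ennreal s * (\<integral>\<^sup>+w. ennreal (p (X w) * (h (X w))\<^sup>2) \<partial>Q)"
    by (rule var[of "\<lambda>x. ennreal (p x * (h x)\<^sup>2)"]) measurable
  finally show ?thesis .
qed

text \<open>Finiteness of the weighted second moment gives square integrability, hence
  integrability; after exchanging \<open>T\<close> for \<open>p\<close> the residual is centred by
  orthogonality.\<close>

lemma treated_residual_mean:
  assumes h[measurable]: "h \<in> borel_measurable borel"
    and fin: "(\<integral>\<^sup>+w. ennreal (p (X w) * (h (X w))\<^sup>2) \<partial>Q) < \<infinity>"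
  shows "(\<integral>w. T w * h (X w) * (Y w - m (X w)) \<partial>Q) = 0"
proof -
  let ?r = "\<lambda>w. Y w - m (X w)"
  let ?g = "\<lambda>(y, x). h x * (y - m x)"
  have g: "?g \<in> borel_measurable (borel \<Otimes>\<^sub>M borel)" by measurable
  have "(\<integral>\<^sup>+w. ennreal ((T w * h (X w) * ?r w)\<^sup>2) \<partial>Q) < \<infinity>"
    using treated_residual_second_moment[OF h] fin ennreal_mult_less_top[of "ennreal s"]
    by (auto intro: order.strict_trans1)
  then have sq: "integrable Q (\<lambda>w. (T w * h (X w) * ?r w)\<^sup>2)"
    by (intro integrableI_bounded) auto
  have "integrable Q (\<lambda>w. T w * h (X w) * ?r w)"
    by (rule square_integrable_imp_integrable[OF _ sq]) measurable
  then have i: "integrable Q (\<lambda>w. p (X w) * (h (X w) * ?r w))"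
    using integral_transfer(2)[OF g] by (simp add: mult.assoc)
  have "(\<integral>w. T w * (h (X w) * ?r w) \<partial>Q) = (\<integral>w. p (X w) * (h (X w) * ?r w) \<partial>Q)"
    using integral_transfer(1)[OF g] by simp
  also have "\<dots> = 0"
    using integral_residual[of "\<lambda>x. p x * h x"] i by (simp add: mult.assoc)
  finally show ?thesis by (simp add: mult.assoc)
qed

text \<open>Pointwise, \<open>f\<^sup>2 / p\<close> dominates if \<open>T = 0\<close> and
  \<open>(f / p)\<^sup>2\<close> if \<open>T = 1\<close>. Once \<open>T\<close> is exchanged for
  \<open>p\<close>, both parts have the same integral, hence the factor 2 in place of the exact
  conditional weight (1 - p)/p.\<close>

lemma weight_error_second_moment:
  assumes f[measurable]: "f \<in> borel_measurable borel" and pos: "AE w in Q. p (X w) > 0"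
  shows "(\<integral>\<^sup>+w. ennreal (((1 - T w / p (X w)) * f (X w))\<^sup>2) \<partial>Q) \<le>
    2 * (\<integral>\<^sup>+w. ennreal ((f (X w))\<^sup>2 / p (X w)) \<partial>Q)"
proof -
  have "(\<integral>\<^sup>+w. ennreal (((1 - T w / p (X w)) * f (X w))\<^sup>2) \<partial>Q) \<le>
      (\<integral>\<^sup>+w. ennreal ((f (X w))\<^sup>2 / p (X w)) + ennreal (T w) * ennreal ((f (X w) / p (X w))\<^sup>2) \<partial>Q)"
  proof (intro nn_integral_mono_AE)
    show "AE w in Q. ennreal (((1 - T w / p (X w)) * f (X w))\<^sup>2) \<le>
        ennreal ((f (X w))\<^sup>2 / p (X w)) + ennreal (T w) * ennreal ((f (X w) / p (X w))\<^sup>2)"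
      using pos p01 AE_space[of Q]
    proof eventually_elim
      case (elim w)
      let ?q = "p (X w)" and ?f = "f (X w)"
      have "((1 - T w / ?q) * ?f)\<^sup>2 \<le> ?f\<^sup>2 / ?q + T w * (?f / ?q)\<^sup>2"
      proof -
        consider "T w = 0" | "T w = 1" using T01 elim by blast
        then show ?thesis
        proof cases
          case 1
          have "?f\<^sup>2 * ?q \<le> ?f\<^sup>2 * 1" using elim by (intro mult_left_mono) auto
          with 1 elim show ?thesis by (simp add: pos_le_divide_eq)
        next
          case 2
          have "(1 - 1 / ?q)\<^sup>2 \<le> (1 / ?q)\<^sup>2"
            using elim by (subst abs_le_square_iff[symmetric]) (auto simp: abs_if field_simps)
          then have "(1 - 1 / ?q)\<^sup>2 * ?f\<^sup>2 \<le> (1 / ?q)\<^sup>2 * ?f\<^sup>2" by (rule mult_right_mono) simp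
          moreover have "0 \<le> ?f\<^sup>2 / ?q" using elim by simp
          ultimately show ?thesis using 2 by (simp add: power_mult_distrib power_divide)
        qed
      qed
      then have "ennreal (((1 - T w / ?q) * ?f)\<^sup>2) \<le> ennreal (?f\<^sup>2 / ?q + T w * (?f / ?q)\<^sup>2)" by (rule ennreal_leI)
      also have "\<dots> = ennreal (?f\<^sup>2 / ?q) + ennreal (T w) * ennreal ((?f / ?q)\<^sup>2)"
        using elim T01[of w] by (subst ennreal_plus) (auto simp: ennreal_mult)
      finally show ?case .
    qed
  qed
  also have "\<dots> = (\<integral>\<^sup>+w. ennreal ((f (X w))\<^sup>2 / p (X w)) \<partial>Q) + (\<integral>\<^sup>+w. ennreal (T w) * ennreal ((f (X w) / p (X w))\<^sup>2) \<partial>Q)"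
    by (rule nn_integral_add) measurable
  also have "(\<integral>\<^sup>+w. ennreal (T w) * ennreal ((f (X w) / p (X w))\<^sup>2) \<partial>Q) =
      (\<integral>\<^sup>+w. ennreal (p (X w)) * ennreal ((f (X w) / p (X w))\<^sup>2) \<partial>Q)"
    using nn_transfer_X[of "\<lambda>x. ennreal ((f x / p x)\<^sup>2)"] by simp
  also have "\<dots> = (\<integral>\<^sup>+w. ennreal ((f (X w))\<^sup>2 / p (X w)) \<partial>Q)"
    using pos by (intro nn_integral_cong_AE) (auto elim!: eventually_mono simp: power2_eq_square simp flip: ennreal_mult)
  finally show ?thesis by (simp add: mult_2)
qed

text \<open>\<open>T / p\<close> has conditional mean 1. As \<open>p \<le> 1\<close>, the finite
  integral of \<open>f\<^sup>2 / p\<close> bounds that of \<open>f\<^sup>2\<close> and so provides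
  integrability.\<close>

lemma weight_error_mean:
  assumes f[measurable]: "f \<in> borel_measurable borel" and pos: "AE w in Q. p (X w) > 0"
    and fin: "(\<integral>\<^sup>+w. ennreal ((f (X w))\<^sup>2 / p (X w)) \<partial>Q) < \<infinity>"
  shows "(\<integral>w. (1 - T w / p (X w)) * f (X w) \<partial>Q) = 0"
proof -
  have "(\<integral>\<^sup>+w. ennreal ((f (X w))\<^sup>2) \<partial>Q) \<le> (\<integral>\<^sup>+w. ennreal ((f (X w))\<^sup>2 / p (X w)) \<partial>Q)"
  proof (intro nn_integral_mono_AE)
    show "AE w in Q. ennreal ((f (X w))\<^sup>2) \<le> ennreal ((f (X w))\<^sup>2 / p (X w))"
      using pos p01
    proof eventually_elim
      case (elim w)
      have "(f (X w))\<^sup>2 * p (X w) \<le> (f (X w))\<^sup>2 * 1" using elim by (intro mult_left_mono) auto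
      then show ?case using elim by (intro ennreal_leI) (simp add: pos_le_divide_eq)
    qed
  qed
  then have "integrable Q (\<lambda>w. (f (X w))\<^sup>2)"
    using fin by (intro integrableI_bounded) (auto intro: order.strict_trans1)
  then have fi: "integrable Q (\<lambda>w. f (X w))"
    by (rule square_integrable_imp_integrable[rotated]) measurable
  have eq: "AE w in Q. p (X w) * (f (X w) / p (X w)) = f (X w)"
    using pos by eventually_elim simp
  have g: "(\<lambda>(y, x). f x / p x) \<in> borel_measurable ((borel :: real measure) \<Otimes>\<^sub>M borel)" by measurable
  have "integrable Q (\<lambda>w. p (X w) * (f (X w) / p (X w)))"
    using fi by (rule integrable_cong_AE_imp) (use eq in \<open>auto elim!: eventually_mono\<close>)
  then have Ti: "integrable Q (\<lambda>w. T w * (f (X w) / p (X w)))"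
    using integral_transfer(2)[OF g] by simp
  have "(\<integral>w. T w * (f (X w) / p (X w)) \<partial>Q) = (\<integral>w. p (X w) * (f (X w) / p (X w)) \<partial>Q)"
    using integral_transfer(1)[OF g] by simp
  also have "\<dots> = (\<integral>w. f (X w) \<partial>Q)"
    using eq by (intro integral_cong_AE) auto
  finally show ?thesis
    using Bochner_Integration.integral_diff[OF fi Ti] by (simp add: algebra_simps)
qed

end

section \<open>Moments within a treatment arm\<close>

text \<open>Unconfoundedness concerns the pair of potential outcomes; pushing the weighted laws
  forward under a projection \<open>h\<close> isolates one arm.\<close>

lemma weighted_law_image:
  assumes eq: "distr (density Q u) (borel \<Otimes>\<^sub>M borel) (\<lambda>w. (V w, X w)) =
      distr (density Q v) (borel \<Otimes>\<^sub>M borel) (\<lambda>w. (V w, X w))"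
    and m[measurable]: "V \<in> borel_measurable Q" "X \<in> borel_measurable Q" and h[measurable]: "h \<in> borel_measurable borel"
  shows "distr (density Q u) (borel \<Otimes>\<^sub>M borel) (\<lambda>w. (h (V w), X w)) =
      distr (density Q v) (borel \<Otimes>\<^sub>M borel) (\<lambda>w. (h (V w), X w))"
proof -
  have *: "distr (density Q u') (borel \<Otimes>\<^sub>M borel) (\<lambda>w. (h (V w), X w)) =
      distr (distr (density Q u') (borel \<Otimes>\<^sub>M borel) (\<lambda>w. (V w, X w))) (borel \<Otimes>\<^sub>M borel) (\<lambda>z. (h (fst z), snd z))" for u'
  proof (subst distr_distr)
    show "(\<lambda>z. (h (fst z), snd z)) \<in> borel \<Otimes>\<^sub>M borel \<rightarrow>\<^sub>M borel \<Otimes>\<^sub>M borel" by measurable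
    show "(\<lambda>w. (V w, X w)) \<in> density Q u' \<rightarrow>\<^sub>M borel \<Otimes>\<^sub>M borel" by (simp add: measurable_density_eq1) measurable
  qed (simp add: comp_def)
  show ?thesis unfolding * eq ..
qed

lemma is_cond_mean_compl:
  assumes Q: "prob_space Q" and X: "X \<in> borel_measurable Q"
    and p: "is_cond_mean Q X (\<lambda>w. of_bool (P w)) p"
  shows "is_cond_mean Q X (\<lambda>w. of_bool (\<not> P w)) (\<lambda>x. 1 - p x)"
proof -
  interpret Q: prob_space Q by fact
  interpret finite_measure_subalgebra Q "sigma_of Q X"
    using finite_measure_subalgebra_sigma_of[OF Q X] .
  have i: "integrable Q (\<lambda>w. of_bool (P w) :: real)" and pm: "p \<in> borel_measurable borel"
    and e: "AE w in Q. real_cond_exp Q (sigma_of Q X) (\<lambda>w. of_bool (P w)) w = p (X w)"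
    using p by (auto simp: is_cond_mean_def)
  have eq: "(\<lambda>w. of_bool (\<not> P w) :: real) = (\<lambda>w. 1 - of_bool (P w))" by auto
  have "integrable Q (\<lambda>_. 1 :: real)" by simp
  from real_cond_exp_diff[OF this i] real_cond_exp_F_meas[OF this borel_measurable_const] e
  have "AE w in Q. real_cond_exp Q (sigma_of Q X) (\<lambda>w. 1 - of_bool (P w)) w = 1 - p (X w)"
    by eventually_elim simp
  then show ?thesis using i pm unfolding is_cond_mean_def eq by simp
qed

text \<open>The assumption bounds moments about \<open>\<mu>\<close>, the interface needs them about
  \<open>m\<close>. By \<open>(Y - m)\<^sup>2 \<le> 2 * (Y - \<mu>)\<^sup>2 + 2 * (m -
  \<mu>)\<^sup>2\<close> and the bias bound, each half contributes \<open>2 * s\<close>, whence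
  \<open>4 * s\<close>.\<close>

lemma treatment_armI:
  fixes V :: "'q \<Rightarrow> 'a::second_countable_topology" and X :: "'q \<Rightarrow> 'x::second_countable_topology"
  assumes Q: "prob_space Q" and X[measurable]: "X \<in> borel_measurable Q"
    and V[measurable]: "V \<in> borel_measurable Q" and W[measurable]: "W \<in> borel_measurable Q"
    and ci: "cond_indep Q V W X" and B[measurable]: "B \<in> sets borel"
    and p: "is_cond_mean Q X (\<lambda>w. of_bool (W w \<in> B)) p"
    and h[measurable]: "h \<in> borel_measurable borel" and Y: "Y = (\<lambda>w. h (V w))"
    and T: "\<And>w. w \<in> space Q \<Longrightarrow> T w = of_bool (W w \<in> B)" and Tm: "T \<in> borel_measurable Q"
    and cm: "is_cond_mean Q X Y m" and \<mu>[measurable]: "\<mu> \<in> borel_measurable borel"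
    and sq: "integrable Q (\<lambda>w. (Y w)\<^sup>2)" and s: "s \<ge> 0"
    and le: "AE w in Q. nn_cond_exp Q (sigma_of Q X) (\<lambda>w. ennreal ((Y w - \<mu> (X w))\<^sup>2)) w \<le> ennreal s"
  shows "treatment_arm Q X Y T p m (4 * s)"
proof -
  have pm: "p \<in> borel_measurable borel" and m[measurable]: "m \<in> borel_measurable borel"
    using p cm by (auto simp: is_cond_mean_def)
  have Ym[measurable]: "Y \<in> borel_measurable Q" using h V unfolding Y by measurable
  have bias: "AE w in Q. (m (X w) - \<mu> (X w))\<^sup>2 \<le> s"
    by (rule cond_mean_bias_bound[OF Q X cm \<mu> sq s le])
  have dens: "density Q (\<lambda>w. ennreal (T w)) = density Q (\<lambda>w. ennreal (of_bool (W w \<in> B)))"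
    using T Tm by (intro density_cong) auto
  show ?thesis
  proof (rule treatment_arm.intro)
    show "distr (density Q (\<lambda>w. ennreal (T w))) (borel \<Otimes>\<^sub>M borel) (\<lambda>w. (Y w, X w)) =
      distr (density Q (\<lambda>w. ennreal (p (X w)))) (borel \<Otimes>\<^sub>M borel) (\<lambda>w. (Y w, X w))"
      unfolding dens Y
      by (rule weighted_law_image[OF cond_indep_weighted_law[OF Q X V W ci B p] V X h])
  next
    fix f :: "'x \<Rightarrow> ennreal" assume f[measurable]: "f \<in> borel_measurable borel"
    have "(\<integral>\<^sup>+w. f (X w) * ennreal ((Y w - m (X w))\<^sup>2) \<partial>Q) \<le>
        (\<integral>\<^sup>+w. ennreal 2 * (f (X w) * ennreal ((Y w - \<mu> (X w))\<^sup>2)) + ennreal (2 * s) * f (X w) \<partial>Q)"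
    proof (intro nn_integral_mono_AE)
      show "AE w in Q. f (X w) * ennreal ((Y w - m (X w))\<^sup>2) \<le>
        ennreal 2 * (f (X w) * ennreal ((Y w - \<mu> (X w))\<^sup>2)) + ennreal (2 * s) * f (X w)"
        using bias
      proof eventually_elim
        case (elim w)
        have "(Y w - m (X w))\<^sup>2 \<le> 2 * (Y w - \<mu> (X w))\<^sup>2 + 2 * (m (X w) - \<mu> (X w))\<^sup>2"
          using sum_squares_bound[of "Y w - \<mu> (X w)" "- (m (X w) - \<mu> (X w))"]
          by (simp add: power2_eq_square algebra_simps)
        also have "\<dots> \<le> 2 * (Y w - \<mu> (X w))\<^sup>2 + 2 * s" using elim by simp
        finally have "ennreal ((Y w - m (X w))\<^sup>2) \<le> ennreal (2 * (Y w - \<mu> (X w))\<^sup>2 + 2 * s)" by (rule ennreal_leI)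
        also have "\<dots> = ennreal 2 * ennreal ((Y w - \<mu> (X w))\<^sup>2) + ennreal (2 * s)"
          using s by (subst ennreal_plus) (auto simp: ennreal_mult)
        finally have "f (X w) * ennreal ((Y w - m (X w))\<^sup>2) \<le>
            f (X w) * (ennreal 2 * ennreal ((Y w - \<mu> (X w))\<^sup>2) + ennreal (2 * s))" by (rule mult_left_mono) simp
        then show ?case by (simp add: distrib_left mult.commute mult.left_commute)
      qed
    qed
    also have "\<dots> = ennreal 2 * (\<integral>\<^sup>+w. f (X w) * ennreal ((Y w - \<mu> (X w))\<^sup>2) \<partial>Q) + ennreal (2 * s) * (\<integral>\<^sup>+w. f (X w) \<partial>Q)"
      by (simp add: nn_integral_add nn_integral_cmult)
    also have "\<dots> \<le> ennreal 2 * (ennreal s * (\<integral>\<^sup>+w. f (X w) \<partial>Q)) + ennreal (2 * s) * (\<integral>\<^sup>+w. f (X w) \<partial>Q)"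
      using nn_integral_le_of_cond_le[OF Q X f _ le] by (intro add_mono mult_left_mono) auto
    also have "\<dots> = ennreal (4 * s) * (\<integral>\<^sup>+w. f (X w) \<partial>Q)"
    proof -
      have "ennreal (4 * s) = ennreal 2 * ennreal s + ennreal (2 * s)"
        using s ennreal_mult[of 2 s] ennreal_plus[of "2 * s" "2 * s"] by simp
      then show ?thesis by (simp add: distrib_right mult.assoc)
    qed
    finally show "(\<integral>\<^sup>+w. f (X w) * ennreal ((Y w - m (X w))\<^sup>2) \<partial>Q) \<le> ennreal (4 * s) * (\<integral>\<^sup>+w. f (X w) \<partial>Q)" .
  next
    fix w assume "w \<in> space Q"
    then show "T w \<in> {0, 1}" using T by simp
  next
    show "0 \<le> 4 * s" using s by simp
    show "AE w in Q. 0 \<le> p (X w) \<and> p (X w) \<le> 1" by (rule is_cond_mean_prob_bounds[OF Q X p])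
  qed (fact Q X Ym Tm pm cm)+
qed

lemma measurable_obs [measurable]:
  "(obsR :: 'p::finite obs \<Rightarrow> real) \<in> borel_measurable borel"
  "(obsY :: 'p::finite obs \<Rightarrow> real) \<in> borel_measurable borel"
  "(obsX :: 'p::finite obs \<Rightarrow> real^'p) \<in> borel_measurable borel"
  by (intro borel_measurable_continuous_onI continuous_intros)+

lemma measurable_statistic_fixed:
  "f \<in> borel_measurable borel \<Longrightarrow> measurable_statistic N (\<lambda>T x z. f z)"
  unfolding measurable_statistic_def by (auto simp: split_beta' intro: measurable_compose[OF measurable_snd])

lemma measurable_statistic_estimator:
  assumes "measurable_estimator N est"
  shows "measurable_statistic N (\<lambda>T x z. est T x (obsX z))"
  unfolding measurable_statistic_def
proof (intro allI impI)
  fix T assume "T \<subseteq> {1..N}"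
  then have m: "(\<lambda>(z, x). est T z x) \<in> borel_measurable (Pi\<^sub>M T (\<lambda>_. borel) \<Otimes>\<^sub>M borel)"
    by (rule assms[unfolded measurable_estimator_def, rule_format])
  have "(\<lambda>w. (fst w, obsX (snd w))) \<in> Pi\<^sub>M T (\<lambda>_. borel :: 'a obs measure) \<Otimes>\<^sub>M borel \<rightarrow>\<^sub>M Pi\<^sub>M T (\<lambda>_. borel) \<Otimes>\<^sub>M borel"
    by (intro measurable_Pair measurable_compose[OF measurable_snd measurable_obs(3)]) simp
  from measurable_compose[OF this m]
  show "(\<lambda>(x, z). est T x (obsX z)) \<in> borel_measurable (Pi\<^sub>M T (\<lambda>_. borel) \<Otimes>\<^sub>M borel)"
    by (simp add: split_beta')
qed

lemma measurable_statistic_arith: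
  assumes "measurable_statistic N F" "measurable_statistic N G"
  shows "measurable_statistic N (\<lambda>T x z. F T x z - G T x z)"
    "measurable_statistic N (\<lambda>T x z. F T x z * G T x z)"
    "measurable_statistic N (\<lambda>T x z. F T x z / G T x z)"
proof -
  have m: "(\<lambda>w. F T (fst w) (snd w)) \<in> borel_measurable (Pi\<^sub>M T (\<lambda>_. borel) \<Otimes>\<^sub>M borel)"
    "(\<lambda>w. G T (fst w) (snd w)) \<in> borel_measurable (Pi\<^sub>M T (\<lambda>_. borel) \<Otimes>\<^sub>M borel)" if "T \<subseteq> {1..N}" for T
    using assms(1)[unfolded measurable_statistic_def, rule_format, OF that]
      assms(2)[unfolded measurable_statistic_def, rule_format, OF that] by (simp_all add: split_beta')
  show "measurable_statistic N (\<lambda>T x z. F T x z - G T x z)"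
    unfolding measurable_statistic_def split_beta' by (intro allI impI borel_measurable_diff m)
  show "measurable_statistic N (\<lambda>T x z. F T x z * G T x z)"
    unfolding measurable_statistic_def split_beta' by (intro allI impI borel_measurable_times m)
  show "measurable_statistic N (\<lambda>T x z. F T x z / G T x z)"
    unfolding measurable_statistic_def split_beta' by (intro allI impI borel_measurable_divide m)
qed

lemma measurable_statistic_section:
  assumes "measurable_statistic N F" "T \<subseteq> {1..N}" "x \<in> space (Pi\<^sub>M T (\<lambda>_. borel))"
  shows "F T x \<in> borel_measurable borel"
proof -
  have "(\<lambda>(x, z). F T x z) \<in> borel_measurable (Pi\<^sub>M T (\<lambda>_. borel) \<Otimes>\<^sub>M borel)"
    by (rule assms(1)[unfolded measurable_statistic_def, rule_format, OF assms(2)])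
  from measurable_compose[OF measurable_Pair1'[OF assms(3)] this] show ?thesis by simp
qed

lemma measurable_fold_stat:
  assumes "measurable_statistic N F"
  shows "fold_stat F N J z \<in> borel_measurable borel"
  unfolding fold_stat_def by (rule measurable_statistic_section[OF assms Diff_subset]) (simp add: space_PiM)

lemma measurable_fold_fit:
  assumes "measurable_estimator N est"
  shows "fold_fit est N J z \<in> borel_measurable borel"
proof -
  have m: "(\<lambda>(z, x). est ({1..N} - J) z x) \<in> borel_measurable (Pi\<^sub>M ({1..N} - J) (\<lambda>_. borel) \<Otimes>\<^sub>M borel)"
    by (rule assms[unfolded measurable_estimator_def, rule_format, OF Diff_subset])
  have "restrict z ({1..N} - J) \<in> space (Pi\<^sub>M ({1..N} - J) (\<lambda>_. borel))" by (simp add: space_PiM)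
  from measurable_compose[OF measurable_Pair1'[OF this] m] show ?thesis
    unfolding fold_fit_def by simp
qed

lemma abs_enn2ereal_le_iff:
  assumes "t \<ge> 0"
  shows "\<bar>enn2ereal x\<bar> \<le> ereal t \<longleftrightarrow> x \<le> ennreal t" "enn2ereal x \<le> ereal t \<longleftrightarrow> x \<le> ennreal t"
  using assms by (simp_all add: less_eq_ennreal.rep_eq enn2ereal_ennreal)

text \<open>Cauchy-Schwarz in a form fitted to rates: the weights \<open>b / (2 * a)\<close> and
  \<open>a / (2 * b)\<close> balance the two squares so that each contributes half of
  \<open>K * (a * b)\<close>.\<close>

lemma nn_integral_product_le:
  fixes u v :: "'a \<Rightarrow> real"
  assumes m[measurable]: "u \<in> borel_measurable Q" "v \<in> borel_measurable Q"
    and K: "K \<ge> 0" and ab: "a > 0" "b > 0"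
    and u: "(\<integral>\<^sup>+w. ennreal ((u w)\<^sup>2) \<partial>Q) \<le> ennreal (K * a\<^sup>2)"
    and v: "(\<integral>\<^sup>+w. ennreal ((v w)\<^sup>2) \<partial>Q) \<le> ennreal (K * b\<^sup>2)"
  shows "(\<integral>\<^sup>+w. ennreal \<bar>u w * v w\<bar> \<partial>Q) \<le> ennreal (K * (a * b))"
proof -
  have "(\<integral>\<^sup>+w. ennreal \<bar>u w * v w\<bar> \<partial>Q) \<le>
      (\<integral>\<^sup>+w. ennreal (b / (2 * a)) * ennreal ((u w)\<^sup>2) + ennreal (a / (2 * b)) * ennreal ((v w)\<^sup>2) \<partial>Q)"
  proof (intro nn_integral_mono)
    fix w
    have "0 \<le> (b * \<bar>u w\<bar> - a * \<bar>v w\<bar>)\<^sup>2 / (2 * a * b)" using ab by simp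
    also have "\<dots> = b / (2 * a) * (u w)\<^sup>2 + a / (2 * b) * (v w)\<^sup>2 - \<bar>u w\<bar> * \<bar>v w\<bar>"
      using ab by (simp add: power2_diff power_mult_distrib field_simps power2_eq_square)
    finally have "\<bar>u w * v w\<bar> \<le> b / (2 * a) * (u w)\<^sup>2 + a / (2 * b) * (v w)\<^sup>2" by (simp add: abs_mult)
    then have "ennreal \<bar>u w * v w\<bar> \<le> ennreal (b / (2 * a) * (u w)\<^sup>2 + a / (2 * b) * (v w)\<^sup>2)" by (rule ennreal_leI)
    also have "\<dots> = ennreal (b / (2 * a)) * ennreal ((u w)\<^sup>2) + ennreal (a / (2 * b)) * ennreal ((v w)\<^sup>2)"
      using ab by (simp del: times_divide_eq_left times_divide_eq_right flip: ennreal_mult ennreal_plus)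
    finally show "ennreal \<bar>u w * v w\<bar> \<le> ennreal (b / (2 * a)) * ennreal ((u w)\<^sup>2) + ennreal (a / (2 * b)) * ennreal ((v w)\<^sup>2)" .
  qed
  also have "\<dots> = ennreal (b / (2 * a)) * (\<integral>\<^sup>+w. ennreal ((u w)\<^sup>2) \<partial>Q) + ennreal (a / (2 * b)) * (\<integral>\<^sup>+w. ennreal ((v w)\<^sup>2) \<partial>Q)"
    by (simp add: nn_integral_add nn_integral_cmult)
  also have "\<dots> \<le> ennreal (b / (2 * a)) * ennreal (K * a\<^sup>2) + ennreal (a / (2 * b)) * ennreal (K * b\<^sup>2)"
    using u v by (intro add_mono mult_left_mono) auto
  also have "\<dots> = ennreal (b / (2 * a) * (K * a\<^sup>2) + a / (2 * b) * (K * b\<^sup>2))"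
    using ab K by (simp del: times_divide_eq_left times_divide_eq_right flip: ennreal_mult ennreal_plus)
  also have "b / (2 * a) * (K * a\<^sup>2) + a / (2 * b) * (K * b\<^sup>2) = K * (a * b)"
    using ab by (simp add: field_simps power2_eq_square)
  finally show ?thesis .
qed

lemma (in prob_space) nn_integral_abs_le:
  fixes u :: "'a \<Rightarrow> real"
  assumes m: "u \<in> borel_measurable M" and K: "K \<ge> 0" and a: "a > 0"
    and u: "(\<integral>\<^sup>+w. ennreal ((u w)\<^sup>2) \<partial>M) \<le> ennreal (K * a\<^sup>2)"
  shows "(\<integral>\<^sup>+w. ennreal \<bar>u w\<bar> \<partial>M) \<le> ennreal ((K + 1) * a)"
proof -
  have "(\<integral>\<^sup>+w. ennreal ((u w)\<^sup>2) \<partial>M) \<le> ennreal ((K + 1) * a\<^sup>2)"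
    using u by (rule order_trans) (intro ennreal_leI mult_right_mono, auto)
  \<comment> \<open>The second factor is the constant 1, whose second moment on a probability space
    is 1; this is why the constant is \<open>K + 1\<close>.\<close>
  moreover have "(\<integral>\<^sup>+w. ennreal (1\<^sup>2) \<partial>M) \<le> ennreal ((K + 1) * 1\<^sup>2)"
    using K by (simp add: emeasure_space_1)
  ultimately have "(\<integral>\<^sup>+w. ennreal \<bar>u w * 1\<bar> \<partial>M) \<le> ennreal ((K + 1) * (a * 1))"
    using m K a by (intro nn_integral_product_le) auto
  then show ?thesis by simp
qed

lemma nn_integral_le_cmult:
  assumes g: "g \<in> borel_measurable Q" and c: "c \<ge> (0::real)"
    and le: "AE w in Q. f w \<le> c * g w" and B: "(\<integral>\<^sup>+w. ennreal (g w) \<partial>Q) \<le> ennreal B"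
  shows "(\<integral>\<^sup>+w. ennreal (f w) \<partial>Q) \<le> ennreal (c * B)"
proof -
  have "(\<integral>\<^sup>+w. ennreal (f w) \<partial>Q) \<le> (\<integral>\<^sup>+w. ennreal c * ennreal (g w) \<partial>Q)"
    using le by (intro nn_integral_mono_AE) (auto elim!: eventually_mono simp: ennreal_mult'[OF c, symmetric] intro!: ennreal_leI)
  also have "\<dots> = ennreal c * (\<integral>\<^sup>+w. ennreal (g w) \<partial>Q)"
    using g by (intro nn_integral_cmult) auto
  also have "\<dots> \<le> ennreal c * ennreal B" using B by (rule mult_left_mono) simp
  also have "\<dots> = ennreal (c * B)" by (rule ennreal_mult'[OF c, symmetric])
  finally show ?thesis .
qed

section \<open>The observational model\<close>

text \<open>A finite bound on \<open>L2norm\<close> excludes its value at functions that are not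
  square integrable, so the Bochner integral inside agrees with the nonnegative one.\<close>

lemma L2norm_le_imp:
  assumes "\<bar>L2norm P f\<bar> \<le> ereal t" "t \<ge> 0"
  shows "(\<integral>\<^sup>+x. ennreal ((f x)\<^sup>2) \<partial>P) \<le> ennreal (t\<^sup>2)"
proof -
  have i: "integrable P (\<lambda>x. (f x)\<^sup>2)" using assms(1) by (auto simp: L2norm_def split: if_splits)
  then have "sqrt (\<integral>x. (f x)\<^sup>2 \<partial>P) \<le> t" using assms(1) by (auto simp: L2norm_def)
  then have "(\<integral>x. (f x)\<^sup>2 \<partial>P) \<le> t\<^sup>2" using assms(2) real_sqrt_le_iff[of _ "t\<^sup>2"] by simp
  then show ?thesis using nn_integral_eq_integral[OF i] by (simp add: ennreal_leI)
qed

text \<open>Derived quantities such as \<open>PX\<close>, \<open>pbar\<close> and \<open>mh\<close>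
  are parameters with defining equations, so that the theorem can interpret the locale with the
  constants of its own \<open>defines\<close> clauses. \<open>s1\<close> and \<open>s2\<close> are
  the bounds whose existence \<open>basic_assumption\<close> asserts.\<close>

locale ate_setting =
  fixes Q :: "'q measure" and X :: "'q \<Rightarrow> real^'p" and Yp R :: "nat \<Rightarrow> 'q \<Rightarrow> real"
    and m \<mu> \<pi> e :: "nat \<Rightarrow> real^'p \<Rightarrow> real"
    and M :: "nat \<Rightarrow> 'w measure" and Zs :: "nat \<Rightarrow> nat \<Rightarrow> 'w \<Rightarrow> 'p::finite obs"
    and K :: nat and I :: "nat \<Rightarrow> nat \<Rightarrow> 'w \<Rightarrow> nat set"
    and mhat :: "nat \<Rightarrow> nat \<Rightarrow> 'p estimator" and pihat :: "nat \<Rightarrow> 'p estimator"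
    and r\<mu> :: "nat \<Rightarrow> nat \<Rightarrow> real" and re :: "nat \<Rightarrow> real" and c C s1 s2 :: real
    and PX :: "(real^'p) measure" and \<X> :: "(real^'p) set" and Z :: "nat \<Rightarrow> 'q \<Rightarrow> 'p obs"
    and pbar a :: "nat \<Rightarrow> real" and \<theta> :: "nat \<Rightarrow> real"
    and mh :: "nat \<Rightarrow> nat \<Rightarrow> nat \<Rightarrow> 'w \<Rightarrow> real^'p \<Rightarrow> real" and ph :: "nat \<Rightarrow> nat \<Rightarrow> 'w \<Rightarrow> real^'p \<Rightarrow> real"
  assumes PX_eq: "PX = distr Q borel X"
    and \<X>_eq: "\<X> = law_support (distr Q borel X)"
    and Z_eq: "Z = (\<lambda>N. observation Yp (R N) X)"
    and pbar_eq: "pbar = (\<lambda>N. measure Q {w \<in> space Q. R N w = 1})"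
    and a_eq: "a = (\<lambda>N. inverse (\<integral>w. inverse (\<pi> N (X w)) \<partial>Q))"
    and \<theta>_eq: "\<theta> = (\<lambda>r. \<integral>w. Yp r w \<partial>Q)"
    and mh_eq: "mh = (\<lambda>r N k w. fold_fit (mhat r N) N (I N k w) (\<lambda>i. Zs N i w))"
    and ph_eq: "ph = (\<lambda>N k w. fold_fit (pihat N) N (I N k w) (\<lambda>i. Zs N i w))"
    and model: "causal_model Q X Yp R m \<pi>"
    and sq: "\<And>r. r \<in> {0,1} \<Longrightarrow> integrable Q (\<lambda>w. (Yp r w)\<^sup>2)"
    and s1: "s1 > 0" and s2: "s2 > 0"
    and cond_lower: "\<And>r. r \<in> {0,1} \<Longrightarrow> AE w in Q. nn_cond_exp Q (sigma_of Q X) (\<lambda>w. ennreal ((Yp r w - m r (X w))\<^sup>2)) w \<ge> ennreal s1"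
    and cond_upper: "\<And>r. r \<in> {0,1} \<Longrightarrow> AE w in Q. nn_cond_exp Q (sigma_of Q X) (\<lambda>w. ennreal ((Yp r w - \<mu> r (X w))\<^sup>2)) w \<le> ennreal s2"
    and limits: "\<forall>r\<in>{0,1}. \<mu> r \<in> borel_measurable borel" "\<forall>N\<ge>1. e N \<in> borel_measurable borel"
    and sample: "\<forall>N\<ge>1. prob_space (M N) \<and> iid_copies (M N) {1..N} (Zs N) Q (Z N)"
    and folds: "\<forall>N\<ge>1. random_partition (M N) N K (I N) (Zs N)"
    and estimators: "\<forall>N\<ge>1. (\<forall>r\<in>{0,1}. measurable_estimator N (mhat r N)) \<and> measurable_estimator N (pihat N)"
    and overlap: "pbar \<longlonglongrightarrow> 0" "filterlim (\<lambda>N. real N * pbar N) at_top sequentially"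
      "c > 0" "C > 0"
      "\<forall>N\<ge>1. \<forall>x\<in>\<X>. c * pbar N < \<pi> N x \<and> \<pi> N x < C * pbar N \<and> c * pbar N < e N x \<and> e N x < C * pbar N"
    and m0: "integrable Q (\<lambda>w. (m 0 (X w) - (\<integral>v. m 0 (X v) \<partial>Q))\<^sup>2)"
    and rates: "\<forall>N\<ge>1. r\<mu> 0 N > 0 \<and> r\<mu> 1 N > 0 \<and> re N > 0"
      "r\<mu> 0 \<in> o(\<lambda>_. 1)" "r\<mu> 1 \<in> o(\<lambda>_. 1)" "re \<in> o(\<lambda>_. 1)"
    and mhat0: "\<forall>k\<in>{1..K}. bigOp M (\<lambda>N w. L2norm PX (\<lambda>x. mh 0 N k w x - \<mu> 0 x)) (r\<mu> 0)"
    and pihat: "\<forall>k\<in>{1..K}. bigOp M (\<lambda>N w. SUP x\<in>\<X>. ereal \<bar>(ph N k w x - e N x) / pbar N\<bar>) re"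
    and mhat1: "\<forall>k\<in>{1..K}. bigOp M (\<lambda>N w. L2norm PX (\<lambda>x. mh 1 N k w x - \<mu> 1 x)) (r\<mu> 1)"
      "\<forall>k\<in>{1..K}. littleop M (\<lambda>N w. enn2ereal
        (\<integral>\<^sup>+x. ennreal (a N / \<pi> N x * (mh 1 N k w x - \<mu> 1 x)\<^sup>2) \<partial>PX)) (\<lambda>_. 1)"
    and pihat_int: "\<forall>k\<in>{1..K}. bigOp M (\<lambda>N w. enn2ereal
        (\<integral>\<^sup>+x. ennreal ((1 - e N x / ph N k w x)\<^sup>2) \<partial>PX)) (\<lambda>N. (re N)\<^sup>2)"
begin

lemma prob_Q: "prob_space Q" and X[measurable]: "X \<in> borel_measurable Q"
  using model by (simp_all add: causal_model_def)

lemma Yp[measurable]: "Yp 0 \<in> borel_measurable Q" "Yp 1 \<in> borel_measurable Q"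
  "Yp (Suc 0) \<in> borel_measurable Q"
  using model by (simp_all add: causal_model_def)

lemma \<mu>[measurable]: "\<mu> 0 \<in> borel_measurable borel" "\<mu> 1 \<in> borel_measurable borel"
  "\<mu> (Suc 0) \<in> borel_measurable borel"
  using limits(1) by simp_all

lemma cm: "is_cond_mean Q X (Yp 0) (m 0)" "is_cond_mean Q X (Yp 1) (m 1)"
  using model by (simp_all add: causal_model_def)

lemma m[measurable]: "m 0 \<in> borel_measurable borel" "m 1 \<in> borel_measurable borel"
  "m (Suc 0) \<in> borel_measurable borel"
  using cm by (simp_all add: is_cond_mean_def)

lemma R:
  assumes "N \<ge> 1"
  shows "R N \<in> borel_measurable Q" "\<And>w. w \<in> space Q \<Longrightarrow> R N w = 0 \<or> R N w = 1"
    and "cond_indep Q (\<lambda>w. (Yp 0 w, Yp 1 w)) (R N) X"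
    and "is_cond_mean Q X (\<lambda>w. of_bool (R N w = 1)) (\<pi> N)"
  using model assms by (auto simp: causal_model_def)

lemma \<pi>: "N \<ge> 1 \<Longrightarrow> \<pi> N \<in> borel_measurable borel"
  using R(4) by (auto simp: is_cond_mean_def)

lemma e: "N \<ge> 1 \<Longrightarrow> e N \<in> borel_measurable borel"
  using limits(2) by simp

lemma Z_measurable: "N \<ge> 1 \<Longrightarrow> Z N \<in> borel_measurable Q"
  using R(1)[of N] unfolding Z_eq observation_def[abs_def] by measurable

sublocale cross_fitting Q Z M Zs K I
proof (rule cross_fitting.intro)
  show "prob_space Q" by (rule prob_Q)
  fix N :: nat assume N: "N \<ge> 1"
  show "Z N \<in> borel_measurable Q" by (rule Z_measurable[OF N])
  show "prob_space (M N)" "iid_copies (M N) {1..N} (Zs N) Q (Z N)" using sample N by blast+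
  show "random_partition (M N) N K (I N) (Zs N)" using folds N by blast
qed

sublocale prob_space Q by (rule prob_Q)

lemma arm1:
  assumes N: "N \<ge> 1"
  shows "treatment_arm Q X (Yp 1) (R N) (\<pi> N) (m 1) (4 * s2)"
proof (rule treatment_armI[where V = "\<lambda>w. (Yp 0 w, Yp 1 w)" and W = "R N" and B = "{1}" and h = snd and \<mu> = "\<mu> 1"])
  show "(\<lambda>w. (Yp 0 w, Yp 1 w)) \<in> borel_measurable Q" by measurable
  show "is_cond_mean Q X (\<lambda>w. of_bool (R N w \<in> {1})) (\<pi> N)" using R(4)[OF N] by simp
  show "snd \<in> borel_measurable (borel :: (real \<times> real) measure)"
    by (intro borel_measurable_continuous_onI continuous_intros)
  show "R N w = of_bool (R N w \<in> {1})" if "w \<in> space Q" for w using R(2)[OF N that] by auto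
  show "integrable Q (\<lambda>w. (Yp 1 w)\<^sup>2)" using sq by simp
  show "AE w in Q. nn_cond_exp Q (sigma_of Q X) (\<lambda>w. ennreal ((Yp 1 w - \<mu> 1 (X w))\<^sup>2)) w \<le> ennreal s2"
    using cond_upper by simp
  show "0 \<le> s2" using s2 by simp
qed (use R[OF N] prob_Q cm in simp_all)

lemma arm0:
  assumes N: "N \<ge> 1"
  shows "treatment_arm Q X (Yp 0) (\<lambda>w. 1 - R N w) (\<lambda>x. 1 - \<pi> N x) (m 0) (4 * s2)"
proof (rule treatment_armI[where V = "\<lambda>w. (Yp 0 w, Yp 1 w)" and W = "R N" and B = "- {1}" and h = fst and \<mu> = "\<mu> 0"])
  show "(\<lambda>w. (Yp 0 w, Yp 1 w)) \<in> borel_measurable Q" by measurable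
  show "is_cond_mean Q X (\<lambda>w. of_bool (R N w \<in> - {1})) (\<lambda>x. 1 - \<pi> N x)"
    using is_cond_mean_compl[OF prob_Q X R(4)[OF N]] by simp
  show "fst \<in> borel_measurable (borel :: (real \<times> real) measure)"
    by (intro borel_measurable_continuous_onI continuous_intros)
  show "1 - R N w = of_bool (R N w \<in> - {1})" if "w \<in> space Q" for w using R(2)[OF N that] by auto
  show "integrable Q (\<lambda>w. (Yp 0 w)\<^sup>2)" using sq by simp
  show "AE w in Q. nn_cond_exp Q (sigma_of Q X) (\<lambda>w. ennreal ((Yp 0 w - \<mu> 0 (X w))\<^sup>2)) w \<le> ennreal s2"
    using cond_upper by simp
  show "0 \<le> s2" using s2 by simp
qed (use R[OF N] prob_Q cm in simp_all)

text \<open>Misspecification is essentially bounded, uniformly in \<open>N\<close>. This lets a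
  weight error measured in L1 control its product with \<open>\<mu> - m\<close>.\<close>

lemma bias:
  "AE w in Q. \<bar>m 0 (X w) - \<mu> 0 (X w)\<bar> \<le> sqrt s2" "AE w in Q. \<bar>m 1 (X w) - \<mu> 1 (X w)\<bar> \<le> sqrt s2"
proof -
  have "AE w in Q. (m 0 (X w) - \<mu> 0 (X w))\<^sup>2 \<le> s2"
    by (rule cond_mean_bias_bound[OF prob_Q X cm(1) \<mu>(1) sq _ cond_upper]) (use s2 in auto)
  then show "AE w in Q. \<bar>m 0 (X w) - \<mu> 0 (X w)\<bar> \<le> sqrt s2"
    by eventually_elim (simp add: real_le_rsqrt)
  have "AE w in Q. (m 1 (X w) - \<mu> 1 (X w))\<^sup>2 \<le> s2"
    by (rule cond_mean_bias_bound[OF prob_Q X cm(2) \<mu>(2) sq _ cond_upper]) (use s2 in auto)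
  then show "AE w in Q. \<bar>m 1 (X w) - \<mu> 1 (X w)\<bar> \<le> sqrt s2"
    by eventually_elim (simp add: real_le_rsqrt)
qed

lemma AE_support: "AE w in Q. X w \<in> \<X>"
  using AE_distrD[OF X AE_law_support[of "distr Q borel X"]] by (simp add: \<X>_eq)

text \<open>The strict inequalities of overlap, read at one point of the support, exclude
  \<open>pbar N = 0\<close>; such a point exists because \<open>X\<close> lies in the support almost
  surely.\<close>

lemma pbar_pos: assumes N: "N \<ge> 1" shows "0 < pbar N" "pbar N \<le> 1"
proof -
  have "\<exists>w. X w \<in> \<X>"
  proof (rule ccontr)
    assume "\<not> (\<exists>w. X w \<in> \<X>)"
    with AE_support show False by simp
  qed
  then obtain w where "X w \<in> \<X>" ..
  then have "c * pbar N < C * pbar N" using overlap(5) N by fastforce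
  moreover have "pbar N \<ge> 0" by (simp add: pbar_eq)
  ultimately show "0 < pbar N" by (cases "pbar N = 0") auto
  show "pbar N \<le> 1" by (simp add: pbar_eq)
qed

lemma overlap_AE:
  assumes N: "N \<ge> 1"
  shows "AE w in Q. c * pbar N < \<pi> N (X w) \<and> \<pi> N (X w) < C * pbar N \<and>
    c * pbar N < e N (X w) \<and> e N (X w) < C * pbar N \<and> 0 < \<pi> N (X w) \<and> 0 < e N (X w)"
  using AE_support
proof eventually_elim
  case (elim w)
  moreover have "0 < c * pbar N" using overlap(3) pbar_pos[OF N] by simp
  ultimately show ?case using overlap(5) N by (meson order.strict_trans)
qed

lemma rate_pos: "N \<ge> 1 \<Longrightarrow> re N > 0" "N \<ge> 1 \<Longrightarrow> r\<mu> 0 N > 0" "N \<ge> 1 \<Longrightarrow> r\<mu> 1 N > 0"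
  using rates(1) by auto

lemma eventually_pbar_le: "d > 0 \<Longrightarrow> \<forall>\<^sub>F N in sequentially. pbar N \<le> d"
  using order_tendstoD(2)[OF overlap(1), of d] by (auto elim!: eventually_mono)

lemma eventually_rate_le:
  assumes "d > 0"
  shows "\<forall>\<^sub>F N in sequentially. re N \<le> d" "\<forall>\<^sub>F N in sequentially. r\<mu> 0 N \<le> d" "\<forall>\<^sub>F N in sequentially. r\<mu> 1 N \<le> d"
  using landau_o.smallD[OF rates(4) assms] landau_o.smallD[OF rates(2) assms] landau_o.smallD[OF rates(3) assms]
  by (eventually_elim, simp)+

text \<open>\<open>1 / \<pi>\<close> is almost surely at most \<open>1 / (c * pbar N)\<close>, hence
  so is its mean, of which \<open>a N\<close> is the inverse. The upper bound on
  \<open>\<pi>\<close> makes this mean positive, as monotonicity of inversion requires.\<close>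

lemma a_ge: assumes N: "N \<ge> 1" shows "a N \<ge> c * pbar N"
proof -
  have cp: "0 < c * pbar N" "0 < C * pbar N" using overlap pbar_pos[OF N] by auto
  have b: "AE w in Q. inverse (\<pi> N (X w)) \<le> inverse (c * pbar N)" "AE w in Q. inverse (C * pbar N) \<le> inverse (\<pi> N (X w))"
    using overlap_AE[OF N]
    by (eventually_elim, use cp in \<open>auto intro!: le_imp_inverse_le simp del: inverse_mult_distrib\<close>)+
  have i: "integrable Q (\<lambda>w. inverse (\<pi> N (X w)))"
  proof (rule integrable_const_bound[of _ "inverse (c * pbar N)"])
    show "AE w in Q. norm (inverse (\<pi> N (X w))) \<le> inverse (c * pbar N)"
      using b(1) overlap_AE[OF N] by eventually_elim simp
  qed (use \<pi>[OF N] in measurable)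
  have "(\<integral>w. inverse (\<pi> N (X w)) \<partial>Q) \<le> inverse (c * pbar N)"
    by (rule integral_le_const[OF i b(1)])
  moreover have "inverse (C * pbar N) \<le> (\<integral>w. inverse (\<pi> N (X w)) \<partial>Q)"
    by (rule integral_ge_const[OF i b(2)])
  then have "0 < (\<integral>w. inverse (\<pi> N (X w)) \<partial>Q)"
    using cp(2) by (meson inverse_positive_iff_positive order.strict_trans2)
  ultimately have "inverse (inverse (c * pbar N)) \<le> a N"
    unfolding a_eq by (rule le_imp_inverse_le)
  then show ?thesis by simp
qed

lemma mh_measurable: "N \<ge> 1 \<Longrightarrow> r \<in> {0,1} \<Longrightarrow> mh r N k w \<in> borel_measurable borel"
  unfolding mh_eq using estimators by (intro measurable_fold_fit) blast

lemma ph_measurable: "N \<ge> 1 \<Longrightarrow> ph N k w \<in> borel_measurable borel"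
  unfolding ph_eq using estimators by (intro measurable_fold_fit) blast

lemma nn_integral_PX: "f \<in> borel_measurable borel \<Longrightarrow> (\<integral>\<^sup>+x. f x \<partial>PX) = (\<integral>\<^sup>+w. f (X w) \<partial>Q)"
  unfolding PX_eq by (rule nn_integral_distr[OF X]) simp

lemma nn_integral_law: "N \<ge> 1 \<Longrightarrow> f \<in> borel_measurable borel \<Longrightarrow> (\<integral>\<^sup>+z. f z \<partial>law N) = (\<integral>\<^sup>+w. f (Z N w) \<partial>Q)"
  by (rule nn_integral_distr[OF Z_measurable]) simp_all

lemma integral_law: "N \<ge> 1 \<Longrightarrow> f \<in> borel_measurable borel \<Longrightarrow> (\<integral>z. f z \<partial>law N) = (\<integral>w. f (Z N w) \<partial>Q)" for f :: "_ \<Rightarrow> real"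
  by (rule integral_distr[OF Z_measurable]) simp_all

abbreviation mu_err :: "nat \<Rightarrow> nat \<Rightarrow> nat \<Rightarrow> 'w \<Rightarrow> ennreal" where
  "mu_err r k N w \<equiv> \<integral>\<^sup>+v. ennreal ((mh r N k w (X v) - \<mu> r (X v))\<^sup>2) \<partial>Q"

abbreviation e_err :: "nat \<Rightarrow> nat \<Rightarrow> 'w \<Rightarrow> ennreal" where
  "e_err k N w \<equiv> \<integral>\<^sup>+v. ennreal ((1 - e N (X v) / ph N k w (X v))\<^sup>2) \<partial>Q"

abbreviation sup_err :: "nat \<Rightarrow> nat \<Rightarrow> 'w \<Rightarrow> ereal" where
  "sup_err k N w \<equiv> SUP x\<in>\<X>. ereal \<bar>(ph N k w x - e N x) / pbar N\<bar>"

lemma mu_err_rate: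
  assumes r: "r \<in> {0,1}" and k: "k \<in> {1..K}"
  shows "bigOp M (\<lambda>N w. enn2ereal (mu_err r k N w)) (\<lambda>N. (r\<mu> r N)\<^sup>2)"
proof -
  have "bigOp M (\<lambda>N w. L2norm PX (\<lambda>x. mh r N k w x - \<mu> r x)) (r\<mu> r)"
    using mhat0 mhat1(1) r k by auto
  then show ?thesis
  proof (rule bigOp_mono)
    show "0 \<le> r\<mu> r N" if "1 \<le> N" for N using rate_pos[OF that] r by auto
    fix L :: real assume L: "L > 0"
    show "\<exists>K'>0. \<forall>\<^sub>F N in sequentially. \<forall>w\<in>space (M N).
        \<bar>L2norm PX (\<lambda>x. mh r N k w x - \<mu> r x)\<bar> \<le> ereal (L * r\<mu> r N) \<longrightarrow>
        \<bar>enn2ereal (mu_err r k N w)\<bar> \<le> ereal (K' * (r\<mu> r N)\<^sup>2)"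
    proof (intro exI[of _ "L\<^sup>2"] conjI eventually_mono[OF eventually_ge_at_top[of 1]] ballI impI)
      fix N w assume N: "(1::nat) \<le> N" and le: "\<bar>L2norm PX (\<lambda>x. mh r N k w x - \<mu> r x)\<bar> \<le> ereal (L * r\<mu> r N)"
      have "(\<integral>\<^sup>+x. ennreal ((mh r N k w x - \<mu> r x)\<^sup>2) \<partial>PX) \<le> ennreal ((L * r\<mu> r N)\<^sup>2)"
        using rate_pos[OF N] r L by (intro L2norm_le_imp[OF le]) auto
      moreover have "(\<lambda>x. ennreal ((mh r N k w x - \<mu> r x)\<^sup>2)) \<in> borel_measurable borel"
        using mh_measurable[OF N r, of k w] limits(1)[rule_format, OF r] by measurable
      ultimately show "\<bar>enn2ereal (mu_err r k N w)\<bar> \<le> ereal (L\<^sup>2 * (r\<mu> r N)\<^sup>2)"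
        by (simp add: abs_enn2ereal_le_iff nn_integral_PX power_mult_distrib)
    qed (use L in simp)
  qed
qed

text \<open>Dividing the hypothesis by its factor \<open>a N\<close>, which is at least
  \<open>c * pbar N\<close>, turns order 1 into order 1/pbar; this also explains the witness
  \<open>c * \<delta>\<close>.\<close>

lemma weighted_mu_err_rate:
  assumes k: "k \<in> {1..K}"
  shows "littleop M (\<lambda>N w. enn2ereal (\<integral>\<^sup>+v. ennreal ((mh 1 N k w (X v) - \<mu> 1 (X v))\<^sup>2 / \<pi> N (X v)) \<partial>Q)) (\<lambda>N. 1 / pbar N)"
proof (rule littleop_mono[OF mhat1(2)[rule_format, OF k]])
  fix \<delta> :: real assume d: "\<delta> > 0"
  show "\<exists>\<delta>'>0. \<forall>\<^sub>F N in sequentially. \<forall>w\<in>space (M N).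
      \<bar>enn2ereal (\<integral>\<^sup>+x. ennreal (a N / \<pi> N x * (mh 1 N k w x - \<mu> 1 x)\<^sup>2) \<partial>PX)\<bar> \<le> ereal (\<delta>' * 1) \<longrightarrow>
      \<bar>enn2ereal (\<integral>\<^sup>+v. ennreal ((mh 1 N k w (X v) - \<mu> 1 (X v))\<^sup>2 / \<pi> N (X v)) \<partial>Q)\<bar> \<le> ereal (\<delta> * (1 / pbar N))"
  proof (intro exI[of _ "c * \<delta>"] conjI eventually_mono[OF eventually_ge_at_top[of 1]] ballI impI)
    fix N w assume N: "(1::nat) \<le> N" and
      le: "\<bar>enn2ereal (\<integral>\<^sup>+x. ennreal (a N / \<pi> N x * (mh 1 N k w x - \<mu> 1 x)\<^sup>2) \<partial>PX)\<bar> \<le> ereal (c * \<delta> * 1)"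
    note [measurable] = mh_measurable[OF N, of 1 k w, simplified] \<pi>[OF N]
    have cp: "0 < c * pbar N" using overlap(3) pbar_pos[OF N] by simp
    have "(\<integral>\<^sup>+v. ennreal (a N / \<pi> N (X v) * (mh 1 N k w (X v) - \<mu> 1 (X v))\<^sup>2) \<partial>Q) \<le> ennreal (c * \<delta>)"
      using le[unfolded mult_1_right, THEN abs_enn2ereal_le_iff(1)[THEN iffD1, rotated]] d overlap(3)
      by (simp add: nn_integral_PX)
    then have "(\<integral>\<^sup>+v. ennreal ((mh 1 N k w (X v) - \<mu> 1 (X v))\<^sup>2 / \<pi> N (X v)) \<partial>Q) \<le> ennreal (1 / (c * pbar N) * (c * \<delta>))"
    proof (rule nn_integral_le_cmult[rotated 3])
      show "AE v in Q. (mh 1 N k w (X v) - \<mu> 1 (X v))\<^sup>2 / \<pi> N (X v) \<le>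
          1 / (c * pbar N) * (a N / \<pi> N (X v) * (mh 1 N k w (X v) - \<mu> 1 (X v))\<^sup>2)"
        using overlap_AE[OF N]
      proof eventually_elim
        case (elim v)
        let ?v = "(mh 1 N k w (X v) - \<mu> 1 (X v))\<^sup>2 / \<pi> N (X v)"
        have "1 * ?v \<le> (a N / (c * pbar N)) * ?v"
          using a_ge[OF N] cp elim by (intro mult_right_mono) auto
        then show ?case by (simp add: mult.commute)
      qed
    qed (use cp in \<open>auto simp: less_imp_le\<close>)
    moreover have "1 / (c * pbar N) * (c * \<delta>) = \<delta> * (1 / pbar N)" using overlap(3) by simp
    ultimately show "\<bar>enn2ereal (\<integral>\<^sup>+v. ennreal ((mh 1 N k w (X v) - \<mu> 1 (X v))\<^sup>2 / \<pi> N (X v)) \<partial>Q)\<bar> \<le> ereal (\<delta> * (1 / pbar N))"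
      using d pbar_pos[OF N] by (simp add: abs_enn2ereal_le_iff)
  qed (use d overlap(3) in simp)
qed

lemma e_err_rate:
  assumes k: "k \<in> {1..K}"
  shows "bigOp M (\<lambda>N w. enn2ereal (e_err k N w)) (\<lambda>N. (re N)\<^sup>2)"
proof (rule bigOp_mono[OF pihat_int[rule_format, OF k]])
  fix L :: real assume L: "L > 0"
  show "\<exists>K'>0. \<forall>\<^sub>F N in sequentially. \<forall>w\<in>space (M N).
      \<bar>enn2ereal (\<integral>\<^sup>+x. ennreal ((1 - e N x / ph N k w x)\<^sup>2) \<partial>PX)\<bar> \<le> ereal (L * (re N)\<^sup>2) \<longrightarrow>
      \<bar>enn2ereal (e_err k N w)\<bar> \<le> ereal (K' * (re N)\<^sup>2)"
  proof (intro exI[of _ L] conjI eventually_mono[OF eventually_ge_at_top[of 1]] ballI impI)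
    fix N w assume N: "(1::nat) \<le> N" and
      le: "\<bar>enn2ereal (\<integral>\<^sup>+x. ennreal ((1 - e N x / ph N k w x)\<^sup>2) \<partial>PX)\<bar> \<le> ereal (L * (re N)\<^sup>2)"
    note [measurable] = ph_measurable[OF N, of k w] e[OF N]
    from le show "\<bar>enn2ereal (e_err k N w)\<bar> \<le> ereal (L * (re N)\<^sup>2)" by (simp add: nn_integral_PX)
  qed (rule L)
qed simp

lemma sup_err_bound:
  assumes N: "N \<ge> 1" and L: "\<bar>sup_err k N w\<bar> \<le> ereal t"
  shows "AE v in Q. \<bar>ph N k w (X v) - e N (X v)\<bar> \<le> t * pbar N"
  using AE_support
proof eventually_elim
  case (elim v)
  have "ereal \<bar>(ph N k w (X v) - e N (X v)) / pbar N\<bar> \<le> sup_err k N w"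
    using elim by (rule SUP_upper)
  also have "\<dots> \<le> \<bar>sup_err k N w\<bar>" by (cases "sup_err k N w") auto
  also note L
  finally show ?case using pbar_pos[OF N] by (simp add: abs_divide field_simps)
qed

end

lemma abs_diff_inverse_le:
  fixes a b :: real
  assumes "a \<ge> 1/2" "b \<ge> 1/2"
  shows "\<bar>1 / a - 1 / b\<bar> \<le> 4 * \<bar>b - a\<bar>"
proof -
  have ab: "1/2 * (1/2) \<le> a * b" using assms by (intro mult_mono) auto
  have "\<bar>1 / a - 1 / b\<bar> = \<bar>b - a\<bar> / (a * b)"
    using assms by (simp add: diff_frac_eq abs_divide abs_mult)
  also have "\<dots> \<le> \<bar>b - a\<bar> / (1/2 * (1/2))"
    using ab by (intro divide_left_mono mult_pos_pos) (use assms in auto)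
  finally show ?thesis by simp
qed

context ate_setting
begin

section \<open>From conditional moments to rates, and the summands of both expansions\<close>

lemma obs_Z: "obsR (Z N w) = R N w" "obsX (Z N w) = X w"
  "obsY (Z N w) = R N w * Yp 1 w + (1 - R N w) * Yp 0 w"
  by (simp_all add: Z_eq observation_def)

lemma rate_eq: "sqrt (1 / pbar N / real N) = (real N * pbar N) powr (-1/2)"
proof (cases "N \<ge> 1")
  case True
  have "(real N * pbar N) powr (-1/2) = 1 / sqrt (real N * pbar N)"
    using True pbar_pos[OF True] by (simp add: powr_minus_divide powr_half_sqrt)
  then show ?thesis by (simp add: real_sqrt_divide real_sqrt_mult mult.commute)
next
  case False
  \<comment> \<open>At \<open>N = 0\<close> both sides are 0, by division by zero on the left and
    \<open>0 powr\<close> on the right.\<close>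
  then have "N = 0" by simp
  then show ?thesis by simp
qed

abbreviation cond_mean where "cond_mean F N k w \<equiv> \<integral>v. trained F N k w (Z N v) \<partial>Q"
abbreviation cond_square where "cond_square F N k w \<equiv> \<integral>\<^sup>+v. ennreal ((trained F N k w (Z N v))\<^sup>2) \<partial>Q"
abbreviation cond_abs where "cond_abs F N k w \<equiv> \<integral>\<^sup>+v. ennreal \<bar>trained F N k w (Z N v)\<bar> \<partial>Q"

text \<open>Conditional second moments may be as large as o(1/pbar), since sqrt (1 / pbar / N) is
  the target rate. \<open>D\<close> states how small the control variable must be for a given
  \<open>\<delta>\<close>; \<open>E\<close> collects the conditions on \<open>N\<close> that hold
  only eventually.\<close>

lemma littleop_pieceI:
  assumes F: "\<And>N. N \<ge> 1 \<Longrightarrow> measurable_statistic N (F N)"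
    and W: "\<And>k. k \<in> {1..K} \<Longrightarrow> littleop M (W k) q"
    and D: "\<And>\<delta>::real. \<delta> > 0 \<Longrightarrow> D \<delta> > (0::real)" and E: "\<And>\<delta>. \<delta> > 0 \<Longrightarrow> \<forall>\<^sub>F N in sequentially. E \<delta> N"
    and imp: "\<And>k \<delta> N w. k \<in> {1..K} \<Longrightarrow> \<delta> > 0 \<Longrightarrow> N \<ge> 1 \<Longrightarrow> E \<delta> N \<Longrightarrow> \<bar>W k N w\<bar> \<le> ereal (D \<delta> * q N) \<Longrightarrow>
      cond_mean F N k w = 0"
      "\<And>k \<delta> N w. k \<in> {1..K} \<Longrightarrow> \<delta> > 0 \<Longrightarrow> N \<ge> 1 \<Longrightarrow> E \<delta> N \<Longrightarrow> \<bar>W k N w\<bar> \<le> ereal (D \<delta> * q N) \<Longrightarrow>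
      cond_square F N k w \<le> ennreal (\<delta> / pbar N)"
  shows "real_littleop M (cross_avg F) (\<lambda>N. (real N * pbar N) powr (-1/2))"
  unfolding rate_eq[symmetric]
proof (rule littleop_cross_avg[OF F])
  show "0 < 1 / pbar N" if "N \<ge> 1" for N using pbar_pos[OF that] by simp
  fix k assume k: "k \<in> {1..K}"
  let ?V = "\<lambda>N w. if (\<integral>z. trained F N k w z \<partial>law N) = 0
      then enn2ereal (\<integral>\<^sup>+z. ennreal ((trained F N k w z)\<^sup>2) \<partial>law N) else \<infinity>"
  show "littleop M ?V (\<lambda>N. 1 / pbar N)"
  proof (rule littleop_mono[OF W[OF k]])
    fix \<delta> :: real assume d: "\<delta> > 0"
    have "\<forall>\<^sub>F N in sequentially. \<forall>w\<in>space (M N). \<bar>W k N w\<bar> \<le> ereal (D \<delta> * q N) \<longrightarrow> \<bar>?V N w\<bar> \<le> ereal (\<delta> * (1 / pbar N))"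
      using E[OF d] eventually_ge_at_top[of 1]
    proof (eventually_elim, intro ballI impI)
      fix N w assume N: "E \<delta> N" "N \<ge> 1" and w: "\<bar>W k N w\<bar> \<le> ereal (D \<delta> * q N)"
      have f: "trained F N k w \<in> borel_measurable borel" by (rule measurable_fold_stat[OF F[OF N(2)]])
      then have f2: "(\<lambda>z. ennreal ((trained F N k w z)\<^sup>2)) \<in> borel_measurable borel" by measurable
      have "0 \<le> \<delta> / pbar N" using d pbar_pos[OF N(2)] by simp
      then show "\<bar>?V N w\<bar> \<le> ereal (\<delta> * (1 / pbar N))"
        using imp(1,2)[OF k d N(2,1) w]
        by (simp add: abs_enn2ereal_le_iff nn_integral_law[OF N(2) f2] integral_law[OF N(2) f])
    qed
    with D[OF d] show "\<exists>\<delta>'>0. \<forall>\<^sub>F N in sequentially. \<forall>w\<in>space (M N). \<bar>W k N w\<bar> \<le> ereal (\<delta>' * q N) \<longrightarrow>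
      \<bar>?V N w\<bar> \<le> ereal (\<delta> * (1 / pbar N))" by blast
  qed
qed

text \<open>Two control variables allow for products of nuisance errors; a term driven by a single
  error passes it twice. Their constants are merged into one \<open>L\<close>, and \<open>B\<close>
  translates it into the constant of the conclusion.\<close>

lemma bigOp_pieceI:
  assumes F: "\<And>N. N \<ge> 1 \<Longrightarrow> measurable_statistic N (F N)"
    and r: "\<And>N. N \<ge> 1 \<Longrightarrow> r N > 0"
    and W1: "\<And>k. k \<in> {1..K} \<Longrightarrow> bigOp M (W1 k) q1" and W2: "\<And>k. k \<in> {1..K} \<Longrightarrow> bigOp M (W2 k) q2"
    and q: "\<And>N. N \<ge> 1 \<Longrightarrow> q1 N \<ge> 0" "\<And>N. N \<ge> 1 \<Longrightarrow> q2 N \<ge> 0"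
    and B: "\<And>L::real. L > 0 \<Longrightarrow> B L > (0::real)" and E: "\<And>L. L > 0 \<Longrightarrow> \<forall>\<^sub>F N in sequentially. E L N"
    and imp: "\<And>k L N w. k \<in> {1..K} \<Longrightarrow> L > 0 \<Longrightarrow> N \<ge> 1 \<Longrightarrow> E L N \<Longrightarrow> \<bar>W1 k N w\<bar> \<le> ereal (L * q1 N) \<Longrightarrow>
      \<bar>W2 k N w\<bar> \<le> ereal (L * q2 N) \<Longrightarrow> cond_abs F N k w \<le> ennreal (B L * r N)"
  shows "real_bigOp M (cross_avg F) r"
proof (rule bigOp_cross_avg[OF F r])
  fix k assume k: "k \<in> {1..K}"
  let ?V = "\<lambda>N w. enn2ereal (\<integral>\<^sup>+z. ennreal \<bar>trained F N k w z\<bar> \<partial>law N)"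
  show "bigOp M ?V r"
  proof (rule bigOp_mono2[OF W1[OF k] W2[OF k]])
    fix L :: real assume L: "L > 0"
    have "\<forall>\<^sub>F N in sequentially. \<forall>w\<in>space (M N). \<bar>W1 k N w\<bar> \<le> ereal (L * q1 N) \<longrightarrow>
      \<bar>W2 k N w\<bar> \<le> ereal (L * q2 N) \<longrightarrow> \<bar>?V N w\<bar> \<le> ereal (B L * r N)"
      using E[OF L] eventually_ge_at_top[of 1]
    proof (eventually_elim, intro ballI impI)
      fix N w assume N: "E L N" "N \<ge> 1" and w: "\<bar>W1 k N w\<bar> \<le> ereal (L * q1 N)" "\<bar>W2 k N w\<bar> \<le> ereal (L * q2 N)"
      have "trained F N k w \<in> borel_measurable borel" by (rule measurable_fold_stat[OF F[OF N(2)]])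
      then have f: "(\<lambda>z. ennreal \<bar>trained F N k w z\<bar>) \<in> borel_measurable borel" by measurable
      have "0 \<le> B L * r N" using B[OF L] r[OF N(2)] by simp
      then show "\<bar>?V N w\<bar> \<le> ereal (B L * r N)"
        using imp[OF k L N(2,1) w] by (simp add: abs_enn2ereal_le_iff nn_integral_law[OF N(2) f])
    qed
    with B[OF L] show "\<exists>L'>0. \<forall>\<^sub>F N in sequentially. \<forall>w\<in>space (M N). \<bar>W1 k N w\<bar> \<le> ereal (L * q1 N) \<longrightarrow>
      \<bar>W2 k N w\<bar> \<le> ereal (L * q2 N) \<longrightarrow> \<bar>?V N w\<bar> \<le> ereal (L' * r N)" by blast
  qed (use q in auto)
qed

text \<open>In first moments the indicator becomes a full factor \<open>\<pi>\<close>, which cancels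
  a weight of order 1/pbar; L1 bounds for arm 1 therefore carry no power of pbar.\<close>

lemma treated_abs:
  assumes N: "N \<ge> 1" and f: "f \<in> borel_measurable borel"
  shows "(\<integral>\<^sup>+w. ennreal \<bar>R N w * f (X w)\<bar> \<partial>Q) = (\<integral>\<^sup>+w. ennreal (\<pi> N (X w) * \<bar>f (X w)\<bar>) \<partial>Q)"
proof -
  interpret A: treatment_arm Q X "Yp 1" "R N" "\<pi> N" "m 1" "4 * s2" by (rule arm1[OF N])
  have "(\<integral>\<^sup>+w. ennreal \<bar>R N w * f (X w)\<bar> \<partial>Q) = (\<integral>\<^sup>+w. ennreal (R N w) * ennreal \<bar>f (X w)\<bar> \<partial>Q)"
    using R(2)[OF N] by (intro nn_integral_cong) (fastforce simp: abs_mult)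
  also have "\<dots> = (\<integral>\<^sup>+w. ennreal (\<pi> N (X w)) * ennreal \<bar>f (X w)\<bar> \<partial>Q)"
    using A.nn_transfer_X[of "\<lambda>x. ennreal \<bar>f x\<bar>"] f by simp
  also have "\<dots> = (\<integral>\<^sup>+w. ennreal (\<pi> N (X w) * \<bar>f (X w)\<bar>) \<partial>Q)"
  proof (intro nn_integral_cong_AE)
    show "AE w in Q. ennreal (\<pi> N (X w)) * ennreal \<bar>f (X w)\<bar> = ennreal (\<pi> N (X w) * \<bar>f (X w)\<bar>)"
      using overlap_AE[OF N] by eventually_elim (simp add: ennreal_mult)
  qed
  finally show ?thesis .
qed

text \<open>The weight uses the true \<open>\<pi>\<close>, although the estimator uses
  \<open>pihat\<close>: only then is the term exactly centred given the training data.\<close>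

definition balance1 :: "nat \<Rightarrow> nat set \<Rightarrow> (nat \<Rightarrow> 'p obs) \<Rightarrow> 'p obs \<Rightarrow> real" where
  "balance1 N T x z = (1 - obsR z / \<pi> N (obsX z)) * (mhat 1 N T x (obsX z) - \<mu> 1 (obsX z))"

text \<open>The residual is taken at the true \<open>m 1\<close> and not at \<open>\<mu> 1\<close>,
  so it is conditionally centred whatever the two weights are.\<close>

definition noise1 :: "nat \<Rightarrow> nat set \<Rightarrow> (nat \<Rightarrow> 'p obs) \<Rightarrow> 'p obs \<Rightarrow> real" where
  "noise1 N T x z = (obsR z / pihat N T x (obsX z) - obsR z / e N (obsX z)) * (obsY z - m 1 (obsX z))"

definition product1 :: "nat \<Rightarrow> nat set \<Rightarrow> (nat \<Rightarrow> 'p obs) \<Rightarrow> 'p obs \<Rightarrow> real" where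
  "product1 N T x z = (obsR z / pihat N T x (obsX z) - obsR z / e N (obsX z)) * (mhat 1 N T x (obsX z) - \<mu> 1 (obsX z))"

definition ps_drift :: "nat \<Rightarrow> nat set \<Rightarrow> (nat \<Rightarrow> 'p obs) \<Rightarrow> 'p obs \<Rightarrow> real" where
  "ps_drift N T x z = (obsR z / \<pi> N (obsX z) - obsR z / pihat N T x (obsX z)) * (\<mu> 1 (obsX z) - m 1 (obsX z))"

definition reg_drift :: "nat \<Rightarrow> nat set \<Rightarrow> (nat \<Rightarrow> 'p obs) \<Rightarrow> 'p obs \<Rightarrow> real" where
  "reg_drift N T x z = (obsR z / \<pi> N (obsX z) - obsR z / e N (obsX z)) * (mhat 1 N T x (obsX z) - m 1 (obsX z))"

text \<open>This linear part of arm 0 counts as an error term: its order N powr (-1/2) is below the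
  target rate.\<close>

definition centred0 :: "nat \<Rightarrow> nat set \<Rightarrow> (nat \<Rightarrow> 'p obs) \<Rightarrow> 'p obs \<Rightarrow> real" where
  "centred0 N T x z = m 0 (obsX z) - \<theta> 0"

text \<open>In contrast to \<open>noise1\<close> no limiting weight is subtracted: the weights of
  arm 0 are bounded, so the whole noise term is already negligible.\<close>

definition noise0 :: "nat \<Rightarrow> nat set \<Rightarrow> (nat \<Rightarrow> 'p obs) \<Rightarrow> 'p obs \<Rightarrow> real" where
  "noise0 N T x z = (1 - obsR z) / (1 - pihat N T x (obsX z)) * (obsY z - m 0 (obsX z))"

text \<open>The reference is \<open>m 0\<close>, where arm 1 uses \<open>\<mu> 1\<close>: in arm 0 a
  bounded second moment is enough, so the misspecification bias may remain inside.\<close>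

definition balance0 :: "nat \<Rightarrow> nat set \<Rightarrow> (nat \<Rightarrow> 'p obs) \<Rightarrow> 'p obs \<Rightarrow> real" where
  "balance0 N T x z = (1 - (1 - obsR z) / (1 - \<pi> N (obsX z))) * (mhat 0 N T x (obsX z) - m 0 (obsX z))"

definition ps_err0 :: "nat \<Rightarrow> nat set \<Rightarrow> (nat \<Rightarrow> 'p obs) \<Rightarrow> 'p obs \<Rightarrow> real" where
  "ps_err0 N T x z = (1 - obsR z) / (1 - e N (obsX z)) - (1 - obsR z) / (1 - pihat N T x (obsX z))"

definition ps_bias0 :: "nat \<Rightarrow> nat set \<Rightarrow> (nat \<Rightarrow> 'p obs) \<Rightarrow> 'p obs \<Rightarrow> real" where
  "ps_bias0 N T x z = (1 - obsR z) / (1 - \<pi> N (obsX z)) - (1 - obsR z) / (1 - e N (obsX z))"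

definition reg_err0 :: "nat \<Rightarrow> nat set \<Rightarrow> (nat \<Rightarrow> 'p obs) \<Rightarrow> 'p obs \<Rightarrow> real" where
  "reg_err0 N T x z = mhat 0 N T x (obsX z) - \<mu> 0 (obsX z)"

definition reg_bias0 :: "nat \<Rightarrow> nat set \<Rightarrow> (nat \<Rightarrow> 'p obs) \<Rightarrow> 'p obs \<Rightarrow> real" where
  "reg_bias0 N T x z = \<mu> 0 (obsX z) - m 0 (obsX z)"

lemma stat_measurable:
  assumes N: "N \<ge> 1"
  shows "measurable_statistic N (balance1 N)" "measurable_statistic N (noise1 N)" "measurable_statistic N (product1 N)"
    "measurable_statistic N (ps_drift N)" "measurable_statistic N (reg_drift N)" "measurable_statistic N (centred0 N)"
    "measurable_statistic N (noise0 N)" "measurable_statistic N (balance0 N)" "measurable_statistic N (ps_err0 N)"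
    "measurable_statistic N (ps_bias0 N)" "measurable_statistic N (reg_err0 N)" "measurable_statistic N (reg_bias0 N)"
proof -
  have est: "measurable_estimator N (mhat 0 N)" "measurable_estimator N (mhat 1 N)" "measurable_estimator N (pihat N)"
    using estimators N by auto
  note [measurable] = \<pi>[OF N] e[OF N]
  have X': "f \<in> borel_measurable borel \<Longrightarrow> measurable_statistic N (\<lambda>T x z :: 'p obs. f (obsX z))" for f
    by (rule measurable_statistic_fixed[OF measurable_compose[OF measurable_obs(3)]])
  have O': "measurable_statistic N (\<lambda>T x z :: 'p obs. obsR z)" "measurable_statistic N (\<lambda>T x z :: 'p obs. obsY z)"
    "measurable_statistic N (\<lambda>T x z :: 'p obs. t)" for t
    by (rule measurable_statistic_fixed; measurable)+
  note rules = measurable_statistic_arith O' X' measurable_statistic_estimator est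
  show "measurable_statistic N (balance1 N)" "measurable_statistic N (noise1 N)" "measurable_statistic N (product1 N)"
    "measurable_statistic N (ps_drift N)" "measurable_statistic N (reg_drift N)" "measurable_statistic N (centred0 N)"
    "measurable_statistic N (noise0 N)" "measurable_statistic N (balance0 N)" "measurable_statistic N (ps_err0 N)"
    "measurable_statistic N (ps_bias0 N)" "measurable_statistic N (reg_err0 N)" "measurable_statistic N (reg_bias0 N)"
    unfolding balance1_def[abs_def] noise1_def[abs_def] product1_def[abs_def] ps_drift_def[abs_def] reg_drift_def[abs_def]
      centred0_def[abs_def] noise0_def[abs_def] balance0_def[abs_def] ps_err0_def[abs_def] ps_bias0_def[abs_def]
      reg_err0_def[abs_def] reg_bias0_def[abs_def]
    by (intro rules m \<mu> \<pi>[OF N] e[OF N])+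
qed

lemma trained_simps:
  "trained balance1 N k w (Z N v) = (1 - R N v / \<pi> N (X v)) * (mh 1 N k w (X v) - \<mu> 1 (X v))"
  "trained noise1 N k w (Z N v) = (R N v / ph N k w (X v) - R N v / e N (X v)) * (R N v * Yp 1 v + (1 - R N v) * Yp 0 v - m 1 (X v))"
  "trained product1 N k w (Z N v) = (R N v / ph N k w (X v) - R N v / e N (X v)) * (mh 1 N k w (X v) - \<mu> 1 (X v))"
  "trained ps_drift N k w (Z N v) = (R N v / \<pi> N (X v) - R N v / ph N k w (X v)) * (\<mu> 1 (X v) - m 1 (X v))"
  "trained reg_drift N k w (Z N v) = (R N v / \<pi> N (X v) - R N v / e N (X v)) * (mh 1 N k w (X v) - m 1 (X v))"
  "trained centred0 N k w (Z N v) = m 0 (X v) - \<theta> 0"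
  "trained noise0 N k w (Z N v) = (1 - R N v) / (1 - ph N k w (X v)) * (R N v * Yp 1 v + (1 - R N v) * Yp 0 v - m 0 (X v))"
  "trained balance0 N k w (Z N v) = (1 - (1 - R N v) / (1 - \<pi> N (X v))) * (mh 0 N k w (X v) - m 0 (X v))"
  by (simp_all only: fold_stat_def balance1_def noise1_def product1_def ps_drift_def reg_drift_def centred0_def noise0_def
      balance0_def mh_eq ph_eq fold_fit_def obs_Z)

lemma arm0_trained_simps:
  "trained ps_err0 N k w (Z N v) = (1 - R N v) / (1 - e N (X v)) - (1 - R N v) / (1 - ph N k w (X v))"
  "trained ps_bias0 N k w (Z N v) = (1 - R N v) / (1 - \<pi> N (X v)) - (1 - R N v) / (1 - e N (X v))"
  "trained reg_err0 N k w (Z N v) = mh 0 N k w (X v) - \<mu> 0 (X v)"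
  "trained reg_bias0 N k w (Z N v) = \<mu> 0 (X v) - m 0 (X v)"
  by (simp_all only: fold_stat_def ps_err0_def ps_bias0_def reg_err0_def reg_bias0_def mh_eq ph_eq fold_fit_def obs_Z)

section \<open>Conditionally centred averages below the target rate\<close>

lemma littleop_errors:
  assumes k: "k \<in> {1..K}"
  shows "littleop M (\<lambda>N w. enn2ereal (e_err k N w)) (\<lambda>_. 1)"
    "littleop M (\<lambda>N w. enn2ereal (mu_err 0 k N w)) (\<lambda>_. 1)"
    "littleop M (\<lambda>N w. sup_err k N w) (\<lambda>_. 1)"
proof -
  have small: "\<forall>\<^sub>F N in sequentially. L * (r N)\<^sup>2 \<le> \<delta>"
    if "L > 0" "\<delta> > 0" "\<And>d::real. d > 0 \<Longrightarrow> \<forall>\<^sub>F N in sequentially. r N \<le> d" "\<And>N. N \<ge> 1 \<Longrightarrow> r N > 0"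
    for L \<delta> :: real and r
  proof -
    have "sqrt (\<delta> / L) > 0" using that by simp
    from that(3)[OF this] eventually_ge_at_top[of 1] show ?thesis
    proof eventually_elim
      case (elim N)
      have "(r N)\<^sup>2 \<le> (sqrt (\<delta> / L))\<^sup>2" using elim that(4)[OF elim(2)] by (intro power_mono) auto
      then show ?case using that by (simp add: field_simps)
    qed
  qed
  show "littleop M (\<lambda>N w. enn2ereal (e_err k N w)) (\<lambda>_. 1)"
  proof (rule littleop_bigOp[OF e_err_rate[OF k]])
    fix L \<delta> :: real assume "L > 0" "\<delta> > 0"
    then have "\<forall>\<^sub>F N in sequentially. L * (re N)\<^sup>2 \<le> \<delta>"
      by (rule small[OF _ _ eventually_rate_le(1) rate_pos(1)])
    then show "\<forall>\<^sub>F N in sequentially. \<forall>w\<in>space (M N). \<bar>enn2ereal (e_err k N w)\<bar> \<le> ereal (L * (re N)\<^sup>2) \<longrightarrow>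
        \<bar>enn2ereal (e_err k N w)\<bar> \<le> ereal (\<delta> * 1)"
      by eventually_elim (intro ballI impI, erule order_trans, simp)
  qed
  show "littleop M (\<lambda>N w. enn2ereal (mu_err 0 k N w)) (\<lambda>_. 1)"
  proof (rule littleop_bigOp[OF mu_err_rate[OF _ k]])
    fix L \<delta> :: real assume "L > 0" "\<delta> > 0"
    then have "\<forall>\<^sub>F N in sequentially. L * (r\<mu> 0 N)\<^sup>2 \<le> \<delta>"
      by (rule small[OF _ _ eventually_rate_le(2) rate_pos(2)])
    then show "\<forall>\<^sub>F N in sequentially. \<forall>w\<in>space (M N). \<bar>enn2ereal (mu_err 0 k N w)\<bar> \<le> ereal (L * (r\<mu> 0 N)\<^sup>2) \<longrightarrow>
        \<bar>enn2ereal (mu_err 0 k N w)\<bar> \<le> ereal (\<delta> * 1)"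
      by eventually_elim (intro ballI impI, erule order_trans, simp)
  qed simp
  show "littleop M (\<lambda>N w. sup_err k N w) (\<lambda>_. 1)"
  proof (rule littleop_bigOp[OF pihat[rule_format, OF k]])
    fix L \<delta> :: real assume Ld: "L > 0" "\<delta> > 0"
    then have "\<delta> / L > 0" by simp
    from eventually_rate_le(1)[OF this]
    show "\<forall>\<^sub>F N in sequentially. \<forall>w\<in>space (M N). \<bar>sup_err k N w\<bar> \<le> ereal (L * re N) \<longrightarrow> \<bar>sup_err k N w\<bar> \<le> ereal (\<delta> * 1)"
    proof eventually_elim
      case (elim N)
      then have "ereal (L * re N) \<le> ereal (\<delta> * 1)" using Ld by (simp add: field_simps)
      then show ?case by (intro ballI impI) (erule order_trans)
    qed
  qed
qed

text \<open>The conditional variance is at most twice the mean of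
  \<open>(mh - \<mu>)\<^sup>2 / \<pi>\<close>, which is small relative to 1/pbar by the weighted
  hypothesis on the regression estimator; \<open>\<delta>/2\<close> pays for the factor 2.\<close>

lemma balance1_rate: "real_littleop M (cross_avg balance1) (\<lambda>N. (real N * pbar N) powr (-1/2))"
proof (rule littleop_pieceI[where D = "\<lambda>\<delta>. \<delta>/2" and E = "\<lambda>_ _. True", OF stat_measurable(1) weighted_mu_err_rate])
  fix k N w and \<delta> :: real
  let ?W = "\<lambda>N w. \<integral>\<^sup>+v. ennreal ((mh 1 N k w (X v) - \<mu> 1 (X v))\<^sup>2 / \<pi> N (X v)) \<partial>Q"
  assume d: "\<delta> > 0" and N: "N \<ge> 1" and le: "\<bar>enn2ereal (?W N w)\<bar> \<le> ereal (\<delta>/2 * (1 / pbar N))"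
  interpret A: treatment_arm Q X "Yp 1" "R N" "\<pi> N" "m 1" "4 * s2" by (rule arm1[OF N])
  have W: "?W N w \<le> ennreal (\<delta> / 2 * (1 / pbar N))"
    using abs_enn2ereal_le_iff(1)[THEN iffD1, OF _ le] d pbar_pos[OF N] by simp
  have f: "(\<lambda>x. mh 1 N k w x - \<mu> 1 x) \<in> borel_measurable borel"
    using mh_measurable[OF N, of 1 k w] \<mu>(2) by (intro borel_measurable_diff) simp_all
  have pos: "AE w in Q. 0 < \<pi> N (X w)" using overlap_AE[OF N] by eventually_elim simp
  show "cond_mean balance1 N k w = 0"
    unfolding trained_simps using A.weight_error_mean[OF f pos] W by (simp add: order.strict_trans1[OF _ ennreal_less_top])
  have "cond_square balance1 N k w \<le> 2 * ?W N w"
    unfolding trained_simps by (rule A.weight_error_second_moment[OF f pos])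
  also have "\<dots> \<le> 2 * ennreal (\<delta> / 2 * (1 / pbar N))" using W by (rule mult_left_mono) simp
  also have "\<dots> = ennreal (\<delta> / pbar N)"
    using d pbar_pos[OF N] ennreal_mult[of 2 "\<delta> / 2 * (1 / pbar N)"] by simp
  finally show "cond_square balance1 N k w \<le> ennreal (\<delta> / pbar N)" .
qed simp_all

end

lemma le_ennreal_imp_finite: "x \<le> ennreal b \<Longrightarrow> x < \<infinity>"
  by (auto intro: order.strict_trans1)

lemma ratio_diff_mult: "(r / a - r / b) * d = r * ((1 / a - 1 / b) * d)" for r a b d :: real
  by (simp add: left_diff_distrib right_diff_distrib)

lemma power2_diff_le: "(a - b)\<^sup>2 \<le> 2 * a\<^sup>2 + 2 * b\<^sup>2" for a b :: real
  using zero_le_power2[of "a + b"] by (simp add: power2_diff power2_sum)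

context ate_setting
begin

lemma eventually_const_le_inverse_pbar:
  assumes "\<delta> > 0" "V \<ge> 0"
  shows "\<forall>\<^sub>F N in sequentially. V \<le> \<delta> / pbar N"
proof -
  \<comment> \<open>\<open>V + 1\<close> keeps the quotient positive when
    \<open>V = 0\<close>.\<close>
  have "\<delta> / (V + 1) > 0" using assms by simp
  from eventually_pbar_le[OF this] eventually_ge_at_top[of 1] show ?thesis
  proof eventually_elim
    case (elim N)
    have "V * pbar N \<le> (V + 1) * pbar N" using pbar_pos[OF elim(2)] by simp
    also have "\<dots> \<le> \<delta>" using elim(1) assms by (simp add: field_simps)
    finally show ?case using pbar_pos[OF elim(2)] by (simp add: pos_le_divide_eq)
  qed
qed

lemma eventually_C_pbar_le: "d > 0 \<Longrightarrow> \<forall>\<^sub>F N in sequentially. C * pbar N \<le> d"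
proof -
  assume "d > 0"
  then have "d / C > 0" using overlap(4) by simp
  from eventually_pbar_le[OF this] show ?thesis
    by eventually_elim (use overlap(4) in \<open>simp add: field_simps\<close>)
qed

lemma noise1_rate: "real_littleop M (cross_avg noise1) (\<lambda>N. (real N * pbar N) powr (-1/2))"
proof (rule littleop_pieceI[where D = "\<lambda>\<delta>. \<delta> * c\<^sup>2 / (4 * s2 * C)" and E = "\<lambda>_ _. True", OF stat_measurable(2) littleop_errors(1)])
  fix k N w and \<delta> :: real
  \<comment> \<open>Solves \<open>4 * s2 * (C / (c\<^sup>2 * pbar N)) * \<delta>' = \<delta> / pbar
    N\<close>: the variance bound \<open>4 * s2\<close> times the overlap constant of
    \<open>\<pi> / e\<^sup>2\<close> times the weight error.\<close>
  define \<delta>' where "\<delta>' = \<delta> * c\<^sup>2 / (4 * s2 * C)"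
  assume d: "\<delta> > 0" and N: "N \<ge> 1" and le: "\<bar>enn2ereal (e_err k N w)\<bar> \<le> ereal (\<delta> * c\<^sup>2 / (4 * s2 * C) * 1)"
  have d': "\<delta>' > 0" using d s2 overlap(3,4) by (simp add: \<delta>'_def)
  interpret A: treatment_arm Q X "Yp 1" "R N" "\<pi> N" "m 1" "4 * s2" by (rule arm1[OF N])
  note [measurable] = ph_measurable[OF N, of k w] e[OF N]
  define h where "h = (\<lambda>x. 1 / ph N k w x - 1 / e N x)"
  have h[measurable]: "h \<in> borel_measurable borel" unfolding h_def by measurable
  have E: "e_err k N w \<le> ennreal \<delta>'"
    using abs_enn2ereal_le_iff(1)[THEN iffD1, OF _ le[folded \<delta>'_def]] d' by simp
  have tr: "trained noise1 N k w (Z N v) = R N v * h (X v) * (Yp 1 v - m 1 (X v))" if "v \<in> space Q" for v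
    using R(2)[OF N that] unfolding trained_simps h_def by auto
  have B: "(\<integral>\<^sup>+v. ennreal (\<pi> N (X v) * (h (X v))\<^sup>2) \<partial>Q) \<le> ennreal (C / (c\<^sup>2 * pbar N) * \<delta>')"
  proof (rule nn_integral_le_cmult[OF _ _ _ E])
    show "AE v in Q. \<pi> N (X v) * (h (X v))\<^sup>2 \<le> C / (c\<^sup>2 * pbar N) * (1 - e N (X v) / ph N k w (X v))\<^sup>2"
      using overlap_AE[OF N]
    proof eventually_elim
      case (elim v)
      let ?e = "e N (X v)" and ?p = "\<pi> N (X v)" and ?q = "ph N k w (X v)"
      have cp: "0 < c * pbar N" using overlap(3) pbar_pos[OF N] by simp
      \<comment> \<open>The relative error \<open>1 - e / ph\<close> appears after factoring out
        \<open>1 / e\<close>. The identity also holds where the estimate is 0, since both quotients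
        by it are then 0.\<close>
      have "h (X v) = - ((1 - ?e / ?q) / ?e)"
        unfolding h_def using elim by (simp add: diff_divide_distrib)
      then have "?p * (h (X v))\<^sup>2 = (?p / ?e\<^sup>2) * (1 - ?e / ?q)\<^sup>2"
        by (simp add: power_divide)
      also have "\<dots> \<le> (C * pbar N / (c * pbar N)\<^sup>2) * (1 - ?e / ?q)\<^sup>2"
        using elim cp by (intro mult_right_mono frac_le power_mono) auto
      also have "C * pbar N / (c * pbar N)\<^sup>2 = C / (c\<^sup>2 * pbar N)"
        using pbar_pos[OF N] by (simp add: power2_eq_square)
      finally show ?case .
    qed
  qed (use overlap(4) pbar_pos[OF N] in \<open>auto simp: less_imp_le\<close>)
  have "cond_mean noise1 N k w = (\<integral>v. R N v * h (X v) * (Yp 1 v - m 1 (X v)) \<partial>Q)"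
    by (intro Bochner_Integration.integral_cong refl tr)
  also have "\<dots> = 0"
    by (rule A.treated_residual_mean[OF h le_ennreal_imp_finite[OF B]])
  finally show "cond_mean noise1 N k w = 0" .
  have "cond_square noise1 N k w =
      (\<integral>\<^sup>+v. ennreal ((R N v * h (X v) * (Yp 1 v - m 1 (X v)))\<^sup>2) \<partial>Q)"
    by (intro nn_integral_cong) (simp add: tr)
  also have "\<dots> \<le> ennreal (4 * s2) * (\<integral>\<^sup>+v. ennreal (\<pi> N (X v) * (h (X v))\<^sup>2) \<partial>Q)"
    by (rule A.treated_residual_second_moment[OF h])
  also have "\<dots> \<le> ennreal (4 * s2) * ennreal (C / (c\<^sup>2 * pbar N) * \<delta>')" using B by (rule mult_left_mono) simp
  also have "\<dots> = ennreal (4 * s2 * (C / (c\<^sup>2 * pbar N) * \<delta>'))"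
    using s2 by (intro ennreal_mult'[symmetric]) simp
  also have "4 * s2 * (C / (c\<^sup>2 * pbar N) * \<delta>') = \<delta> / pbar N"
    using s2 overlap(3,4) pbar_pos[OF N] by (simp add: \<delta>'_def)
  finally show "cond_square noise1 N k w \<le> ennreal (\<delta> / pbar N)" .
qed (use s2 overlap(3,4) in simp_all)

lemma m_integrable: "integrable Q (\<lambda>w. m 0 (X w))" "integrable Q (\<lambda>w. m 1 (X w))"
  and m_mean: "(\<integral>w. m 0 (X w) \<partial>Q) = \<theta> 0" "(\<integral>w. m 1 (X w) \<partial>Q) = \<theta> 1"
proof -
  interpret S: finite_measure_subalgebra Q "sigma_of Q X"
    using finite_measure_subalgebra_sigma_of[OF prob_Q X] .
  have *: "integrable Q (\<lambda>w. m r (X w)) \<and> (\<integral>w. m r (X w) \<partial>Q) = \<theta> r" if r: "is_cond_mean Q X (Yp r) (m r)" for r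
  proof -
    have Yi: "integrable Q (Yp r)" and mm: "m r \<in> borel_measurable borel"
      and rce: "AE w in Q. real_cond_exp Q (sigma_of Q X) (Yp r) w = m r (X w)"
      using r by (auto simp: is_cond_mean_def)
    have i: "integrable Q (\<lambda>w. real_cond_exp Q (sigma_of Q X) (Yp r) w)" by (rule S.real_cond_exp_int(1)[OF Yi])
    have mX: "(\<lambda>w. m r (X w)) \<in> borel_measurable Q" using mm by measurable
    have "(\<integral>w. m r (X w) \<partial>Q) = (\<integral>w. real_cond_exp Q (sigma_of Q X) (Yp r) w \<partial>Q)"
      using rce mX by (intro integral_cong_AE) (auto elim!: eventually_mono)
    then show ?thesis
      using integrable_cong_AE_imp[OF i mX rce] S.real_cond_exp_int(2)[OF Yi] by (simp add: \<theta>_eq)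
  qed
  show "integrable Q (\<lambda>w. m 0 (X w))" "integrable Q (\<lambda>w. m 1 (X w))"
    "(\<integral>w. m 0 (X w) \<partial>Q) = \<theta> 0" "(\<integral>w. m 1 (X w) \<partial>Q) = \<theta> 1"
    using *[OF cm(1)] *[OF cm(2)] by auto
qed

text \<open>No estimator enters, so the control variable is zero and all the work is in
  \<open>E\<close>: the fixed variance of \<open>m 0 (X w)\<close> eventually drops below
  \<open>\<delta> / pbar N\<close>.\<close>

lemma centred0_rate: "real_littleop M (cross_avg centred0) (\<lambda>N. (real N * pbar N) powr (-1/2))"
proof (rule littleop_pieceI[where W = "\<lambda>_ _ _. 0" and q = "\<lambda>_. 1" and D = "\<lambda>_. 1" and
      E = "\<lambda>\<delta> N. (\<integral>w. (m 0 (X w) - \<theta> 0)\<^sup>2 \<partial>Q) \<le> \<delta> / pbar N", OF stat_measurable(6)])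
  have i: "integrable Q (\<lambda>w. (m 0 (X w) - \<theta> 0)\<^sup>2)" using m0 m_mean by simp
  show "littleop M (\<lambda>_ _. 0) (\<lambda>_. 1)" by (rule littleop_zero) simp
  fix k N w and \<delta> :: real assume "(\<integral>w. (m 0 (X w) - \<theta> 0)\<^sup>2 \<partial>Q) \<le> \<delta> / pbar N"
  then show "cond_mean centred0 N k w = 0" "cond_square centred0 N k w \<le> ennreal (\<delta> / pbar N)"
    unfolding trained_simps nn_integral_eq_integral[OF i AE_I2[OF zero_le_power2]]
    using m_integrable(1) m_mean(1) by (simp_all add: prob_space ennreal_leI)
qed (simp_all add: eventually_const_le_inverse_pbar)

text \<open>Once \<open>e\<close> is below 1/4 and the estimate within 1/4 of it, the weight
  \<open>1 / (1 - ph)\<close> is at most 2 and its square at most 4; with the variance bound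
  \<open>4 * s2\<close> this gives \<open>16 * s2\<close>.\<close>

lemma noise0_rate: "real_littleop M (cross_avg noise0) (\<lambda>N. (real N * pbar N) powr (-1/2))"
proof (rule littleop_pieceI[where D = "\<lambda>_. 1/4" and E = "\<lambda>\<delta> N. 16 * s2 \<le> \<delta> / pbar N \<and> C * pbar N \<le> 1/4",
      OF stat_measurable(7) littleop_errors(3)])
  show "\<forall>\<^sub>F N in sequentially. 16 * s2 \<le> \<delta> / pbar N \<and> C * pbar N \<le> 1/4" if "\<delta> > 0" for \<delta>
    using that s2 by (intro eventually_conj eventually_const_le_inverse_pbar eventually_C_pbar_le) simp_all
  fix k N w and \<delta> :: real
  assume N: "N \<ge> 1" and E: "16 * s2 \<le> \<delta> / pbar N \<and> C * pbar N \<le> 1/4" and le: "\<bar>sup_err k N w\<bar> \<le> ereal (1/4 * 1)"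
  interpret A: treatment_arm Q X "Yp 0" "\<lambda>w. 1 - R N w" "\<lambda>x. 1 - \<pi> N x" "m 0" "4 * s2" by (rule arm0[OF N])
  note [measurable] = ph_measurable[OF N, of k w]
  define h where "h = (\<lambda>x. 1 / (1 - ph N k w x))"
  have h[measurable]: "h \<in> borel_measurable borel" unfolding h_def by measurable
  have tr: "trained noise0 N k w (Z N v) = (1 - R N v) * h (X v) * (Yp 0 v - m 0 (X v))" if "v \<in> space Q" for v
    using R(2)[OF N that] unfolding trained_simps h_def by auto
  have "(\<integral>\<^sup>+v. ennreal ((1 - \<pi> N (X v)) * (h (X v))\<^sup>2) \<partial>Q) \<le> (\<integral>\<^sup>+v. ennreal 4 \<partial>Q)"
  proof (intro nn_integral_mono_AE)
    show "AE v in Q. ennreal ((1 - \<pi> N (X v)) * (h (X v))\<^sup>2) \<le> ennreal 4"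
      using sup_err_bound[OF N le] overlap_AE[OF N]
    proof eventually_elim
      case (elim v)
      have "\<bar>ph N k w (X v) - e N (X v)\<bar> \<le> 1/4"
        using elim(1) pbar_pos[OF N] by simp
      moreover have "e N (X v) \<le> 1/4" using elim(2) E by simp
      ultimately have q: "1/2 \<le> 1 - ph N k w (X v)" by linarith
      have "h (X v) \<le> 2" "0 \<le> h (X v)" using q by (auto simp: h_def divide_simps)
      then have "(h (X v))\<^sup>2 \<le> 2\<^sup>2" by (intro power_mono)
      moreover have "1 - \<pi> N (X v) \<le> 1" using elim(2) by simp
      ultimately have "(1 - \<pi> N (X v)) * (h (X v))\<^sup>2 \<le> 1 * 2\<^sup>2"
        by (intro mult_mono) auto
      then show ?case by (intro ennreal_leI) simp
    qed
  qed
  then have B: "(\<integral>\<^sup>+v. ennreal ((1 - \<pi> N (X v)) * (h (X v))\<^sup>2) \<partial>Q) \<le> ennreal 4"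
    by (simp add: emeasure_space_1)
  have "cond_mean noise0 N k w = (\<integral>v. (1 - R N v) * h (X v) * (Yp 0 v - m 0 (X v)) \<partial>Q)"
    by (intro Bochner_Integration.integral_cong refl tr)
  also have "\<dots> = 0"
    by (rule A.treated_residual_mean[OF h le_ennreal_imp_finite[OF B]])
  finally show "cond_mean noise0 N k w = 0" .
  have "cond_square noise0 N k w =
      (\<integral>\<^sup>+v. ennreal (((1 - R N v) * h (X v) * (Yp 0 v - m 0 (X v)))\<^sup>2) \<partial>Q)"
    by (intro nn_integral_cong) (simp add: tr)
  also have "\<dots> \<le> ennreal (4 * s2) * (\<integral>\<^sup>+v. ennreal ((1 - \<pi> N (X v)) * (h (X v))\<^sup>2) \<partial>Q)"
    by (rule A.treated_residual_second_moment[OF h])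
  also have "\<dots> \<le> ennreal (4 * s2) * ennreal 4" using B by (rule mult_left_mono) simp
  also have "\<dots> = ennreal (4 * s2 * 4)" using s2 by (intro ennreal_mult'[symmetric]) simp
  also have "\<dots> \<le> ennreal (\<delta> / pbar N)" using E by (intro ennreal_leI) simp
  finally show "cond_square noise0 N k w \<le> ennreal (\<delta> / pbar N)" .
qed simp_all

text \<open>Origin of \<open>8 * (1 + s2)\<close>: the square of \<open>mh - m\<close> costs
  \<open>2 * (u\<^sup>2 + s2)\<close> with \<open>u = mh - \<mu>\<close> of second moment at most 1,
  division by \<open>1 - \<pi> \<ge> 1/2\<close> costs another 2, and the second moment of the
  weight error a last 2.\<close>

lemma balance0_rate: "real_littleop M (cross_avg balance0) (\<lambda>N. (real N * pbar N) powr (-1/2))"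
proof (rule littleop_pieceI[where D = "\<lambda>_. 1" and E = "\<lambda>\<delta> N. 8 * (1 + s2) \<le> \<delta> / pbar N \<and> C * pbar N \<le> 1/2",
      OF stat_measurable(8) littleop_errors(2)])
  show "\<forall>\<^sub>F N in sequentially. 8 * (1 + s2) \<le> \<delta> / pbar N \<and> C * pbar N \<le> 1/2" if "\<delta> > 0" for \<delta>
    using that s2 by (intro eventually_conj eventually_const_le_inverse_pbar eventually_C_pbar_le) simp_all
  fix k N w and \<delta> :: real
  assume N: "N \<ge> 1" and ev: "8 * (1 + s2) \<le> \<delta> / pbar N \<and> C * pbar N \<le> 1/2" and
    le: "\<bar>enn2ereal (mu_err 0 k N w)\<bar> \<le> ereal (1 * 1)"
  interpret A: treatment_arm Q X "Yp 0" "\<lambda>w. 1 - R N w" "\<lambda>x. 1 - \<pi> N x" "m 0" "4 * s2" by (rule arm0[OF N])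
  have mhm[measurable]: "mh 0 N k w \<in> borel_measurable borel" by (rule mh_measurable[OF N]) simp
  let ?g = "\<lambda>v. (mh 0 N k w (X v) - \<mu> 0 (X v))\<^sup>2"
  have E: "mu_err 0 k N w \<le> ennreal 1"
    using abs_enn2ereal_le_iff(1)[THEN iffD1, OF _ le] by simp
  have f[measurable]: "(\<lambda>x. mh 0 N k w x - m 0 x) \<in> borel_measurable borel" by measurable
  have pos: "AE v in Q. 1/2 \<le> 1 - \<pi> N (X v)"
    using overlap_AE[OF N] by eventually_elim (use conjunct2[OF ev] in linarith)
  then have pos0: "AE v in Q. 0 < 1 - \<pi> N (X v)" by eventually_elim linarith
  have "(\<integral>\<^sup>+v. ennreal (?g v + s2) \<partial>Q) = (\<integral>\<^sup>+v. ennreal (?g v) + ennreal s2 \<partial>Q)"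
    using s2 by (intro nn_integral_cong) simp
  also have "\<dots> = mu_err 0 k N w + ennreal s2"
    by (subst nn_integral_add) (auto simp: emeasure_space_1)
  also have "\<dots> \<le> ennreal 1 + ennreal s2" using E by (rule add_right_mono)
  also have "\<dots> = ennreal (1 + s2)" using s2 by simp
  finally have G: "(\<integral>\<^sup>+v. ennreal (?g v + s2) \<partial>Q) \<le> ennreal (1 + s2)" .
  have B: "(\<integral>\<^sup>+v. ennreal ((mh 0 N k w (X v) - m 0 (X v))\<^sup>2 / (1 - \<pi> N (X v))) \<partial>Q) \<le> ennreal (4 * (1 + s2))"
  proof (rule nn_integral_le_cmult[OF _ _ _ G])
    show "AE v in Q. (mh 0 N k w (X v) - m 0 (X v))\<^sup>2 / (1 - \<pi> N (X v)) \<le> 4 * (?g v + s2)"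
      using pos bias(1)
    proof eventually_elim
      case (elim v)
      let ?u = "mh 0 N k w (X v) - \<mu> 0 (X v)" and ?v = "m 0 (X v) - \<mu> 0 (X v)"
      have "?v\<^sup>2 \<le> (sqrt s2)\<^sup>2" using elim(2) s2 by (subst abs_le_square_iff[symmetric]) simp
      then have v: "?v\<^sup>2 \<le> s2" using s2 by simp
      have "(mh 0 N k w (X v) - m 0 (X v))\<^sup>2 = (?u - ?v)\<^sup>2" by simp
      also have "\<dots> \<le> 2 * ?u\<^sup>2 + 2 * ?v\<^sup>2" by (rule power2_diff_le)
      finally have le2: "(mh 0 N k w (X v) - m 0 (X v))\<^sup>2 \<le> 2 * ?u\<^sup>2 + 2 * s2" using v by linarith
      have "(mh 0 N k w (X v) - m 0 (X v))\<^sup>2 / (1 - \<pi> N (X v)) \<le> (2 * ?u\<^sup>2 + 2 * s2) / (1/2)"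
        using le2 elim(1) s2 by (intro frac_le) auto
      then show ?case by simp
    qed
  qed simp_all
  show "cond_mean balance0 N k w = 0"
    unfolding trained_simps by (rule A.weight_error_mean[OF f pos0 le_ennreal_imp_finite[OF B]])
  have "cond_square balance0 N k w \<le>
      2 * (\<integral>\<^sup>+v. ennreal ((mh 0 N k w (X v) - m 0 (X v))\<^sup>2 / (1 - \<pi> N (X v))) \<partial>Q)"
    unfolding trained_simps by (rule A.weight_error_second_moment[OF f pos0])
  also have "\<dots> \<le> ennreal 2 * ennreal (4 * (1 + s2))" using B by (simp add: mult_left_mono)
  also have "\<dots> = ennreal (2 * (4 * (1 + s2)))" by (intro ennreal_mult'[symmetric]) simp
  also have "\<dots> \<le> ennreal (\<delta> / pbar N)" using ev by (intro ennreal_leI) simp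
  finally show "cond_square balance0 N k w \<le> ennreal (\<delta> / pbar N)" .
qed simp_all

section \<open>Arm 1: the product of the nuisance errors, and the two forms of the drift\<close>

lemma product1_rate: "real_bigOp M (cross_avg product1) (\<lambda>N. re N * r\<mu> 1 N)"
proof (rule bigOp_pieceI[where B = "\<lambda>L. C / c * L" and E = "\<lambda>_ _. True",
      OF stat_measurable(3) _ e_err_rate mu_err_rate])
  show "0 < re N * r\<mu> 1 N" if "N \<ge> 1" for N using rate_pos[OF that] by simp
  fix k N w and L :: real assume L: "L > 0" and N: "N \<ge> 1" and le1: "\<bar>enn2ereal (e_err k N w)\<bar> \<le> ereal (L * (re N)\<^sup>2)"
    and le2: "\<bar>enn2ereal (mu_err 1 k N w)\<bar> \<le> ereal (L * (r\<mu> 1 N)\<^sup>2)"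
  have mhm[measurable]: "mh 1 N k w \<in> borel_measurable borel" by (rule mh_measurable[OF N]) simp
  note [measurable] = ph_measurable[OF N, of k w] e[OF N] \<mu>(2)
  have E: "e_err k N w \<le> ennreal (L * (re N)\<^sup>2)" "mu_err 1 k N w \<le> ennreal (L * (r\<mu> 1 N)\<^sup>2)"
    using abs_enn2ereal_le_iff(1)[THEN iffD1, OF _ le1] abs_enn2ereal_le_iff(1)[THEN iffD1, OF _ le2] L by simp_all
  let ?u = "\<lambda>v. 1 - e N (X v) / ph N k w (X v)" and ?v = "\<lambda>v. mh 1 N k w (X v) - \<mu> 1 (X v)"
  let ?f = "\<lambda>x. (1 / ph N k w x - 1 / e N x) * (mh 1 N k w x - \<mu> 1 x)"
  have um: "?u \<in> borel_measurable Q" and vm: "?v \<in> borel_measurable Q" by measurable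
  have uv: "(\<lambda>v. \<bar>?u v * ?v v\<bar>) \<in> borel_measurable Q" by measurable
  have P: "(\<integral>\<^sup>+v. ennreal \<bar>?u v * ?v v\<bar> \<partial>Q) \<le> ennreal (L * (re N * r\<mu> 1 N))"
    using L rate_pos[OF N] by (intro nn_integral_product_le[OF um vm _ _ _ E]) auto
  have "cond_abs product1 N k w = (\<integral>\<^sup>+v. ennreal \<bar>R N v * ?f (X v)\<bar> \<partial>Q)"
    unfolding trained_simps by (intro nn_integral_cong arg_cong[where f = "\<lambda>x. ennreal \<bar>x\<bar>"] ratio_diff_mult)
  also have "\<dots> = (\<integral>\<^sup>+v. ennreal (\<pi> N (X v) * \<bar>?f (X v)\<bar>) \<partial>Q)"
    by (rule treated_abs[OF N]) measurable
  also have "\<dots> \<le> ennreal (C / c * (L * (re N * r\<mu> 1 N)))"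
  proof (rule nn_integral_le_cmult[OF uv _ _ P])
    show "AE v in Q. \<pi> N (X v) * \<bar>?f (X v)\<bar> \<le> C / c * \<bar>?u v * ?v v\<bar>"
      using overlap_AE[OF N]
    proof eventually_elim
      case (elim v)
      let ?e = "e N (X v)" and ?p = "\<pi> N (X v)" and ?q = "ph N k w (X v)"
      have cp: "0 < c * pbar N" using overlap(3) pbar_pos[OF N] by simp
      \<comment> \<open>The \<open>\<pi>\<close> that has replaced \<open>R\<close> cancels
        \<open>1 / e\<close> up to the factor \<open>C / c\<close>, leaving the product of two L2
        errors to which Cauchy-Schwarz has been applied. The identity is also valid at
        \<open>?q = 0\<close>.\<close>
      have "1 / ?q - 1 / ?e = - (?u v / ?e)" using elim by (simp add: diff_divide_distrib)
      then have "?p * \<bar>?f (X v)\<bar> = (?p / ?e) * \<bar>?u v * ?v v\<bar>"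
        using elim by (simp add: abs_mult)
      also have "\<dots> \<le> (C * pbar N / (c * pbar N)) * \<bar>?u v * ?v v\<bar>"
        using elim cp by (intro mult_right_mono frac_le) auto
      finally show ?case using pbar_pos[OF N] by simp
    qed
  qed (use overlap(3,4) in simp)
  finally show "cond_abs product1 N k w \<le> ennreal (C / c * L * (re N * r\<mu> 1 N))"
    by (simp add: mult.assoc)
qed (use rate_pos overlap(3,4) in auto)

text \<open>With \<open>e = \<pi>\<close>, the factor \<open>\<pi> * (1 / \<pi> - 1 / ph)\<close> is
  the relative error \<open>1 - e / ph\<close>, and the bias factor is at most
  \<open>sqrt s2\<close>. Passing from L2 to L1 turns \<open>L\<close> into
  \<open>L + 1\<close>.\<close>

lemma ps_drift_rate:
  assumes ok: "\<And>N. N \<ge> 1 \<Longrightarrow> AE x in PX. e N x = \<pi> N x"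
  shows "real_bigOp M (cross_avg ps_drift) re"
proof (rule bigOp_pieceI[where B = "\<lambda>L. sqrt s2 * (L + 1)" and E = "\<lambda>_ _. True",
      OF stat_measurable(4) rate_pos(1) e_err_rate e_err_rate])
  fix k N w and L :: real assume L: "L > 0" and N: "N \<ge> 1" and le: "\<bar>enn2ereal (e_err k N w)\<bar> \<le> ereal (L * (re N)\<^sup>2)"
  note [measurable] = ph_measurable[OF N, of k w] e[OF N] \<pi>[OF N] \<mu>(2) m(2)
  have E: "e_err k N w \<le> ennreal (L * (re N)\<^sup>2)"
    using abs_enn2ereal_le_iff(1)[THEN iffD1, OF _ le] L by simp
  let ?u = "\<lambda>v. 1 - e N (X v) / ph N k w (X v)"
  let ?f = "\<lambda>x. (1 / \<pi> N x - 1 / ph N k w x) * (\<mu> 1 x - m 1 x)"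
  have u: "?u \<in> borel_measurable Q" by measurable
  have P: "(\<integral>\<^sup>+v. ennreal \<bar>?u v\<bar> \<partial>Q) \<le> ennreal ((L + 1) * re N)"
    using L rate_pos(1)[OF N] by (intro nn_integral_abs_le[OF u _ _ E]) auto
  have okX: "AE v in Q. e N (X v) = \<pi> N (X v)"
    using AE_distrD[OF X ok[OF N, unfolded PX_eq]] .
  have "cond_abs ps_drift N k w = (\<integral>\<^sup>+v. ennreal \<bar>R N v * ?f (X v)\<bar> \<partial>Q)"
    unfolding trained_simps by (intro nn_integral_cong arg_cong[where f = "\<lambda>x. ennreal \<bar>x\<bar>"] ratio_diff_mult)
  also have "\<dots> = (\<integral>\<^sup>+v. ennreal (\<pi> N (X v) * \<bar>?f (X v)\<bar>) \<partial>Q)"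
    by (rule treated_abs[OF N]) measurable
  also have "\<dots> \<le> ennreal (sqrt s2 * ((L + 1) * re N))"
  proof (rule nn_integral_le_cmult[OF borel_measurable_abs[OF u] _ _ P])
    show "AE v in Q. \<pi> N (X v) * \<bar>?f (X v)\<bar> \<le> sqrt s2 * \<bar>?u v\<bar>"
      using overlap_AE[OF N] okX bias(2)
    proof eventually_elim
      case (elim v)
      let ?p = "\<pi> N (X v)" and ?q = "ph N k w (X v)"
      have "1 / ?p - 1 / ?q = ?u v / ?p" using elim by (simp add: diff_divide_distrib)
      then have "?p * \<bar>?f (X v)\<bar> = \<bar>m 1 (X v) - \<mu> 1 (X v)\<bar> * \<bar>?u v\<bar>"
        using elim by (simp add: abs_mult abs_minus_commute)
      also have "\<dots> \<le> sqrt s2 * \<bar>?u v\<bar>" using elim by (intro mult_right_mono) auto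
      finally show ?case .
    qed
  qed (use s2 in simp)
  finally show "cond_abs ps_drift N k w \<le> ennreal (sqrt s2 * (L + 1) * re N)"
    by (simp add: mult.assoc)
qed (use rate_pos s2 in auto)

text \<open>With \<open>\<mu> 1 = m 1\<close> the regression factor is the error that has a rate.
  The weight factor becomes \<open>1 - \<pi> / e\<close>, which overlap bounds by
  \<open>1 + C / c\<close> but which need not vanish asymptotically.\<close>

lemma reg_drift_rate:
  assumes ok: "AE x in PX. \<mu> 1 x = m 1 x"
  shows "real_bigOp M (cross_avg reg_drift) (r\<mu> 1)"
proof (rule bigOp_pieceI[where B = "\<lambda>L. (1 + C / c) * (L + 1)" and E = "\<lambda>_ _. True",
      OF stat_measurable(5) rate_pos(3) mu_err_rate mu_err_rate])
  have Cc: "C / c > 0" using overlap(3,4) by simp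
  fix k N w and L :: real assume L: "L > 0" and N: "N \<ge> 1" and le: "\<bar>enn2ereal (mu_err 1 k N w)\<bar> \<le> ereal (L * (r\<mu> 1 N)\<^sup>2)"
  have mhm[measurable]: "mh 1 N k w \<in> borel_measurable borel" by (rule mh_measurable[OF N]) simp
  note [measurable] = e[OF N] \<pi>[OF N] \<mu>(2) m(2)
  have E: "mu_err 1 k N w \<le> ennreal (L * (r\<mu> 1 N)\<^sup>2)"
    using abs_enn2ereal_le_iff(1)[THEN iffD1, OF _ le] L by simp
  let ?u = "\<lambda>v. mh 1 N k w (X v) - \<mu> 1 (X v)"
  let ?f = "\<lambda>x. (1 / \<pi> N x - 1 / e N x) * (mh 1 N k w x - m 1 x)"
  have u: "?u \<in> borel_measurable Q" by measurable
  have P: "(\<integral>\<^sup>+v. ennreal \<bar>?u v\<bar> \<partial>Q) \<le> ennreal ((L + 1) * r\<mu> 1 N)"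
    using L rate_pos(3)[OF N] by (intro nn_integral_abs_le[OF u _ _ E]) auto
  have okX: "AE v in Q. \<mu> 1 (X v) = m 1 (X v)"
    using AE_distrD[OF X ok[unfolded PX_eq]] .
  have "cond_abs reg_drift N k w = (\<integral>\<^sup>+v. ennreal \<bar>R N v * ?f (X v)\<bar> \<partial>Q)"
    unfolding trained_simps by (intro nn_integral_cong arg_cong[where f = "\<lambda>x. ennreal \<bar>x\<bar>"] ratio_diff_mult)
  also have "\<dots> = (\<integral>\<^sup>+v. ennreal (\<pi> N (X v) * \<bar>?f (X v)\<bar>) \<partial>Q)"
    by (rule treated_abs[OF N]) measurable
  also have "\<dots> \<le> ennreal ((1 + C / c) * ((L + 1) * r\<mu> 1 N))"
  proof (rule nn_integral_le_cmult[OF borel_measurable_abs[OF u] _ _ P])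
    show "AE v in Q. \<pi> N (X v) * \<bar>?f (X v)\<bar> \<le> (1 + C / c) * \<bar>?u v\<bar>"
      using overlap_AE[OF N] okX
    proof eventually_elim
      case (elim v)
      let ?p = "\<pi> N (X v)" and ?e = "e N (X v)"
      have cp: "0 < c * pbar N" using overlap(3) pbar_pos[OF N] by simp
      have "?p / ?e \<le> C * pbar N / (c * pbar N)" using elim cp by (intro frac_le) auto
      then have pe: "?p / ?e \<le> C / c" using pbar_pos[OF N] by simp
      have "1 / ?p - 1 / ?e = (1 - ?p / ?e) / ?p" using elim by (simp add: diff_divide_distrib)
      then have "?p * \<bar>?f (X v)\<bar> = \<bar>1 - ?p / ?e\<bar> * \<bar>?u v\<bar>"
        using elim by (simp add: abs_mult)
      also have "\<bar>1 - ?p / ?e\<bar> \<le> 1 + ?p / ?e" using elim by (simp add: abs_if)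
      also have "1 + ?p / ?e \<le> 1 + C / c" using pe by simp
      finally show ?case by (simp add: mult_right_mono)
    qed
  qed (use Cc in simp)
  finally show "cond_abs reg_drift N k w \<le> ennreal ((1 + C / c) * (L + 1) * r\<mu> 1 N)"
    by (simp add: mult.assoc)
qed (use rate_pos overlap(3,4) in \<open>auto intro!: mult_pos_pos add_pos_pos\<close>)

section \<open>Arm 0: errors of the bounded weights and their products with regression
  errors\<close>

lemma ps_err0_bound:
  assumes N: "N \<ge> 1" and Cp: "C * pbar N \<le> 1/4" and L: "L * re N \<le> 1/4" and le: "\<bar>sup_err k N w\<bar> \<le> ereal (L * re N)"
  shows "AE v in Q. \<bar>trained ps_err0 N k w (Z N v)\<bar> \<le> 4 * L * (pbar N * re N)"
  unfolding arm0_trained_simps using sup_err_bound[OF N le] overlap_AE[OF N] AE_space[of Q]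
proof eventually_elim
  case (elim v)
  let ?e = "e N (X v)" and ?q = "ph N k w (X v)"
  \<comment> \<open>With \<open>e\<close> below 1/4 and the estimate within 1/4 of it, both
    complements are at least 1/2, where the reciprocal has Lipschitz constant 4. The sup error is
    relative to pbar, hence the extra factor \<open>pbar N\<close>.\<close>
  have "L * re N * pbar N \<le> 1/4 * 1" using L pbar_pos[OF N] by (intro mult_mono) auto
  then have "1/2 \<le> 1 - ?e" "1/2 \<le> 1 - ?q" using elim Cp by linarith+
  from abs_diff_inverse_le[OF this] have "\<bar>1 / (1 - ?e) - 1 / (1 - ?q)\<bar> \<le> 4 * \<bar>?e - ?q\<bar>" by simp
  also have "\<dots> \<le> 4 * (L * re N * pbar N)" using elim(1) by (simp add: abs_minus_commute)
  finally show ?case using R(2)[OF N elim(3)] elim(1) by (auto simp: mult_ac)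
qed

lemma ps_bias0_bound:
  assumes N: "N \<ge> 1" and Cp: "C * pbar N \<le> 1/4"
  shows "AE v in Q. \<bar>trained ps_bias0 N k w (Z N v)\<bar> \<le> 4 * C * pbar N"
  unfolding arm0_trained_simps using overlap_AE[OF N] AE_space[of Q]
proof eventually_elim
  case (elim v)
  let ?e = "e N (X v)" and ?p = "\<pi> N (X v)"
  have "1/2 \<le> 1 - ?p" "1/2 \<le> 1 - ?e" using elim Cp by linarith+
  from abs_diff_inverse_le[OF this] have "\<bar>1 / (1 - ?p) - 1 / (1 - ?e)\<bar> \<le> 4 * \<bar>?p - ?e\<bar>" by simp
  \<comment> \<open>Both values lie between 0 and \<open>C * pbar N\<close>, so even a misspecified
    \<open>e\<close> is within that distance of \<open>\<pi>\<close>.\<close>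
  also have "\<bar>?p - ?e\<bar> \<le> C * pbar N" using elim by linarith
  finally show ?case using R(2)[OF N elim(2)] overlap(4) pbar_pos[OF N] by (auto simp: mult_ac)
qed

lemma reg_bias0_L1: "(\<integral>\<^sup>+v. ennreal \<bar>\<mu> 0 (X v) - m 0 (X v)\<bar> \<partial>Q) \<le> ennreal (sqrt s2)"
proof -
  have "(\<integral>\<^sup>+v. ennreal \<bar>\<mu> 0 (X v) - m 0 (X v)\<bar> \<partial>Q) \<le> (\<integral>\<^sup>+v. ennreal (sqrt s2) \<partial>Q)"
    using bias(1) by (intro nn_integral_mono_AE) (auto elim!: eventually_mono simp: abs_minus_commute intro!: ennreal_leI)
  then show ?thesis by (simp add: emeasure_space_1)
qed

text \<open>Hoelder's inequality with exponents infinity and 1: the weight factor is bounded almost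
  surely, the regression factor in conditional L1. The condition \<open>L * re N \<le> 1/4\<close>
  depends on \<open>L\<close> and so can hold only eventually.\<close>

lemma arm0_piece_rate:
  assumes wt: "\<And>N. N \<ge> 1 \<Longrightarrow> measurable_statistic N (wt N)" "\<And>N. N \<ge> 1 \<Longrightarrow> b N > 0"
      "\<And>k. k \<in> {1..K} \<Longrightarrow> bigOp M (W1 k) q1" "\<And>N. N \<ge> 1 \<Longrightarrow> q1 N \<ge> 0" "\<And>L. L > 0 \<Longrightarrow> D L > 0"
      "\<And>k N w L. L > 0 \<Longrightarrow> N \<ge> 1 \<Longrightarrow> C * pbar N \<le> 1/4 \<Longrightarrow> L * re N \<le> 1/4 \<Longrightarrow> \<bar>W1 k N w\<bar> \<le> ereal (L * q1 N) \<Longrightarrow>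
        AE v in Q. \<bar>trained wt N k w (Z N v)\<bar> \<le> D L * b N"
    and G: "\<And>N. N \<ge> 1 \<Longrightarrow> measurable_statistic N (G N)" "\<And>N. N \<ge> 1 \<Longrightarrow> r N > 0"
      "\<And>k. k \<in> {1..K} \<Longrightarrow> bigOp M (W2 k) q2" "\<And>N. N \<ge> 1 \<Longrightarrow> q2 N \<ge> 0" "\<And>L. L > 0 \<Longrightarrow> B L > 0"
      "\<And>k N w L. L > 0 \<Longrightarrow> N \<ge> 1 \<Longrightarrow> \<bar>W2 k N w\<bar> \<le> ereal (L * q2 N) \<Longrightarrow> cond_abs G N k w \<le> ennreal (B L * r N)"
  shows "real_bigOp M (cross_avg (\<lambda>N T x z. wt N T x z * G N T x z)) (\<lambda>N. b N * r N)"
proof (rule bigOp_pieceI[where B = "\<lambda>L. D L * B L" and E = "\<lambda>L N. C * pbar N \<le> 1/4 \<and> L * re N \<le> 1/4",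
      OF measurable_statistic_arith(2)[OF wt(1) G(1)] _ wt(3) G(3) wt(4) G(4)])
  show "\<forall>\<^sub>F N in sequentially. C * pbar N \<le> 1/4 \<and> L * re N \<le> 1/4" if L: "L > 0" for L
  proof -
    have "1 / (4 * L) > 0" "(1/4::real) > 0" using L by auto
    from eventually_rate_le(1)[OF this(1)] eventually_C_pbar_le[OF this(2)]
    show ?thesis by eventually_elim (use L in \<open>simp add: field_simps\<close>)
  qed
  show "0 < b N * r N" if "N \<ge> 1" for N using wt(2) G(2) that by simp
  show "0 < D L * B L" if "L > 0" for L using wt(5) G(5) that by simp
  fix k N w and L :: real
  assume L: "L > 0" and N: "N \<ge> 1" and E: "C * pbar N \<le> 1/4 \<and> L * re N \<le> 1/4"
    and le: "\<bar>W1 k N w\<bar> \<le> ereal (L * q1 N)" "\<bar>W2 k N w\<bar> \<le> ereal (L * q2 N)"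
  have meas: "trained G N k w \<in> borel_measurable borel" by (rule measurable_fold_stat[OF G(1)[OF N]])
  have "(\<integral>\<^sup>+v. ennreal \<bar>trained wt N k w (Z N v) * trained G N k w (Z N v)\<bar> \<partial>Q) \<le> ennreal (D L * b N * (B L * r N))"
  proof (rule nn_integral_le_cmult[OF _ _ _ G(6)[OF L N le(2)]])
    show "AE v in Q. \<bar>trained wt N k w (Z N v) * trained G N k w (Z N v)\<bar> \<le> D L * b N * \<bar>trained G N k w (Z N v)\<bar>"
      using wt(6)[OF L N conjunct1[OF E] conjunct2[OF E] le(1)] by eventually_elim (simp add: abs_mult mult_right_mono)
    show "0 \<le> D L * b N" using wt(2,5) L N by (simp add: less_imp_le)
    show "(\<lambda>v. \<bar>trained G N k w (Z N v)\<bar>) \<in> borel_measurable Q"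
      by (intro borel_measurable_abs measurable_compose[OF Z_measurable[OF N] meas])
  qed
  then show "cond_abs (\<lambda>N T x z. wt N T x z * G N T x z) N k w \<le> ennreal (D L * B L * (b N * r N))"
    by (simp only: fold_stat_def mult_ac)
qed

lemma arm0_rates:
  "real_bigOp M (cross_avg (\<lambda>N T x z. ps_err0 N T x z * reg_err0 N T x z)) (\<lambda>N. pbar N * re N * r\<mu> 0 N)"
  "real_bigOp M (cross_avg (\<lambda>N T x z. ps_err0 N T x z * reg_bias0 N T x z)) (\<lambda>N. pbar N * re N)"
  "real_bigOp M (cross_avg (\<lambda>N T x z. ps_bias0 N T x z * reg_err0 N T x z)) (\<lambda>N. pbar N * r\<mu> 0 N)"
  "real_bigOp M (cross_avg (\<lambda>N T x z. ps_bias0 N T x z * reg_bias0 N T x z)) pbar"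
proof -
  have zero: "(0::nat) \<in> {0, 1}" by simp
  \<comment> \<open>Control variable for the factors that involve no estimator and obey
    deterministic bounds.\<close>
  have bz: "bigOp M (\<lambda>_ _. 0) (\<lambda>_. 1)" by (rule bigOp_zero) simp
  have pos: "0 < pbar N * re N" "0 \<le> re N" "0 \<le> (r\<mu> 0 N)\<^sup>2" if "N \<ge> 1" for N
    using pbar_pos[OF that] rate_pos[OF that] by auto
  have err: "cond_abs reg_err0 N k w \<le> ennreal ((L + 1) * r\<mu> 0 N)"
    if L: "L > 0" and N: "N \<ge> 1" and le: "\<bar>enn2ereal (mu_err 0 k N w)\<bar> \<le> ereal (L * (r\<mu> 0 N)\<^sup>2)" for N k w L
    unfolding arm0_trained_simps
  proof (rule nn_integral_abs_le)
    show "(\<lambda>v. mh 0 N k w (X v) - \<mu> 0 (X v)) \<in> borel_measurable Q" using mh_measurable[OF N, of 0 k w] by measurable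
    show "mu_err 0 k N w \<le> ennreal (L * (r\<mu> 0 N)\<^sup>2)"
      using abs_enn2ereal_le_iff(1)[THEN iffD1, OF _ le] L by simp
  qed (use L rate_pos[OF N] in auto)
  have bias: "cond_abs reg_bias0 N k w \<le> ennreal (sqrt s2 * 1)" for N k w
    unfolding arm0_trained_simps using reg_bias0_L1 by simp
  note ps_err = stat_measurable(9) pos(1) pihat[rule_format] pos(2) _ ps_err0_bound
  note ps_bias = stat_measurable(10) pbar_pos(1) bz zero_le_one _ ps_bias0_bound
  note reg_err = stat_measurable(11) rate_pos(2) mu_err_rate[OF zero] pos(3) _ err
  note reg_bias = stat_measurable(12) zero_less_one bz zero_le_one _ bias
  show "real_bigOp M (cross_avg (\<lambda>N T x z. ps_err0 N T x z * reg_err0 N T x z)) (\<lambda>N. pbar N * re N * r\<mu> 0 N)"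
    by (rule arm0_piece_rate[OF ps_err reg_err]) auto
  show "real_bigOp M (cross_avg (\<lambda>N T x z. ps_err0 N T x z * reg_bias0 N T x z)) (\<lambda>N. pbar N * re N)"
    using arm0_piece_rate[OF ps_err reg_bias] s2 by simp
  show "real_bigOp M (cross_avg (\<lambda>N T x z. ps_bias0 N T x z * reg_err0 N T x z)) (\<lambda>N. pbar N * r\<mu> 0 N)"
    using overlap(4) by (intro arm0_piece_rate[OF ps_bias reg_err]) auto
  show "real_bigOp M (cross_avg (\<lambda>N T x z. ps_bias0 N T x z * reg_bias0 N T x z)) pbar"
    using arm0_piece_rate[OF ps_bias reg_bias] overlap(4) s2 by simp
qed

end

section \<open>Expansion of the two arms\<close>

lemma bigOp_minus: "real_bigOp M V r \<Longrightarrow> real_bigOp M (\<lambda>N w. - V N w) r"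
  unfolding bigOp_def by simp

lemma littleop_minus: "real_littleop M V r \<Longrightarrow> real_littleop M (\<lambda>N w. - V N w) r"
  unfolding littleop_def by simp

lemma littleop_diff:
  fixes V1 V2 :: "nat \<Rightarrow> 'w \<Rightarrow> real"
  assumes "real_littleop M V1 r" "real_littleop M V2 r"
  shows "real_littleop M (\<lambda>N w. V1 N w - V2 N w) r"
  using littleop_add[OF assms(1) littleop_minus[OF assms(2)]] by simp

lemma littleop_of_smallo:
  assumes U: "bigOp M U r" and r: "r \<in> o(s)" and s: "\<And>N. N \<ge> 1 \<Longrightarrow> s N \<ge> 0"
  shows "littleop M U s"
proof (rule littleop_bigOp[OF U])
  fix L \<delta> :: real assume L: "L > 0" "\<delta> > 0"
  then have "\<delta> / L > 0" by simp
  from landau_o.smallD[OF r this] eventually_ge_at_top[of 1]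
  show "\<forall>\<^sub>F N in sequentially. \<forall>w\<in>space (M N). \<bar>U N w\<bar> \<le> ereal (L * r N) \<longrightarrow> \<bar>U N w\<bar> \<le> ereal (\<delta> * s N)"
  proof eventually_elim
    case (elim N)
    have "r N \<le> \<delta> / L * s N" using elim s[OF elim(2)] by simp
    then have "L * r N \<le> L * (\<delta> / L * s N)" using L by (intro mult_left_mono) auto
    also have "\<dots> = \<delta> * s N" using L by simp
    finally have "ereal (L * r N) \<le> ereal (\<delta> * s N)" by simp
    then show ?case by (intro ballI impI) (erule order_trans)
  qed
qed

text \<open>The propensity limit may be correct for some \<open>N\<close> and not for others, so the
  indicator varies with \<open>N\<close>. A gated term is negligible if the gate is always closed or
  if the term itself is negligible.\<close>

lemma littleop_gated:
  assumes s: "\<And>N. N \<ge> 1 \<Longrightarrow> s N \<ge> 0"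
    and U: "(\<forall>N\<ge>1. \<not> b N) \<or> real_littleop M U s"
  shows "real_littleop M (\<lambda>N w. of_bool (b N) * U N w) s"
  using U
proof
  assume b: "\<forall>N\<ge>1. \<not> b N"
  show ?thesis
    by (rule littleop_cong_AE[OF littleop_zero[OF s]]) (use b in \<open>auto simp: zero_ereal_def\<close>)
next
  assume U: "real_littleop M U s"
  show ?thesis
  proof (rule littleop_mono[OF U])
    fix \<delta> :: real assume d: "\<delta> > 0"
    have le: "\<bar>ereal (of_bool (b N) * U N w)\<bar> \<le> \<bar>ereal (U N w)\<bar>" for N w by simp
    show "\<exists>\<delta>'>0. \<forall>\<^sub>F N in sequentially. \<forall>w\<in>space (M N).
        \<bar>ereal (U N w)\<bar> \<le> ereal (\<delta>' * s N) \<longrightarrow> \<bar>ereal (of_bool (b N) * U N w)\<bar> \<le> ereal (\<delta> * s N)"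
      by (intro exI[of _ \<delta>] conjI always_eventually allI ballI impI d) (rule order_trans[OF le])
  qed
qed

lemma integrable_mult_of_squares:
  fixes f g :: "'a \<Rightarrow> real"
  assumes "f \<in> borel_measurable M" "g \<in> borel_measurable M"
    and "integrable M (\<lambda>x. (f x)\<^sup>2)" "integrable M (\<lambda>x. (g x)\<^sup>2)"
  shows "integrable M (\<lambda>x. f x * g x)"
proof (rule Bochner_Integration.integrable_bound[OF Bochner_Integration.integrable_add[OF assms(3,4)]])
  have "\<bar>a * b\<bar> \<le> a\<^sup>2 + b\<^sup>2" for a b :: real
  proof -
    have "2 * (\<bar>a\<bar> * \<bar>b\<bar>) \<le> a\<^sup>2 + b\<^sup>2" using sum_squares_bound[of "\<bar>a\<bar>" "\<bar>b\<bar>"] by simp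
    moreover have "0 \<le> \<bar>a\<bar> * \<bar>b\<bar>" by simp
    ultimately show ?thesis unfolding abs_mult by linarith
  qed
  then show "AE x in M. norm (f x * g x) \<le> norm ((f x)\<^sup>2 + (g x)\<^sup>2)" by simp
qed (use assms in measurable)

lemma integrable_add_squares:
  fixes f g :: "'a \<Rightarrow> real"
  assumes "f \<in> borel_measurable M" "g \<in> borel_measurable M"
    and "integrable M (\<lambda>x. (f x)\<^sup>2)" "integrable M (\<lambda>x. (g x)\<^sup>2)"
  shows "integrable M (\<lambda>x. (f x + g x)\<^sup>2)"
  using integrable_mult_of_squares[OF assms] assms(3,4) by (simp add: power2_sum mult.assoc)

text \<open>\<open>rq\<close>, \<open>re\<close>, \<open>rp\<close> stand for \<open>R\<close> over
  the estimated, limiting and true propensity. In general the drift would be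
  \<open>(rp - re) * (mh - \<mu>) + (re - rq) * (\<mu> - m)\<close>; a correct propensity limit
  removes the first summand, a correct regression limit the second.\<close>

lemma arm1_pointwise:
  fixes mh rq re rp y \<theta> \<mu> m :: real
  shows "re = rp \<Longrightarrow> mh + rq * (y - mh) - \<theta> =
      (\<mu> - \<theta> + re * (y - \<mu>)) + (rp - rq) * (\<mu> - m) + (1 - rp) * (mh - \<mu>) + (rq - re) * (y - m) - (rq - re) * (mh - \<mu>)"
    and "\<mu> = m \<Longrightarrow> mh + rq * (y - mh) - \<theta> =
      (\<mu> - \<theta> + re * (y - \<mu>)) + (rp - re) * (mh - m) + (1 - rp) * (mh - \<mu>) + (rq - re) * (y - m) - (rq - re) * (mh - \<mu>)"
  by (simp_all add: algebra_simps)

text \<open>The weight error \<open>sp - sq\<close> is split at \<open>se\<close> and the regression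
  error \<open>mh - m\<close> at \<open>\<mu>\<close>. Multiplying out gives the four products, and
  no correct specification is involved.\<close>

lemma arm0_pointwise:
  fixes mh sq se sp y \<theta> \<mu> m :: real
  shows "mh + sq * (y - mh) - \<theta> = (m - \<theta>) + sq * (y - m) + (1 - sp) * (mh - m) +
    (se - sq) * (mh - \<mu>) + (se - sq) * (\<mu> - m) + (sp - se) * (mh - \<mu>) + (sp - se) * (\<mu> - m)"
  by (simp add: algebra_simps)

context ate_setting
begin

text \<open>\<open>P\<close> need not be measurable. Its failure set is covered by a Borel null set,
  and avoidance of that set passes from the law of \<open>X\<close> to each of the finitely many
  observations.\<close>

lemma AE_sample:
  assumes N: "N \<ge> 1" and P: "AE x in distr Q borel X. P x"
  shows "AE w in M N. \<forall>i\<in>{1..N}. P (obsX (Zs N i w))"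
proof (intro AE_finite_allI)
  fix i assume i: "i \<in> {1..N}"
  interpret MN: prob_space "M N" using sample N by blast
  obtain A where A: "{x \<in> space (distr Q borel X). \<not> P x} \<subseteq> A" "emeasure (distr Q borel X) A = 0" "A \<in> sets (distr Q borel X)"
    using P by (rule AE_E)
  have Ab[measurable]: "A \<in> sets borel" using A(3) by simp
  have "A \<in> null_sets (distr Q borel X)" using A by auto
  then have "AE w in Q. X w \<notin> A" using AE_distrD[OF X AE_not_in] by blast
  then have lawA: "AE z in law N. obsX z \<notin> A"
    by (subst AE_distr_iff[OF Z_measurable[OF N]]) (measurable, simp add: obs_Z)
  have Zi: "law N = distr (M N) borel (Zs N i)" "Zs N i \<in> borel_measurable (M N)"
    using iid[OF N] i by (auto simp: iid_copies_def MN.indep_vars_def)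
  have "AE z in distr (M N) borel (Zs N i). obsX z \<notin> A" by (rule lawA[unfolded Zi(1)])
  from AE_distrD[OF Zi(2) this] show "AE w in M N. P (obsX (Zs N i w))"
    by eventually_elim (use A(1) in auto)
qed simp

abbreviation fold_map :: "nat \<Rightarrow> 'w \<Rightarrow> nat \<Rightarrow> nat set" where "fold_map N w \<equiv> \<lambda>k. I N k w"
abbreviation sample_data :: "nat \<Rightarrow> 'w \<Rightarrow> nat \<Rightarrow> 'p obs" where "sample_data N w \<equiv> \<lambda>i. Zs N i w"

abbreviation avg :: "nat \<Rightarrow> (nat \<Rightarrow> real) \<Rightarrow> real" where "avg N f \<equiv> (\<Sum>i=1..N. f i) / real N"

lemma avg_arith: "avg N f + avg N g = avg N (\<lambda>i. f i + g i)" "avg N f - avg N g = avg N (\<lambda>i. f i - g i)"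
  "N \<ge> 1 \<Longrightarrow> avg N f - t = avg N (\<lambda>i. f i - t)"
  by (simp_all add: sum.distrib sum_subtractf add_divide_distrib diff_divide_distrib)

lemma avg_cong: "(\<And>i. i \<in> {1..N} \<Longrightarrow> f i = g i) \<Longrightarrow> avg N f = avg N g"
  by (auto intro: arg_cong[where f = "\<lambda>x. x / real N"] sum.cong)

lemma arm1_expansion:
  fixes \<Delta> :: real
  assumes N: "N \<ge> 1"
    and \<Delta>: "(\<forall>i\<in>{1..N}. e N (obsX (Zs N i w)) = \<pi> N (obsX (Zs N i w))) \<and>
        \<Delta> = drift_e N K (\<pi> N) (\<mu> 1) (m 1) (pihat N) (fold_map N w) (sample_data N w) \<or>
      (\<forall>i\<in>{1..N}. \<mu> 1 (obsX (Zs N i w)) = m 1 (obsX (Zs N i w))) \<and>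
        \<Delta> = drift_m N K (\<pi> N) (e N) (m 1) (mhat 1 N) (fold_map N w) (sample_data N w)"
  shows "theta_hat1 N K (mhat 1 N) (pihat N) (fold_map N w) (sample_data N w) - \<theta> 1 =
    (\<Sum>i=1..N. psi1 (\<theta> 1) (\<mu> 1) (e N) (Zs N i w)) / real N + \<Delta> +
    cross_avg balance1 N w + cross_avg noise1 N w - cross_avg product1 N w"
proof -
  note defs = theta_hat1_def cross_mean_def fold_stat_def cross_fit_def fold_fit_def psi1_def drift_e_def drift_m_def
    balance1_def noise1_def product1_def
  from \<Delta> show ?thesis
  proof (elim disjE conjE)
    assume ok: "\<forall>i\<in>{1..N}. e N (obsX (Zs N i w)) = \<pi> N (obsX (Zs N i w))"
      and D: "\<Delta> = drift_e N K (\<pi> N) (\<mu> 1) (m 1) (pihat N) (fold_map N w) (sample_data N w)"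
    show ?thesis
      unfolding D defs avg_arith(1,2) avg_arith(3)[OF N] by (rule avg_cong, rule arm1_pointwise(1)) (use ok in simp)
  next
    assume ok: "\<forall>i\<in>{1..N}. \<mu> 1 (obsX (Zs N i w)) = m 1 (obsX (Zs N i w))"
      and D: "\<Delta> = drift_m N K (\<pi> N) (e N) (m 1) (mhat 1 N) (fold_map N w) (sample_data N w)"
    show ?thesis
      unfolding D defs avg_arith(1,2) avg_arith(3)[OF N] by (rule avg_cong, rule arm1_pointwise(2)) (use ok in simp)
  qed
qed

lemma arm0_expansion:
  assumes N: "N \<ge> 1"
  shows "theta_hat0 N K (mhat 0 N) (pihat N) (fold_map N w) (sample_data N w) - \<theta> 0 =
    cross_avg centred0 N w + cross_avg noise0 N w + cross_avg balance0 N w +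
    cross_avg (\<lambda>N T x z. ps_err0 N T x z * reg_err0 N T x z) N w +
    cross_avg (\<lambda>N T x z. ps_err0 N T x z * reg_bias0 N T x z) N w +
    cross_avg (\<lambda>N T x z. ps_bias0 N T x z * reg_err0 N T x z) N w +
    cross_avg (\<lambda>N T x z. ps_bias0 N T x z * reg_bias0 N T x z) N w"
  unfolding theta_hat0_def cross_mean_def fold_stat_def cross_fit_def fold_fit_def centred0_def noise0_def balance0_def
    ps_err0_def reg_err0_def ps_bias0_def reg_bias0_def avg_arith(1,2) avg_arith(3)[OF N]
  by (rule avg_cong, rule arm0_pointwise)

lemma cross_avg_zero:
  assumes "\<And>i T x. i \<in> {1..N} \<Longrightarrow> F N T x (Zs N i w) = 0"
  shows "cross_avg F N w = 0"
  using assms by (simp add: cross_mean_def fold_stat_def)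

abbreviation lin_err :: "nat \<Rightarrow> 'w \<Rightarrow> real" where
  "lin_err N w \<equiv> theta_hat_ATE N K (mhat 0 N) (mhat 1 N) (pihat N) (fold_map N w) (sample_data N w) - (\<theta> 1 - \<theta> 0)"

abbreviation lin_term :: "nat \<Rightarrow> 'w \<Rightarrow> real" where
  "lin_term N w \<equiv> (\<Sum>i=1..N. psi1 (\<theta> 1) (\<mu> 1) (e N) (Zs N i w)) / real N"

abbreviation m_ok :: "nat \<Rightarrow> bool" where "m_ok r \<equiv> AE x in distr Q borel X. \<mu> r x = m r x"

abbreviation e_ok :: "nat \<Rightarrow> bool" where "e_ok N \<equiv> AE x in distr Q borel X. e N x = \<pi> N x"

abbreviation is_drift :: "(nat \<Rightarrow> 'w \<Rightarrow> real) \<Rightarrow> bool" where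
  "is_drift \<Delta> \<equiv> (\<forall>N\<ge>1. e_ok N) \<and>
        \<Delta> = (\<lambda>N w. drift_e N K (\<pi> N) (\<mu> 1) (m 1) (pihat N) (fold_map N w) (sample_data N w)) \<or>
      m_ok 1 \<and> \<Delta> = (\<lambda>N w. drift_m N K (\<pi> N) (e N) (m 1) (mhat 1 N) (fold_map N w) (sample_data N w))"

abbreviation rt :: "nat \<Rightarrow> real" where "rt N \<equiv> (real N * pbar N) powr (-1/2)"

text \<open>The indicators are legitimate because \<open>reg_bias0\<close> vanishes at all sample
  points under \<open>m_ok 0\<close>, and \<open>ps_bias0\<close> under \<open>e_ok N\<close>,
  almost surely. When both limits of arm 1 are correct, \<open>is_drift\<close> admits either
  form.\<close>

lemma expansion:
  assumes \<Delta>: "is_drift \<Delta>"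
  shows "\<exists>U1 U2 U3 U4 U5 :: nat \<Rightarrow> 'w \<Rightarrow> real.
    real_bigOp M U1 (\<lambda>N. re N * r\<mu> 1 N + pbar N * re N * r\<mu> 0 N) \<and> real_bigOp M U2 (\<lambda>N. pbar N * re N) \<and>
    real_bigOp M U3 (\<lambda>N. pbar N * r\<mu> 0 N) \<and> real_bigOp M U4 pbar \<and> real_littleop M U5 rt \<and>
    (\<forall>N\<ge>1. \<forall>w\<in>space (M N). lin_err N w = lin_term N w + \<Delta> N w + U1 N w
        + of_bool (\<not> m_ok 0) * U2 N w + of_bool (\<not> e_ok N) * U3 N w
        + of_bool (\<not> e_ok N \<and> \<not> m_ok 0) * U4 N w + U5 N w)"
proof -
  let ?A = "\<lambda>N. cross_avg (\<lambda>N T x z. ps_err0 N T x z * reg_err0 N T x z) N"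
  let ?B = "\<lambda>N. cross_avg (\<lambda>N T x z. ps_err0 N T x z * reg_bias0 N T x z) N"
  let ?C = "\<lambda>N. cross_avg (\<lambda>N T x z. ps_bias0 N T x z * reg_err0 N T x z) N"
  let ?D = "\<lambda>N. cross_avg (\<lambda>N T x z. ps_bias0 N T x z * reg_bias0 N T x z) N"
  define U1 where "U1 N w = - cross_avg product1 N w + - ?A N w" for N w
  define U2 where "U2 N w = - ?B N w" for N w
  define U3 where "U3 N w = - ?C N w" for N w
  define U4 where "U4 N w = - ?D N w" for N w
  define err where "err N w = lin_err N w - lin_term N w - \<Delta> N w" for N w
  define U5 where "U5 N w = err N w - U1 N w - of_bool (\<not> m_ok 0) * U2 N w - of_bool (\<not> e_ok N) * U3 N w
    - of_bool (\<not> e_ok N \<and> \<not> m_ok 0) * U4 N w" for N w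
  define V where "V N w = cross_avg balance1 N w + cross_avg noise1 N w - cross_avg centred0 N w
    - cross_avg noise0 N w - cross_avg balance0 N w" for N w
  have V: "real_littleop M V rt"
    unfolding V_def
    by (intro littleop_diff littleop_add balance1_rate noise1_rate centred0_rate noise0_rate balance0_rate)
  have U5: "real_littleop M U5 rt"
  proof (rule littleop_cong_AE[OF V])
    fix N :: nat assume N: "N \<ge> 1"
    have a: "AE w in M N. m_ok 0 \<longrightarrow> (\<forall>i\<in>{1..N}. \<mu> 0 (obsX (Zs N i w)) = m 0 (obsX (Zs N i w)))"
      using AE_sample[OF N] by (cases "m_ok 0") auto
    have b: "AE w in M N. e_ok N \<longrightarrow> (\<forall>i\<in>{1..N}. e N (obsX (Zs N i w)) = \<pi> N (obsX (Zs N i w)))"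
      using AE_sample[OF N] by (cases "e_ok N") auto
    have d: "AE w in M N. m_ok 1 \<longrightarrow>
        (\<forall>i\<in>{1..N}. \<mu> 1 (obsX (Zs N i w)) = m 1 (obsX (Zs N i w)))"
      using AE_sample[OF N] by (cases "m_ok 1") auto
    from a b d show "AE w in M N. ereal (U5 N w) = ereal (V N w)"
    proof eventually_elim
      case (elim w)
      have "theta_hat1 N K (mhat 1 N) (pihat N) (fold_map N w) (sample_data N w) - \<theta> 1 =
          lin_term N w + \<Delta> N w + cross_avg balance1 N w + cross_avg noise1 N w - cross_avg product1 N w"
        by (rule arm1_expansion[OF N]) (use \<Delta> N elim(2,3) in auto)
      with arm0_expansion[OF N, of w]
      have err: "err N w = V N w - cross_avg product1 N w - ?A N w - ?B N w - ?C N w - ?D N w"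
        unfolding err_def theta_hat_ATE_def V_def by linarith
      \<comment> \<open>A product whose indicator is 0 vanishes here, so dropping it from the sum
        does not change the remainder.\<close>
      have B: "m_ok 0 \<Longrightarrow> ?B N w = 0" "m_ok 0 \<Longrightarrow> ?D N w = 0"
        using elim(1) by (auto intro!: cross_avg_zero simp: reg_bias0_def)
      have C: "e_ok N \<Longrightarrow> ?C N w = 0" "e_ok N \<Longrightarrow> ?D N w = 0"
        using elim(2) by (auto intro!: cross_avg_zero simp: ps_bias0_def)
      show ?case
        unfolding U5_def err U1_def U2_def U3_def U4_def using B C by (cases "m_ok 0"; cases "e_ok N") simp_all
    qed
  qed
  have pos: "0 \<le> re N * r\<mu> 1 N" "0 \<le> pbar N * re N * r\<mu> 0 N" if "N \<ge> 1" for N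
    using rate_pos[OF that] pbar_pos[OF that] by auto
  have eq: "lin_err N w = lin_term N w + \<Delta> N w + U1 N w + of_bool (\<not> m_ok 0) * U2 N w + of_bool (\<not> e_ok N) * U3 N w
        + of_bool (\<not> e_ok N \<and> \<not> m_ok 0) * U4 N w + U5 N w" for N w
    unfolding U5_def err_def by simp
  have U: "real_bigOp M U1 (\<lambda>N. re N * r\<mu> 1 N + pbar N * re N * r\<mu> 0 N)"
    "real_bigOp M U2 (\<lambda>N. pbar N * re N)"
    "real_bigOp M U3 (\<lambda>N. pbar N * r\<mu> 0 N)"
    "real_bigOp M U4 pbar"
    unfolding U1_def U2_def U3_def U4_def
    by (rule bigOp_add[OF bigOp_minus[OF product1_rate] bigOp_minus[OF arm0_rates(1)] pos], assumption, assumption)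
       (intro bigOp_minus arm0_rates)+
  show ?thesis
    by (intro exI[of _ U1] exI[of _ U2] exI[of _ U3] exI[of _ U4] exI[of _ U5] conjI U U5 allI ballI impI eq)
qed

section \<open>Comparison of the deterministic rates\<close>

lemma smallo_dominated:
  fixes f g s :: "nat \<Rightarrow> real"
  assumes "f \<in> o(s)" "\<forall>\<^sub>F N in sequentially. \<bar>g N\<bar> \<le> \<bar>f N\<bar>"
  shows "g \<in> o(s)"
proof (rule landau_o.smallI)
  fix d :: real assume "d > 0"
  from landau_o.smallD[OF assms(1) this] assms(2) show "\<forall>\<^sub>F N in sequentially. norm (g N) \<le> d * norm (s N)"
    by eventually_elim simp
qed

text \<open>Source of the exponent -3/2 in the conditions: errors of arm 0 carry a factor pbar, and
  \<open>pbar N * pbar N powr (-3/2)\<close> is \<open>pbar N powr (-1/2)\<close>.\<close>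

lemma smallo_pbar_mult:
  assumes "f \<in> o(\<lambda>N. real N powr (-1/2) * pbar N powr (-3/2))"
  shows "(\<lambda>N. pbar N * f N) \<in> o(rt)"
proof -
  have "(\<lambda>N. pbar N * f N) \<in> o(\<lambda>N. pbar N * (real N powr (-1/2) * pbar N powr (-3/2)))"
    by (rule landau_o.small.mult_left[OF assms])
  also have "o(\<lambda>N. pbar N * (real N powr (-1/2) * pbar N powr (-3/2))) = o(rt)"
  proof (intro landau_o.small.cong eventually_mono[OF eventually_ge_at_top[of 1]])
    fix N :: nat assume N: "1 \<le> N"
    have "pbar N * pbar N powr (-3/2) = pbar N powr (-1/2)"
      using pbar_pos[OF N] powr_add[of "pbar N" 1 "-3/2"] by simp
    then show "pbar N * (real N powr (-1/2) * pbar N powr (-3/2)) = rt N"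
      using pbar_pos[OF N] by (simp add: powr_mult mult.left_commute)
  qed
  finally show ?thesis .
qed

text \<open>The ratio of \<open>pbar\<close> to the target rate is
  \<open>pbar * sqrt (N * pbar)\<close>, whose square is \<open>N * pbar ^ 3\<close>; hence the
  hypothesis is used at \<open>d\<^sup>2\<close>.\<close>

lemma smallo_pbar:
  assumes "(\<lambda>N. real N * pbar N ^ 3) \<in> o(\<lambda>_. 1)"
  shows "pbar \<in> o(rt)"
proof (rule landau_o.smallI)
  fix d :: real assume d: "d > 0"
  then have "d\<^sup>2 > 0" by simp
  from landau_o.smallD[OF assms this] eventually_ge_at_top[of 1]
  show "\<forall>\<^sub>F N in sequentially. norm (pbar N) \<le> d * norm (rt N)"
  proof eventually_elim
    case (elim N)
    note p = pbar_pos[OF elim(2)]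
    have N: "real N > 0" using elim by simp
    have rt: "rt N = 1 / sqrt (real N * pbar N)"
      using p N by (simp add: powr_minus_divide powr_half_sqrt)
    have "(pbar N * sqrt (real N * pbar N))\<^sup>2 = real N * pbar N ^ 3"
      using p N by (simp add: power_mult_distrib power2_eq_square power3_eq_cube)
    also have "\<dots> \<le> d\<^sup>2" using elim(1) p N by simp
    finally have "pbar N * sqrt (real N * pbar N) \<le> d" by (rule power2_le_imp_le) (use d in simp)
    then show ?case using p N d unfolding rt by (simp add: pos_le_divide_eq)
  qed
qed

text \<open>In each case every remainder of the expansion is either switched off by its indicator or
  negligible by the rate condition of that case.\<close>

lemma remainder:
  assumes \<Delta>: "is_drift \<Delta>" and prod: "(\<lambda>N. re N * r\<mu> 1 N) \<in> o(rt)"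
    and cases: "(m_ok 0 \<and> (\<forall>N\<ge>1. e_ok N) \<and> (\<lambda>N. re N * r\<mu> 0 N) \<in> o(\<lambda>N. real N powr (-1/2) * pbar N powr (-3/2))) \<or>
      (\<not> m_ok 0 \<and> (\<forall>N\<ge>1. e_ok N) \<and> re \<in> o(\<lambda>N. real N powr (-1/2) * pbar N powr (-3/2))) \<or>
      (m_ok 0 \<and> \<not> (\<forall>N\<ge>1. e_ok N) \<and> r\<mu> 0 \<in> o(\<lambda>N. real N powr (-1/2) * pbar N powr (-3/2))) \<or>
      (\<not> m_ok 0 \<and> \<not> (\<forall>N\<ge>1. e_ok N) \<and> (\<lambda>N. real N * pbar N ^ 3) \<in> o(\<lambda>_. 1))"
  shows "\<exists>V. real_littleop M V rt \<and> (\<forall>N\<ge>1. \<forall>w\<in>space (M N). lin_err N w = lin_term N w + V N w + \<Delta> N w)"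
proof -
  obtain U1 U2 U3 U4 U5 where U: "real_bigOp M U1 (\<lambda>N. re N * r\<mu> 1 N + pbar N * re N * r\<mu> 0 N)"
    "real_bigOp M U2 (\<lambda>N. pbar N * re N)" "real_bigOp M U3 (\<lambda>N. pbar N * r\<mu> 0 N)" "real_bigOp M U4 pbar" "real_littleop M U5 rt"
    and eq: "\<forall>N\<ge>1. \<forall>w\<in>space (M N). lin_err N w = lin_term N w + \<Delta> N w + U1 N w
        + of_bool (\<not> m_ok 0) * U2 N w + of_bool (\<not> e_ok N) * U3 N w
        + of_bool (\<not> e_ok N \<and> \<not> m_ok 0) * U4 N w + U5 N w"
    using expansion[OF \<Delta>] by (elim exE conjE)
  have rt0: "rt N \<ge> 0" for N by simp
  have le1: "\<forall>\<^sub>F N in sequentially. 0 < pbar N \<and> 0 < re N \<and> re N \<le> 1 \<and> 0 < r\<mu> 0 N \<and> r\<mu> 0 N \<le> 1"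
    using eventually_rate_le(1)[OF zero_less_one] eventually_rate_le(2)[OF zero_less_one] eventually_ge_at_top[of 1]
    by eventually_elim (simp add: pbar_pos rate_pos)
  \<comment> \<open>A further factor tending to 0 is eventually at most 1 and preserves little-o.
    This settles \<open>pbar N * re N * r\<mu> 0 N\<close> in the cases that assume nothing on the
    product of the two rates.\<close>
  have dom_re: "(\<lambda>N. f N * re N) \<in> o(rt)" if "f \<in> o(rt)" for f
    by (rule smallo_dominated[OF that]) (use le1 in \<open>auto elim!: eventually_mono simp: abs_mult mult_left_le\<close>)
  have dom_mu: "(\<lambda>N. f N * r\<mu> 0 N) \<in> o(rt)" if "f \<in> o(rt)" for f
    by (rule smallo_dominated[OF that]) (use le1 in \<open>auto elim!: eventually_mono simp: abs_mult mult_left_le\<close>)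
  let ?U2 = "m_ok 0 \<or> (\<lambda>N. pbar N * re N) \<in> o(rt)"
  let ?U3 = "(\<forall>N\<ge>1. e_ok N) \<or> (\<lambda>N. pbar N * r\<mu> 0 N) \<in> o(rt)"
  let ?U4 = "(\<forall>N\<ge>1. e_ok N) \<or> m_ok 0 \<or> pbar \<in> o(rt)"
  have small: "(\<lambda>N. pbar N * re N * r\<mu> 0 N) \<in> o(rt) \<and> ?U2 \<and> ?U3 \<and> ?U4"
    using cases
  proof (elim disjE conjE)
    assume "m_ok 0" "\<forall>N\<ge>1. e_ok N" and r: "(\<lambda>N. re N * r\<mu> 0 N) \<in> o(\<lambda>N. real N powr (-1/2) * pbar N powr (-3/2))"
    then show ?thesis using smallo_pbar_mult[OF r] by (simp add: mult.assoc)
  next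
    assume "\<forall>N\<ge>1. e_ok N" and r: "re \<in> o(\<lambda>N. real N powr (-1/2) * pbar N powr (-3/2))"
    then show ?thesis using smallo_pbar_mult[OF r] dom_mu[OF smallo_pbar_mult[OF r]] by simp
  next
    assume "m_ok 0" and r: "r\<mu> 0 \<in> o(\<lambda>N. real N powr (-1/2) * pbar N powr (-3/2))"
    then show ?thesis using smallo_pbar_mult[OF r] dom_re[OF smallo_pbar_mult[OF r]] by (simp add: mult_ac)
  next
    assume "(\<lambda>N. real N * pbar N ^ 3) \<in> o(\<lambda>_. 1)"
    note r = smallo_pbar[OF this]
    show ?thesis using r dom_re[OF r] dom_mu[OF r] dom_mu[OF dom_re[OF r]] by simp
  qed
  have s1: "real_littleop M U1 rt"
    using small prod by (intro littleop_of_smallo[OF U(1)] sum_in_smallo rt0) auto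
  have s2: "real_littleop M (\<lambda>N w. of_bool (\<not> m_ok 0) * U2 N w) rt"
    using small littleop_of_smallo[OF U(2) _ rt0] by (intro littleop_gated[OF rt0]) auto
  have s3: "real_littleop M (\<lambda>N w. of_bool (\<not> e_ok N) * U3 N w) rt"
    using small littleop_of_smallo[OF U(3) _ rt0] by (intro littleop_gated[OF rt0]) auto
  have s4: "real_littleop M (\<lambda>N w. of_bool (\<not> e_ok N \<and> \<not> m_ok 0) * U4 N w) rt"
    using small littleop_of_smallo[OF U(4) _ rt0] by (intro littleop_gated[OF rt0]) auto
  show ?thesis
  proof (intro exI conjI)
    show "real_littleop M (\<lambda>N w. U1 N w + of_bool (\<not> m_ok 0) * U2 N w + of_bool (\<not> e_ok N) * U3 N w
        + of_bool (\<not> e_ok N \<and> \<not> m_ok 0) * U4 N w + U5 N w) rt"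
      by (intro littleop_add s1 s2 s3 s4 U(5))
    show "\<forall>N\<ge>1. \<forall>w\<in>space (M N). lin_err N w = lin_term N w + (U1 N w + of_bool (\<not> m_ok 0) * U2 N w + of_bool (\<not> e_ok N) * U3 N w
        + of_bool (\<not> e_ok N \<and> \<not> m_ok 0) * U4 N w + U5 N w) + \<Delta> N w"
      using eq by simp
  qed
qed

text \<open>The residual part \<open>B\<close> carries the order 1/pbar in both directions: it is
  orthogonal to the rest, so its second moment is a lower bound, and overlap together with the two
  conditional moment bounds pins that down up to constants.\<close>

lemma psi1_moments:
  assumes N: "N \<ge> 1"
    and ok: "(AE x in distr Q borel X. e N x = \<pi> N x) \<or> (AE x in distr Q borel X. \<mu> 1 x = m 1 x)"
  defines "\<psi> \<equiv> \<lambda>w. psi1 (\<theta> 1) (\<mu> 1) (e N) (Z N w)"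
    and "v \<equiv> \<integral>w. (\<mu> 1 (X w) - \<theta> 1)\<^sup>2 \<partial>Q"
  shows "integrable Q \<psi>" "(\<integral>w. \<psi> w \<partial>Q) = 0" "integrable Q (\<lambda>w. (\<psi> w)\<^sup>2)"
    and "(\<integral>w. (\<psi> w)\<^sup>2 \<partial>Q) \<le> 3 * (v + 5 * s2 * (C / c\<^sup>2)) * inverse (pbar N)"
    and "(\<integral>w. (\<psi> w)\<^sup>2 \<partial>Q) \<ge> s1 * (c / C\<^sup>2) * inverse (pbar N)"
proof -
  interpret A: treatment_arm Q X "Yp 1" "R N" "\<pi> N" "m 1" "4 * s2" by (rule arm1[OF N])
  note [measurable] = e[OF N] \<pi>[OF N] R(1)[OF N] \<mu>(2) m(2) Yp(2)
  note p = pbar_pos[OF N]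
  have cp: "0 < c * pbar N" using overlap(3) p by simp
  define P where "P w = \<mu> 1 (X w) - \<theta> 1" for w
  define h where "h x = 1 / e N x" for x
  define G where "G w = R N w * (h (X w) * (m 1 (X w) - \<mu> 1 (X w)))" for w
  define B where "B w = R N w * h (X w) * (Yp 1 w - m 1 (X w))" for w
  have h[measurable]: "h \<in> borel_measurable borel" unfolding h_def by measurable
  have meas[measurable]: "P \<in> borel_measurable Q" "G \<in> borel_measurable Q" "B \<in> borel_measurable Q"
    unfolding P_def G_def B_def by measurable
  \<comment> \<open>The outcome is recentred at the true regression: \<open>B\<close> is centred
    whether or not \<open>\<mu> 1\<close> is correct, and \<open>G\<close> carries the
    misspecification.\<close>
  have \<psi>: "\<psi> w = P w + G w + B w" if "w \<in> space Q" for w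
    using R(2)[OF N that] unfolding \<psi>_def psi1_def obs_Z P_def G_def B_def h_def
    by (auto simp: algebra_simps diff_divide_distrib)
  have hb: "AE w in Q. 0 < h (X w) \<and> h (X w) \<le> 1 / (c * pbar N) \<and> 1 / (C * pbar N) \<le> h (X w)"
    using overlap_AE[OF N]
  proof eventually_elim
    case (elim w)
    then show ?case unfolding h_def using cp by (auto intro!: divide_left_mono)
  qed
  have ph_up: "AE w in Q. \<pi> N (X w) * (h (X w))\<^sup>2 \<le> C / c\<^sup>2 * inverse (pbar N)"
    using hb overlap_AE[OF N]
  proof eventually_elim
    case (elim w)
    have "\<pi> N (X w) * (h (X w))\<^sup>2 \<le> (C * pbar N) * (1 / (c * pbar N))\<^sup>2"
      using elim by (intro mult_mono power_mono) auto
    also have "\<dots> = C / c\<^sup>2 * inverse (pbar N)" using p by (simp add: power2_eq_square field_simps)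
    finally show ?case .
  qed
  have ph_low: "AE w in Q. c / C\<^sup>2 * inverse (pbar N) \<le> \<pi> N (X w) * (h (X w))\<^sup>2"
    using hb overlap_AE[OF N]
  proof eventually_elim
    case (elim w)
    have "c / C\<^sup>2 * inverse (pbar N) = (c * pbar N) * (1 / (C * pbar N))\<^sup>2"
      using p by (simp add: power2_eq_square field_simps)
    also have "\<dots> \<le> \<pi> N (X w) * (h (X w))\<^sup>2"
      using elim cp overlap(4) p by (intro mult_mono power_mono) auto
    finally show ?case .
  qed
  have q0: "0 \<le> C / c\<^sup>2 * inverse (pbar N)" "0 \<le> c / C\<^sup>2 * inverse (pbar N)" using overlap(3,4) p by auto
  have int_ph: "(\<integral>\<^sup>+w. ennreal (\<pi> N (X w) * (h (X w))\<^sup>2) \<partial>Q) \<le> ennreal (C / c\<^sup>2 * inverse (pbar N))"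
  proof -
    have "(\<integral>\<^sup>+w. ennreal (\<pi> N (X w) * (h (X w))\<^sup>2) \<partial>Q) \<le> (\<integral>\<^sup>+w. ennreal (C / c\<^sup>2 * inverse (pbar N)) \<partial>Q)"
      using ph_up by (intro nn_integral_mono_AE) (auto elim!: eventually_mono intro!: ennreal_leI)
    then show ?thesis by (simp add: emeasure_space_1)
  qed
  have bias2: "AE w in Q. (m 1 (X w) - \<mu> 1 (X w))\<^sup>2 \<le> s2"
    using bias(2)
  proof eventually_elim
    case (elim w)
    then have "\<bar>m 1 (X w) - \<mu> 1 (X w)\<bar>\<^sup>2 \<le> (sqrt s2)\<^sup>2" by (intro power_mono) auto
    then show ?case using s2 by simp
  qed
  have res2: "integrable Q (\<lambda>w. (Yp 1 w - m 1 (X w))\<^sup>2)"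
  proof (intro integrableI_bounded)
    show "(\<integral>\<^sup>+w. ennreal (norm ((Yp 1 w - m 1 (X w))\<^sup>2)) \<partial>Q) < \<infinity>"
      using A.var[of "\<lambda>_. 1"] by (intro le_ennreal_imp_finite[of _ "4 * s2"]) (simp add: emeasure_space_1)
  qed measurable
  have Y1: "integrable Q (\<lambda>w. (Yp 1 w)\<^sup>2)" using sq by simp
  have b2: "integrable Q (\<lambda>w. (m 1 (X w) - \<mu> 1 (X w))\<^sup>2)"
    using bias2 by (intro integrable_const_bound[of _ s2]) (auto elim!: eventually_mono)
  have P2: "integrable Q (\<lambda>w. (P w)\<^sup>2)"
  proof -
    have "integrable Q (\<lambda>w. (Yp 1 w + (- (Yp 1 w - m 1 (X w))))\<^sup>2)"
      by (rule integrable_add_squares[OF _ _ Y1]) (measurable, subst power2_minus, rule res2)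
    then have m2: "integrable Q (\<lambda>w. (m 1 (X w))\<^sup>2)" by simp
    have m\<theta>: "integrable Q (\<lambda>w. (m 1 (X w) + (- \<theta> 1))\<^sup>2)"
      by (rule integrable_add_squares[OF measurable_compose[OF X m(2)] borel_measurable_const m2]) simp
    have "integrable Q (\<lambda>w. ((m 1 (X w) + (- \<theta> 1)) + (- (m 1 (X w) - \<mu> 1 (X w))))\<^sup>2)"
      by (rule integrable_add_squares[OF _ _ m\<theta>]) (measurable, subst power2_minus, rule b2)
    then show ?thesis by (simp add: P_def)
  qed
  have G2b: "(\<integral>\<^sup>+w. ennreal ((G w)\<^sup>2) \<partial>Q) \<le> ennreal (s2 * (C / c\<^sup>2 * inverse (pbar N)))"
  proof -
    have "(\<integral>\<^sup>+w. ennreal ((G w)\<^sup>2) \<partial>Q) = (\<integral>\<^sup>+w. ennreal (R N w) * ennreal ((h (X w) * (m 1 (X w) - \<mu> 1 (X w)))\<^sup>2) \<partial>Q)"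
      using R(2)[OF N] unfolding G_def by (intro nn_integral_cong) fastforce
    also have "\<dots> = (\<integral>\<^sup>+w. ennreal (\<pi> N (X w)) * ennreal ((h (X w) * (m 1 (X w) - \<mu> 1 (X w)))\<^sup>2) \<partial>Q)"
      using A.nn_transfer_X[of "\<lambda>x. ennreal ((h x * (m 1 x - \<mu> 1 x))\<^sup>2)"] by simp
    also have "\<dots> = (\<integral>\<^sup>+w. ennreal (\<pi> N (X w) * (h (X w))\<^sup>2 * (m 1 (X w) - \<mu> 1 (X w))\<^sup>2) \<partial>Q)"
    proof (intro nn_integral_cong_AE)
      show "AE w in Q. ennreal (\<pi> N (X w)) * ennreal ((h (X w) * (m 1 (X w) - \<mu> 1 (X w)))\<^sup>2) =
          ennreal (\<pi> N (X w) * (h (X w))\<^sup>2 * (m 1 (X w) - \<mu> 1 (X w))\<^sup>2)"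
        using overlap_AE[OF N] by eventually_elim (simp add: power_mult_distrib mult.assoc flip: ennreal_mult)
    qed
    also have "\<dots> \<le> ennreal (s2 * (C / c\<^sup>2 * inverse (pbar N)))"
    proof (rule nn_integral_le_cmult[OF _ _ _ int_ph])
      show "AE w in Q. \<pi> N (X w) * (h (X w))\<^sup>2 * (m 1 (X w) - \<mu> 1 (X w))\<^sup>2 \<le> s2 * (\<pi> N (X w) * (h (X w))\<^sup>2)"
        using overlap_AE[OF N] bias2
      proof eventually_elim
        case (elim w)
        then have "\<pi> N (X w) * (h (X w))\<^sup>2 * (m 1 (X w) - \<mu> 1 (X w))\<^sup>2 \<le> \<pi> N (X w) * (h (X w))\<^sup>2 * s2"
          by (intro mult_left_mono) auto
        then show ?case by (simp add: mult.commute)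
      qed
    qed (use s2 in auto)
    finally show ?thesis .
  qed
  have G2: "integrable Q (\<lambda>w. (G w)\<^sup>2)"
    using le_ennreal_imp_finite[OF G2b] by (intro integrableI_bounded) auto
  have B2b: "(\<integral>\<^sup>+w. ennreal ((B w)\<^sup>2) \<partial>Q) \<le> ennreal (4 * s2 * (C / c\<^sup>2 * inverse (pbar N)))"
  proof -
    have "(\<integral>\<^sup>+w. ennreal ((B w)\<^sup>2) \<partial>Q) \<le> ennreal (4 * s2) * (\<integral>\<^sup>+w. ennreal (\<pi> N (X w) * (h (X w))\<^sup>2) \<partial>Q)"
      unfolding B_def by (rule A.treated_residual_second_moment[OF h])
    also have "\<dots> \<le> ennreal (4 * s2) * ennreal (C / c\<^sup>2 * inverse (pbar N))" using int_ph by (rule mult_left_mono) simp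
    also have "\<dots> = ennreal (4 * s2 * (C / c\<^sup>2 * inverse (pbar N)))" using s2 by (intro ennreal_mult'[symmetric]) simp
    finally show ?thesis .
  qed
  have B2: "integrable Q (\<lambda>w. (B w)\<^sup>2)"
    using le_ennreal_imp_finite[OF B2b] by (intro integrableI_bounded) auto
  have Bmean: "(\<integral>w. B w \<partial>Q) = 0"
    unfolding B_def by (rule A.treated_residual_mean[OF h le_ennreal_imp_finite[OF int_ph]])
  note PG2 = integrable_add_squares[OF meas(1,2) P2 G2]
  have PGm: "(\<lambda>w. P w + G w) \<in> borel_measurable Q" by measurable
  note S2 = integrable_add_squares[OF PGm meas(3) PG2 B2]
  have Pi: "integrable Q P" and Gi: "integrable Q G" and Bi: "integrable Q B"
    by (rule square_integrable_imp_integrable[OF meas(1) P2] square_integrable_imp_integrable[OF meas(2) G2]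
        square_integrable_imp_integrable[OF meas(3) B2])+
  show \<psi>i: "integrable Q \<psi>"
    using Pi Gi Bi by (subst Bochner_Integration.integrable_cong[OF refl \<psi>]) auto
  show "integrable Q (\<lambda>w. (\<psi> w)\<^sup>2)"
    using S2 by (subst Bochner_Integration.integrable_cong[OF refl arg_cong[where f = "\<lambda>x. x\<^sup>2", OF \<psi>]]) auto
  have eqi: "(\<integral>w. \<psi> w \<partial>Q) = (\<integral>w. P w + G w + B w \<partial>Q)" "(\<integral>w. (\<psi> w)\<^sup>2 \<partial>Q) = (\<integral>w. (P w + G w + B w)\<^sup>2 \<partial>Q)"
    by (intro Bochner_Integration.integral_cong refl; simp add: \<psi>)+
  show "(\<integral>w. \<psi> w \<partial>Q) = 0"
  proof -
    have "(\<integral>w. G w \<partial>Q) = (\<integral>w. \<pi> N (X w) * (h (X w) * (m 1 (X w) - \<mu> 1 (X w))) \<partial>Q)"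
      unfolding G_def using A.integral_transfer(1)[of "\<lambda>(y, x). h x * (m 1 x - \<mu> 1 x)"] by simp
    \<comment> \<open>Double robustness of the mean: if \<open>e = \<pi>\<close> then
      \<open>\<pi> * h = 1\<close>, and if \<open>\<mu> 1 = m 1\<close> both integrands are
      0.\<close>
    also have "\<dots> = (\<integral>w. m 1 (X w) - \<mu> 1 (X w) \<partial>Q)"
      using ok
    proof
      assume "AE x in distr Q borel X. e N x = \<pi> N x"
      from AE_distrD[OF X this] overlap_AE[OF N]
      have "AE w in Q. \<pi> N (X w) * (h (X w) * (m 1 (X w) - \<mu> 1 (X w))) = m 1 (X w) - \<mu> 1 (X w)"
        by eventually_elim (simp add: h_def)
      then show ?thesis by (intro integral_cong_AE) auto
    next
      assume "AE x in distr Q borel X. \<mu> 1 x = m 1 x"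
      from AE_distrD[OF X this]
      have "AE w in Q. \<pi> N (X w) * (h (X w) * (m 1 (X w) - \<mu> 1 (X w))) = m 1 (X w) - \<mu> 1 (X w)"
        by eventually_elim simp
      then show ?thesis by (intro integral_cong_AE) auto
    qed
    finally have Gmean: "(\<integral>w. G w \<partial>Q) = (\<integral>w. m 1 (X w) - \<mu> 1 (X w) \<partial>Q)" .
    have bi: "integrable Q (\<lambda>w. m 1 (X w) - \<mu> 1 (X w))"
      by (rule square_integrable_imp_integrable[OF _ b2]) measurable
    have "(\<integral>w. P w \<partial>Q) + (\<integral>w. m 1 (X w) - \<mu> 1 (X w) \<partial>Q) = (\<integral>w. P w + (m 1 (X w) - \<mu> 1 (X w)) \<partial>Q)"
      using Pi bi by simp
    also have "\<dots> = (\<integral>w. m 1 (X w) - \<theta> 1 \<partial>Q)" by (simp add: P_def)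
    also have "\<dots> = 0" using m_integrable(2) m_mean(2) by (simp add: prob_space)
    finally show ?thesis unfolding eqi using Pi Gi Bi Bmean Gmean by simp
  qed
  \<comment> \<open>The squares of \<open>P\<close>, \<open>G\<close>, \<open>B\<close> contribute
    \<open>v\<close>, \<open>s2 * (C / c\<^sup>2)\<close> and
    \<open>4 * s2 * (C / c\<^sup>2)\<close> over pbar, whence the 5; for \<open>P\<close> this uses
    \<open>pbar N \<le> 1\<close>. As \<open>v\<close> does not involve \<open>N\<close>, the
    constant is uniform.\<close>
  show "(\<integral>w. (\<psi> w)\<^sup>2 \<partial>Q) \<le> 3 * (v + 5 * s2 * (C / c\<^sup>2)) * inverse (pbar N)"
  proof -
    have sqle: "(a + b + d)\<^sup>2 \<le> 3 * (a\<^sup>2 + b\<^sup>2 + d\<^sup>2)" for a b d :: real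
    proof -
      have "0 \<le> (a - b)\<^sup>2 + (b - d)\<^sup>2 + (a - d)\<^sup>2" by simp
      then show ?thesis by (simp add: power2_eq_square algebra_simps)
    qed
    have "(\<integral>w. (P w + G w + B w)\<^sup>2 \<partial>Q) \<le> (\<integral>w. 3 * ((P w)\<^sup>2 + (G w)\<^sup>2 + (B w)\<^sup>2) \<partial>Q)"
      using P2 G2 B2 S2 sqle by (intro integral_mono) auto
    also have "\<dots> = 3 * ((\<integral>w. (P w)\<^sup>2 \<partial>Q) + (\<integral>w. (G w)\<^sup>2 \<partial>Q) + (\<integral>w. (B w)\<^sup>2 \<partial>Q))"
      using P2 G2 B2 by simp
    also have "(\<integral>w. (G w)\<^sup>2 \<partial>Q) \<le> s2 * (C / c\<^sup>2 * inverse (pbar N))"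
      using G2b nn_integral_eq_integral[OF G2] q0(1) s2 by (simp add: ennreal_le_iff del: times_divide_eq_left)
    also have "(\<integral>w. (B w)\<^sup>2 \<partial>Q) \<le> 4 * s2 * (C / c\<^sup>2 * inverse (pbar N))"
      using B2b nn_integral_eq_integral[OF B2] q0(1) s2 by (simp add: ennreal_le_iff del: times_divide_eq_left)
    also have "(\<integral>w. (P w)\<^sup>2 \<partial>Q) \<le> v * inverse (pbar N)"
    proof -
      have "1 \<le> inverse (pbar N)" using p by (simp add: one_le_inverse)
      moreover have "0 \<le> v" by (simp add: v_def)
      ultimately have "v * 1 \<le> v * inverse (pbar N)" by (rule mult_left_mono)
      then show ?thesis by (simp add: v_def P_def)
    qed
    finally show ?thesis unfolding eqi by (simp add: algebra_simps)
  qed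
  show "(\<integral>w. (\<psi> w)\<^sup>2 \<partial>Q) \<ge> s1 * (c / C\<^sup>2) * inverse (pbar N)"
  proof -
    \<comment> \<open>Where \<open>R = 1\<close>, \<open>P + G\<close> is a function of the
      covariates; multiplied by the weight \<open>h\<close> of \<open>B\<close> it gives
      \<open>g\<close>. So \<open>(P + G) * B\<close> is again a treated residual, with weight
      \<open>g\<close>.\<close>
    define g where "g x = (\<mu> 1 x - \<theta> 1 + h x * (m 1 x - \<mu> 1 x)) * h x" for x
    have g[measurable]: "g \<in> borel_measurable borel" unfolding g_def by measurable
    have Rg: "(R N w * g (X w))\<^sup>2 = R N w * (g (X w))\<^sup>2" "R N w * g (X w) = R N w * (h (X w) * (P w + G w))"
      "(P w + G w) * B w = R N w * g (X w) * (Yp 1 w - m 1 (X w))" if "w \<in> space Q" for w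
      using R(2)[OF N that] by (auto simp: g_def P_def G_def B_def)
    have "(\<integral>\<^sup>+w. ennreal (\<pi> N (X w) * (g (X w))\<^sup>2) \<partial>Q) = (\<integral>\<^sup>+w. ennreal (\<pi> N (X w)) * ennreal ((g (X w))\<^sup>2) \<partial>Q)"
    proof (intro nn_integral_cong_AE)
      show "AE w in Q. ennreal (\<pi> N (X w) * (g (X w))\<^sup>2) = ennreal (\<pi> N (X w)) * ennreal ((g (X w))\<^sup>2)"
        using overlap_AE[OF N] by eventually_elim (simp add: ennreal_mult)
    qed
    also have "\<dots> = (\<integral>\<^sup>+w. ennreal (R N w) * ennreal ((g (X w))\<^sup>2) \<partial>Q)"
      using A.nn_transfer_X[of "\<lambda>x. ennreal ((g x)\<^sup>2)"] by simp
    also have "\<dots> = (\<integral>\<^sup>+w. ennreal ((R N w * (h (X w) * (P w + G w)))\<^sup>2) \<partial>Q)"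
    proof (intro nn_integral_cong)
      fix w assume w: "w \<in> space Q"
      show "ennreal (R N w) * ennreal ((g (X w))\<^sup>2) = ennreal ((R N w * (h (X w) * (P w + G w)))\<^sup>2)"
        unfolding Rg(2)[OF w, symmetric] using R(2)[OF N w] by auto
    qed
    \<comment> \<open>A crude bound that may grow with \<open>N\<close>; only its finiteness at each
      fixed \<open>N\<close> matters for the cross term.\<close>
    also have "\<dots> \<le> ennreal ((1 / (c * pbar N))\<^sup>2 * (\<integral>w. (P w + G w)\<^sup>2 \<partial>Q))"
    proof (rule nn_integral_le_cmult)
      show "AE w in Q. (R N w * (h (X w) * (P w + G w)))\<^sup>2 \<le> (1 / (c * pbar N))\<^sup>2 * (P w + G w)\<^sup>2"
        using hb AE_space[of Q]
      proof eventually_elim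
        case (elim w)
        have "(R N w * h (X w))\<^sup>2 \<le> (1 / (c * pbar N))\<^sup>2"
          using elim R(2)[OF N elim(2)] cp by (intro power_mono) auto
        then have "(R N w * h (X w))\<^sup>2 * (P w + G w)\<^sup>2 \<le> (1 / (c * pbar N))\<^sup>2 * (P w + G w)\<^sup>2"
          by (rule mult_right_mono) simp
        then show ?case by (simp add: power_mult_distrib mult.assoc)
      qed
      show "(\<integral>\<^sup>+w. ennreal ((P w + G w)\<^sup>2) \<partial>Q) \<le> ennreal (\<integral>w. (P w + G w)\<^sup>2 \<partial>Q)"
        using nn_integral_eq_integral[OF PG2] by simp
    qed auto
    finally have gfin: "(\<integral>\<^sup>+w. ennreal (\<pi> N (X w) * (g (X w))\<^sup>2) \<partial>Q) < \<infinity>" by (rule le_ennreal_imp_finite)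
    have cross: "(\<integral>w. (P w + G w) * B w \<partial>Q) = 0"
      using A.treated_residual_mean[OF g gfin] by (subst Bochner_Integration.integral_cong[OF refl Rg(3)]) auto
    have "ennreal (s1 * (c / C\<^sup>2 * inverse (pbar N))) = ennreal s1 * (\<integral>\<^sup>+w. ennreal (c / C\<^sup>2 * inverse (pbar N)) \<partial>Q)"
      using s1 by (simp add: emeasure_space_1 ennreal_mult' del: times_divide_eq_left)
    also have "\<dots> \<le> ennreal s1 * (\<integral>\<^sup>+w. ennreal (\<pi> N (X w) * (h (X w))\<^sup>2) \<partial>Q)"
      using ph_low by (intro mult_left_mono nn_integral_mono_AE) (auto elim!: eventually_mono intro!: ennreal_leI)
    also have "\<dots> \<le> (\<integral>\<^sup>+w. ennreal (\<pi> N (X w) * (h (X w))\<^sup>2) * ennreal ((Yp 1 w - m 1 (X w))\<^sup>2) \<partial>Q)"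
      by (rule nn_integral_ge_of_cond_ge[OF prob_Q X, of "\<lambda>x. ennreal (\<pi> N x * (h x)\<^sup>2)"])
         (measurable, rule cond_lower, simp)
    also have "\<dots> = (\<integral>\<^sup>+w. ennreal (\<pi> N (X w)) * ennreal ((h (X w) * (Yp 1 w - m 1 (X w)))\<^sup>2) \<partial>Q)"
    proof (intro nn_integral_cong_AE)
      show "AE w in Q. ennreal (\<pi> N (X w) * (h (X w))\<^sup>2) * ennreal ((Yp 1 w - m 1 (X w))\<^sup>2) =
          ennreal (\<pi> N (X w)) * ennreal ((h (X w) * (Yp 1 w - m 1 (X w)))\<^sup>2)"
        using overlap_AE[OF N] by eventually_elim (simp add: power_mult_distrib mult.assoc flip: ennreal_mult)
    qed
    also have "\<dots> = (\<integral>\<^sup>+w. ennreal (R N w) * ennreal ((h (X w) * (Yp 1 w - m 1 (X w)))\<^sup>2) \<partial>Q)"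
      using A.nn_transfer[of "\<lambda>(y, x). ennreal ((h x * (y - m 1 x))\<^sup>2)"] by simp
    also have "\<dots> = (\<integral>\<^sup>+w. ennreal ((B w)\<^sup>2) \<partial>Q)"
      using R(2)[OF N] unfolding B_def by (intro nn_integral_cong) fastforce
    also have "\<dots> = ennreal (\<integral>w. (B w)\<^sup>2 \<partial>Q)" by (rule nn_integral_eq_integral[OF B2]) simp
    finally have low: "s1 * (c / C\<^sup>2 * inverse (pbar N)) \<le> (\<integral>w. (B w)\<^sup>2 \<partial>Q)"
      by (subst (asm) ennreal_le_iff) auto
    have "(\<integral>w. (P w + G w + B w)\<^sup>2 \<partial>Q) = (\<integral>w. (P w + G w)\<^sup>2 + 2 * ((P w + G w) * B w) + (B w)\<^sup>2 \<partial>Q)"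
      by (intro Bochner_Integration.integral_cong refl) (simp add: power2_eq_square algebra_simps)
    also have "\<dots> = (\<integral>w. (P w + G w)\<^sup>2 \<partial>Q) + 2 * (\<integral>w. (P w + G w) * B w \<partial>Q) + (\<integral>w. (B w)\<^sup>2 \<partial>Q)"
      using PG2 B2 integrable_mult_of_squares[OF PGm meas(3) PG2 B2]
      by (subst Bochner_Integration.integral_add | subst integral_mult_right_zero | simp)+
    also have "\<dots> \<ge> (\<integral>w. (B w)\<^sup>2 \<partial>Q)" unfolding cross by simp
    finally show ?thesis unfolding eqi using low by (simp add: mult.assoc)
  qed
qed

end

theorem corollary5p1:
  fixes Q :: "'q measure" and X :: "'q \<Rightarrow> real^'p" and Yp R :: "nat \<Rightarrow> 'q \<Rightarrow> real"
    and m \<mu> \<pi> e :: "nat \<Rightarrow> real^'p \<Rightarrow> real"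
    and M :: "nat \<Rightarrow> 'w measure" and Zs :: "nat \<Rightarrow> nat \<Rightarrow> 'w \<Rightarrow> 'p::finite obs"
    and K :: nat and I :: "nat \<Rightarrow> nat \<Rightarrow> 'w \<Rightarrow> nat set"
    and mhat :: "nat \<Rightarrow> nat \<Rightarrow> 'p estimator" and pihat :: "nat \<Rightarrow> 'p estimator"
    and r\<mu> :: "nat \<Rightarrow> nat \<Rightarrow> real" and re :: "nat \<Rightarrow> real" and c C :: real
  defines "PX \<equiv> distr Q borel X"
    and "\<X> \<equiv> law_support (distr Q borel X)"
    and "Z \<equiv> \<lambda>N. observation Yp (R N) X"
    and "pbar \<equiv> \<lambda>N. measure Q {\<omega> \<in> space Q. R N \<omega> = 1}"
    and "a \<equiv> \<lambda>N. inverse (\<integral>\<omega>. inverse (\<pi> N (X \<omega>)) \<partial>Q)"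
    and "\<theta> \<equiv> \<lambda>r. \<integral>\<omega>. Yp r \<omega> \<partial>Q"
    and "data \<equiv> \<lambda>N \<omega> i. Zs N i \<omega>"
    and "folds \<equiv> \<lambda>N \<omega> k. I N k \<omega>"
    and "mh \<equiv> \<lambda>r N k \<omega>. fold_fit (mhat r N) N (I N k \<omega>) (\<lambda>i. Zs N i \<omega>)"
    and "ph \<equiv> \<lambda>N k \<omega>. fold_fit (pihat N) N (I N k \<omega>) (\<lambda>i. Zs N i \<omega>)"
    and "m_ok \<equiv> \<lambda>r. AE x in distr Q borel X. \<mu> r x = m r x"
    and "e_ok \<equiv> \<lambda>N. AE x in distr Q borel X. e N x = \<pi> N x"
  assumes model: "causal_model Q X Yp R m \<pi>"
    and basic: "basic_assumption Q X Yp R m \<mu>"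
    and limits: "\<forall>r\<in>{0,1}. \<mu> r \<in> borel_measurable borel" "\<forall>N\<ge>1. e N \<in> borel_measurable borel"
    and sample: "\<forall>N\<ge>1. prob_space (M N) \<and> iid_copies (M N) {1..N} (Zs N) Q (Z N)"
    and folds: "K \<ge> 2" "\<forall>N\<ge>1. random_partition (M N) N K (I N) (Zs N)"
    and estimators: "\<forall>N\<ge>1. (\<forall>r\<in>{0,1}. measurable_estimator N (mhat r N)) \<and> measurable_estimator N (pihat N)"
    \<comment> \<open>(i)\<close>
    and overlap: "pbar \<longlonglongrightarrow> 0" "filterlim (\<lambda>N. real N * pbar N) at_top sequentially"
      "c > 0" "C > 0"
      "\<forall>N\<ge>1. \<forall>x\<in>\<X>. c * pbar N < \<pi> N x \<and> \<pi> N x < C * pbar N \<and> c * pbar N < e N x \<and> e N x < C * pbar N"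
    and eps: "\<exists>B::real. \<forall>N\<ge>1.
      L2norm Q (\<lambda>\<omega>. obsY (Z N \<omega>) - R N \<omega> * m 1 (X \<omega>) - (1 - R N \<omega>) * m 0 (X \<omega>)) \<le> ereal B"
    and m0: "L2norm PX (\<lambda>x. m 0 x - \<mu> 0 x) < \<infinity>"
      "integrable Q (\<lambda>\<omega>. (m 0 (X \<omega>) - (\<integral>\<omega>'. m 0 (X \<omega>') \<partial>Q))\<^sup>2)"
    and rates: "\<forall>N\<ge>1. r\<mu> 0 N > 0 \<and> r\<mu> 1 N > 0 \<and> re N > 0"
      "r\<mu> 0 \<in> o(\<lambda>_. 1)" "r\<mu> 1 \<in> o(\<lambda>_. 1)" "re \<in> o(\<lambda>_. 1)"
    and mhat0: "\<forall>k\<in>{1..K}. bigOp M (\<lambda>N \<omega>. L2norm PX (\<lambda>x. mh 0 N k \<omega> x - \<mu> 0 x)) (r\<mu> 0)"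
    and pihat: "\<forall>k\<in>{1..K}. bigOp M (\<lambda>N \<omega>. SUP x\<in>\<X>. ereal \<bar>(ph N k \<omega> x - e N x) / pbar N\<bar>) re"
    \<comment> \<open>(ii)\<close>
    and one_correct: "(\<forall>N\<ge>1. e_ok N) \<or> m_ok 1"
    and mhat1: "\<forall>k\<in>{1..K}. bigOp M (\<lambda>N \<omega>. L2norm PX (\<lambda>x. mh 1 N k \<omega> x - \<mu> 1 x)) (r\<mu> 1)"
      "\<forall>k\<in>{1..K}. littleop M (\<lambda>N \<omega>. enn2ereal
        (\<integral>\<^sup>+x. ennreal (a N / \<pi> N x * (mh 1 N k \<omega> x - \<mu> 1 x)\<^sup>2) \<partial>PX)) (\<lambda>_. 1)"
    and pihat_int: "\<forall>k\<in>{1..K}. littleop M (\<lambda>N \<omega>. enn2ereal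
        (\<integral>\<^sup>+x. ennreal (a N / \<pi> N x * (1 - e N x / ph N k \<omega> x)\<^sup>2) \<partial>PX)) (\<lambda>_. 1)"
      "\<forall>k\<in>{1..K}. bigOp M (\<lambda>N \<omega>. enn2ereal
        (\<integral>\<^sup>+x. ennreal ((1 - e N x / ph N k \<omega> x)\<^sup>2) \<partial>PX)) (\<lambda>N. (re N)\<^sup>2)"
    and misspec: "(\<forall>N\<ge>1. e_ok N) \<longrightarrow> L2norm PX (\<lambda>x. m 1 x - \<mu> 1 x) < \<infinity>"
      "m_ok 1 \<longrightarrow> (\<exists>B::real. \<forall>N\<ge>1. L2norm PX (\<lambda>x. 1 - \<pi> N x / e N x) \<le> ereal B)"
  shows
    "let \<psi> = (\<lambda>N. psi1 (\<theta> 1) (\<mu> 1) (e N));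
         \<Delta>e = (\<lambda>N \<omega>. drift_e N K (\<pi> N) (\<mu> 1) (m 1) (pihat N) (folds N \<omega>) (data N \<omega>));
         \<Delta>m = (\<lambda>N \<omega>. drift_m N K (\<pi> N) (e N) (m 1) (mhat 1 N) (folds N \<omega>) (data N \<omega>));
         err = (\<lambda>N \<omega>. theta_hat_ATE N K (mhat 0 N) (mhat 1 N) (pihat N) (folds N \<omega>) (data N \<omega>)
                        - (\<theta> 1 - \<theta> 0));
         lead = (\<lambda>N \<omega>. (\<Sum>i=1..N. \<psi> N (Zs N i \<omega>)) / real N)
     in
       (\<forall>N\<ge>1. integrable Q (\<lambda>\<omega>. \<psi> N (Z N \<omega>)) \<and> (\<integral>\<omega>. \<psi> N (Z N \<omega>) \<partial>Q) = 0) \<and>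
       (\<forall>N\<ge>1. integrable Q (\<lambda>\<omega>. (\<psi> N (Z N \<omega>))\<^sup>2)) \<and>
       (\<lambda>N. \<integral>\<omega>. (\<psi> N (Z N \<omega>))\<^sup>2 \<partial>Q) \<in> \<Theta>(\<lambda>N. inverse (pbar N)) \<and>
       ((\<forall>N\<ge>1. e_ok N) \<longrightarrow> bigOp M (\<lambda>N \<omega>. ereal (\<Delta>e N \<omega>)) re) \<and>
       (m_ok 1 \<longrightarrow> bigOp M (\<lambda>N \<omega>. ereal (\<Delta>m N \<omega>)) (r\<mu> 1)) \<and>
       (\<forall>\<Delta>. ((\<forall>N\<ge>1. e_ok N) \<and> \<Delta> = \<Delta>e) \<or> (m_ok 1 \<and> \<Delta> = \<Delta>m) \<longrightarrow>
         (\<exists>U1 U2 U3 U4 U5 :: nat \<Rightarrow> 'w \<Rightarrow> real.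
           bigOp M (\<lambda>N \<omega>. ereal (U1 N \<omega>)) (\<lambda>N. re N * r\<mu> 1 N + pbar N * re N * r\<mu> 0 N) \<and>
           bigOp M (\<lambda>N \<omega>. ereal (U2 N \<omega>)) (\<lambda>N. pbar N * re N) \<and>
           bigOp M (\<lambda>N \<omega>. ereal (U3 N \<omega>)) (\<lambda>N. pbar N * r\<mu> 0 N) \<and>
           bigOp M (\<lambda>N \<omega>. ereal (U4 N \<omega>)) pbar \<and>
           littleop M (\<lambda>N \<omega>. ereal (U5 N \<omega>)) (\<lambda>N. (real N * pbar N) powr (-1/2)) \<and>
           (\<forall>N\<ge>1. \<forall>\<omega>\<in>space (M N).
             err N \<omega> = lead N \<omega> + \<Delta> N \<omega> + U1 N \<omega>
               + of_bool (\<not> m_ok 0) * U2 N \<omega>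
               + of_bool (\<not> e_ok N) * U3 N \<omega>
               + of_bool (\<not> e_ok N \<and> \<not> m_ok 0) * U4 N \<omega>
               + U5 N \<omega>)) \<and>
         ((\<lambda>N. re N * r\<mu> 1 N) \<in> o(\<lambda>N. (real N * pbar N) powr (-1/2)) \<longrightarrow>
          (m_ok 0 \<and> (\<forall>N\<ge>1. e_ok N) \<and>
             (\<lambda>N. re N * r\<mu> 0 N) \<in> o(\<lambda>N. real N powr (-1/2) * pbar N powr (-3/2))) \<or>
          (\<not> m_ok 0 \<and> (\<forall>N\<ge>1. e_ok N) \<and>
             re \<in> o(\<lambda>N. real N powr (-1/2) * pbar N powr (-3/2))) \<or>
          (m_ok 0 \<and> \<not> (\<forall>N\<ge>1. e_ok N) \<and>
             r\<mu> 0 \<in> o(\<lambda>N. real N powr (-1/2) * pbar N powr (-3/2))) \<or>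
          (\<not> m_ok 0 \<and> \<not> (\<forall>N\<ge>1. e_ok N) \<and> (\<lambda>N. real N * pbar N ^ 3) \<in> o(\<lambda>_. 1)) \<longrightarrow>
          (\<exists>V :: nat \<Rightarrow> 'w \<Rightarrow> real.
             littleop M (\<lambda>N \<omega>. ereal (V N \<omega>)) (\<lambda>N. (real N * pbar N) powr (-1/2)) \<and>
             (\<forall>N\<ge>1. \<forall>\<omega>\<in>space (M N). err N \<omega> = lead N \<omega> + V N \<omega> + \<Delta> N \<omega>))))"
proof -
  note defs = PX_def \<X>_def Z_def pbar_def a_def \<theta>_def data_def folds_def mh_def ph_def m_ok_def e_ok_def
  \<comment> \<open>Outcomes and covariates do not depend on \<open>N\<close>, only the treatment
    does, so one pair of moment bounds serves all sample sizes.\<close>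
  obtain s1 s2 :: real where s: "s1 > 0" "s2 > 0" "\<forall>r\<in>{0,1}.
      (AE \<omega> in Q. nn_cond_exp Q (sigma_of Q X) (\<lambda>\<omega>. ennreal ((Yp r \<omega> - m r (X \<omega>))\<^sup>2)) \<omega> \<ge> ennreal s1) \<and>
      (AE \<omega> in Q. nn_cond_exp Q (sigma_of Q X) (\<lambda>\<omega>. ennreal ((Yp r \<omega> - \<mu> r (X \<omega>))\<^sup>2)) \<omega> \<le> ennreal s2)"
    using basic unfolding basic_assumption_def by blast
  have sq: "integrable Q (\<lambda>\<omega>. (Yp r \<omega>)\<^sup>2)" if "r \<in> {0,1}" for r
    using basic that unfolding basic_assumption_def by blast
  interpret ate_setting Q X Yp R m \<mu> \<pi> e M Zs K I mhat pihat r\<mu> re c C s1 s2 PX \<X> Z pbar a \<theta> mh ph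
  proof (rule ate_setting.intro)
    fix r :: nat assume r: "r \<in> {0,1}"
    show "integrable Q (\<lambda>\<omega>. (Yp r \<omega>)\<^sup>2)" by (rule sq[OF r])
    show "AE \<omega> in Q. nn_cond_exp Q (sigma_of Q X) (\<lambda>\<omega>. ennreal ((Yp r \<omega> - m r (X \<omega>))\<^sup>2)) \<omega> \<ge> ennreal s1"
      "AE \<omega> in Q. nn_cond_exp Q (sigma_of Q X) (\<lambda>\<omega>. ennreal ((Yp r \<omega> - \<mu> r (X \<omega>))\<^sup>2)) \<omega> \<le> ennreal s2"
      using s(3) r by blast+
  qed (fact s(1,2) model limits sample folds(2) estimators overlap m0(2) rates mhat0 pihat mhat1 pihat_int(2) |
      (simp only: defs; fail))+
  have ok: "(AE x in distr Q borel X. e N x = \<pi> N x) \<or> (AE x in distr Q borel X. \<mu> 1 x = m 1 x)" if "N \<ge> 1" for N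
    using one_correct that unfolding e_ok_def m_ok_def by blast
  note \<psi> = psi1_moments[OF _ ok]
  have theta: "(\<lambda>N. \<integral>\<omega>. (psi1 (\<theta> 1) (\<mu> 1) (e N) (Z N \<omega>))\<^sup>2 \<partial>Q) \<in> \<Theta>(\<lambda>N. inverse (pbar N))"
  proof (rule bigthetaI)
    show "(\<lambda>N. \<integral>\<omega>. (psi1 (\<theta> 1) (\<mu> 1) (e N) (Z N \<omega>))\<^sup>2 \<partial>Q) \<in> O(\<lambda>N. inverse (pbar N))"
    proof (rule bigoI[OF eventually_mono[OF eventually_ge_at_top[of 1]]])
      fix N :: nat assume N: "1 \<le> N"
      show "norm (\<integral>\<omega>. (psi1 (\<theta> 1) (\<mu> 1) (e N) (Z N \<omega>))\<^sup>2 \<partial>Q) \<le>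
          3 * ((\<integral>\<omega>. (\<mu> 1 (X \<omega>) - \<theta> 1)\<^sup>2 \<partial>Q) + 5 * s2 * (C / c\<^sup>2)) * norm (inverse (pbar N))"
        using \<psi>(4)[OF N N] pbar_pos[OF N] by simp
    qed
    \<comment> \<open>The constant of the lower bound must be positive and free of \<open>N\<close>;
      it comes from overlap and the noise level \<open>s1\<close> alone.\<close>
    have "s1 * (c / C\<^sup>2) > 0" using s overlap by simp
    then show "(\<lambda>N. \<integral>\<omega>. (psi1 (\<theta> 1) (\<mu> 1) (e N) (Z N \<omega>))\<^sup>2 \<partial>Q) \<in> \<Omega>(\<lambda>N. inverse (pbar N))"
    proof (rule landau_omega.bigI[OF _ eventually_mono[OF eventually_ge_at_top[of 1]]])
      fix N :: nat assume N: "1 \<le> N"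
      show "norm (\<integral>\<omega>. (psi1 (\<theta> 1) (\<mu> 1) (e N) (Z N \<omega>))\<^sup>2 \<partial>Q) \<ge> s1 * (c / C\<^sup>2) * norm (inverse (pbar N))"
        using \<psi>(5)[OF N N] pbar_pos[OF N] by simp
    qed
  qed
  have drift: "drift_e N K (\<pi> N) (\<mu> 1) (m 1) (pihat N) (fold_map N \<omega>) (sample_data N \<omega>) = cross_avg ps_drift N \<omega>"
    "drift_m N K (\<pi> N) (e N) (m 1) (mhat 1 N) (fold_map N \<omega>) (sample_data N \<omega>) = cross_avg reg_drift N \<omega>" for N \<omega>
    by (simp_all only: drift_e_def drift_m_def cross_mean_def fold_stat_def cross_fit_def fold_fit_def ps_drift_def reg_drift_def)
  have \<Delta>e: "bigOp M (\<lambda>N \<omega>. ereal (drift_e N K (\<pi> N) (\<mu> 1) (m 1) (pihat N) (folds N \<omega>) (data N \<omega>))) re"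
    if "\<forall>N\<ge>1. e_ok N"
    unfolding folds_def data_def drift by (rule ps_drift_rate) (use that in \<open>unfold e_ok_def PX_def, blast\<close>)
  have \<Delta>m: "bigOp M (\<lambda>N \<omega>. ereal (drift_m N K (\<pi> N) (e N) (m 1) (mhat 1 N) (folds N \<omega>) (data N \<omega>))) (r\<mu> 1)"
    if "m_ok 1"
    unfolding folds_def data_def drift by (rule reg_drift_rate) (use that in \<open>unfold m_ok_def PX_def\<close>)
  show ?thesis
    unfolding Let_def
    by (intro conjI allI impI)
      ((rule \<psi>(1-3) theta \<Delta>e \<Delta>m; assumption)+,
        unfold folds_def data_def m_ok_def e_ok_def, (rule expansion remainder; assumption)+)
qed

end
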